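(* Let $M=G/H$ be a homogeneous space of a compact connected Lie group $G$ with reductive decomposition $\mathfrak g=\mathfrak h+\mathfrak m$. Assume that the Lie algebra $\mathfrak g$ has two subalgebras $\mathfrak k=\mathfrak h+\mathfrak p$ and $\mathfrak k'=\mathfrak h+\mathfrak p'$ (with $\mathfrak p=\mathfrak k\cap\mathfrak m$, $\mathfrak p'=\mathfrak k'\cap\mathfrak m$) which contain $\mathfrak h$ and generate $\mathfrak g$. Let $$\mathfrak m=\mathfrak q+\mathfrak p_1+\mathfrak p_2+\mathfrak n,\qquad \mathfrak q=\mathfrak p\cap\mathfrak p',$$ be the associated $b$-orthogonal decomposition, in which $\mathfrak p=\mathfrak q+\mathfrak p_1$, $\mathfrak p'=\mathfrak q+\mathfrak p_2$, and $\mathfrak n$ is the orthogonal complement of $\mathfrak p+\mathfrak p'$ in $\mathfrak m$. Assume that there are no commuting $\mathrm{ad}_{\mathfrak h+\mathfrak q}$-submodules of $\mathfrak p_1$ and $\mathfrak p_2$, i.e. there are no non-zero $\mathrm{ad}_{\mathfrak h+\mathfrak q}$-submodules $\mathfrak p_1'\subset\mathfrak p_1$, $\mathfrak p_2'\subset\mathfrak p_2$ with $[\mathfrak p_1',\mathfrak p_2']=0$. Then for any GO-metric on $M$ defined by a metric endomorphism $A$ which preserves this decomposition, $A$ is a scalar operator on $\mathfrak p_1+\mathfrak p_2+\mathfrak n$. In particular, if $\mathfrak q$ is trivial and the $\mathrm{Ad}_H$-modules $\mathfrak p_1,\mathfrak p_2,\mathfrak n$ are strictly non-equivalent (pairwise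 disjoint: no two of them have equivalent non-zero submodules), then the only GO-metric on $M$ is the normal metric (the one whose metric endomorphism is a scalar operator).
   Context: $H\subset G$ is a closed subgroup with Lie algebra $\mathfrak h$; $b=\langle\cdot,\cdot\rangle$ is a fixed $\mathrm{Ad}_G$-invariant Euclidean metric on $\mathfrak g$; $\mathfrak g=\mathfrak h+\mathfrak m$ is the $b$-orthogonal decomposition, with $\mathfrak m$ identified with $T_oM$, $o=eH$. A $G$-invariant Riemannian metric $g^M$ on $M$ corresponds to an $\mathrm{Ad}_H$-invariant Euclidean metric $g$ on $\mathfrak m$; its metric endomorphism $A$ is the $\mathrm{Ad}_H$-equivariant, $b$-symmetric positive definite endomorphism of $\mathfrak m$ with $g(X,Y)=b(AX,Y)$. The metric $g^M$ is a GO-metric if every geodesic of $(M,g^M)$ is an orbit of a one-parameter subgroup of $G$.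
   Formalization: The two subalgebras k and k' are additionally assumed to be proper (neither equals g); without this the claim fails, e.g. for S^5 = SU(3)/SU(2) with k = h and k' = g, where non-normal GO-metrics exist. *)

theory Defs
  imports "HOL-Analysis.Analysis" "HOL-Algebra.Left_Coset"
begin

section \<open>Smooth maps between open subsets of normed spaces\<close>

text \<open>Both notions are meant for open sets \<open>S\<close> of finite-dimensional spaces only.\<close>

primrec Ck_on :: "nat \<Rightarrow> 'd::real_normed_vector set \<Rightarrow> ('d \<Rightarrow> 'e::real_normed_vector) \<Rightarrow> bool" where
  "Ck_on 0 S f \<longleftrightarrow> continuous_on S f"
| "Ck_on (Suc k) S f \<longleftrightarrow>
     f differentiable_on S \<and> (\<forall>v. Ck_on k S (\<lambda>x. frechet_derivative f (at x) v))"

definition smooth_on :: "'d::real_normed_vector set \<Rightarrow> ('d \<Rightarrow> 'e::real_normed_vector) \<Rightarrow> bool" where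
  "smooth_on S f \<longleftrightarrow> (\<forall>k. Ck_on k S f)"


section \<open>Abstract Lie groups\<close>

text \<open>
  A chart is a pair of a domain and a coordinate map into the Euclidean space \<open>'e\<close>. The
  \<open>base_chart\<close> is an arbitrary chart around the identity; it identifies the tangent space at the
  identity, hence the Lie algebra, with \<open>'e\<close>. The topology of the group is the one that
  the carrier inherits from the type \<open>'a\<close>.
\<close>

type_synonym ('a, 'e) chart = "'a set \<times> ('a \<Rightarrow> 'e)"

record ('a, 'e) lie_structure = "'a monoid" +
  atlas :: "('a, 'e) chart set"
  base_chart :: "('a, 'e) chart"

definition smooth_atlas ::
    "'a::t2_space set \<Rightarrow> ('a, 'e::euclidean_space) chart set \<Rightarrow> bool" where
  "smooth_atlas S \<A> \<longleftrightarrow>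
     (\<Union>(U, \<phi>)\<in>\<A>. U) = S \<and>
     (\<forall>(U, \<phi>)\<in>\<A>. openin (top_of_set S) U \<and> open (\<phi> ` U) \<and>
        homeomorphism U (\<phi> ` U) \<phi> (inv_into U \<phi>)) \<and>
     (\<forall>(U, \<phi>)\<in>\<A>. \<forall>(V, \<psi>)\<in>\<A>. smooth_on (\<phi> ` (U \<inter> V)) (\<lambda>x. \<psi> (inv_into U \<phi> x)))"

definition lie_group :: "('a::t2_space, 'e::euclidean_space) lie_structure \<Rightarrow> bool" where
  "lie_group G \<longleftrightarrow>
     group G \<and>
     second_countable (top_of_set (carrier G)) \<and>
     smooth_atlas (carrier G) (atlas G) \<and>
     base_chart G \<in> atlas G \<and> \<one>\<^bsub>G\<^esub> \<in> fst (base_chart G) \<and>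
     continuous_on (carrier G \<times> carrier G) (\<lambda>(x, y). x \<otimes>\<^bsub>G\<^esub> y) \<and>
     continuous_on (carrier G) (\<lambda>x. inv\<^bsub>G\<^esub> x) \<and>
     (\<forall>(U, \<phi>)\<in>atlas G. \<forall>(V, \<psi>)\<in>atlas G. \<forall>(W, \<theta>)\<in>atlas G.
        smooth_on {(x, y). x \<in> \<phi> ` U \<and> y \<in> \<psi> ` V \<and> inv_into U \<phi> x \<otimes>\<^bsub>G\<^esub> inv_into V \<psi> y \<in> W}
          (\<lambda>(x, y). \<theta> (inv_into U \<phi> x \<otimes>\<^bsub>G\<^esub> inv_into V \<psi> y))) \<and>
     (\<forall>(U, \<phi>)\<in>atlas G. \<forall>(W, \<theta>)\<in>atlas G.
        smooth_on {x \<in> \<phi> ` U. inv\<^bsub>G\<^esub> (inv_into U \<phi> x) \<in> W}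
          (\<lambda>x. \<theta> (inv\<^bsub>G\<^esub> (inv_into U \<phi> x))))"

definition smooth_into ::
    "('a::t2_space, 'e::euclidean_space) lie_structure \<Rightarrow> 'd::euclidean_space set \<Rightarrow> ('d \<Rightarrow> 'a) \<Rightarrow> bool"
  where
  "smooth_into G D f \<longleftrightarrow>
     f ` D \<subseteq> carrier G \<and> continuous_on D f \<and>
     (\<forall>(U, \<phi>)\<in>atlas G. smooth_on (D \<inter> f -` U) (\<lambda>x. \<phi> (f x)))"


section \<open>The Lie algebra, in the coordinates of the base chart\<close>

abbreviation coord :: "('a, 'e) lie_structure \<Rightarrow> 'a \<Rightarrow> 'e" where
  "coord G \<equiv> snd (base_chart G)"

abbreviation coord_inv :: "('a, 'e) lie_structure \<Rightarrow> 'e \<Rightarrow> 'a" where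
  "coord_inv G \<equiv> inv_into (fst (base_chart G)) (coord G)"

text \<open>The left logarithmic derivative \<open>\<alpha>(t)\<inverse> \<alpha>'(t)\<close> of a curve in the group.\<close>

definition left_vel ::
    "('a::t2_space, 'e::euclidean_space) lie_structure \<Rightarrow> (real \<Rightarrow> 'a) \<Rightarrow> real \<Rightarrow> 'e" where
  "left_vel G \<alpha> t = vector_derivative (\<lambda>s. coord G (inv\<^bsub>G\<^esub> (\<alpha> t) \<otimes>\<^bsub>G\<^esub> \<alpha> s)) (at t)"

definition Ad ::
    "('a::t2_space, 'e::euclidean_space) lie_structure \<Rightarrow> 'a \<Rightarrow> 'e \<Rightarrow> 'e" where
  "Ad G g =
     frechet_derivative (\<lambda>x. coord G (g \<otimes>\<^bsub>G\<^esub> coord_inv G x \<otimes>\<^bsub>G\<^esub> inv\<^bsub>G\<^esub> g)) (at (coord G \<one>\<^bsub>G\<^esub>))"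

text \<open>
  The bracket is \<open>ad = d(Ad)\<close> at the identity, i.e. the bracket of left-invariant vector fields;
  \<open>t \<mapsto> coord_inv G (coord G \<one> + t X)\<close> is a curve through the identity with velocity \<open>X\<close>.
\<close>

definition bracket ::
    "('a::t2_space, 'e::euclidean_space) lie_structure \<Rightarrow> 'e \<Rightarrow> 'e \<Rightarrow> 'e" where
  "bracket G X Y =
     vector_derivative (\<lambda>t. Ad G (coord_inv G (coord G \<one>\<^bsub>G\<^esub> + t *\<^sub>R X)) Y) (at 0)"

definition one_param_subgroup ::
    "('a::t2_space, 'e::euclidean_space) lie_structure \<Rightarrow> (real \<Rightarrow> 'a) \<Rightarrow> bool" where
  "one_param_subgroup G \<gamma> \<longleftrightarrow>
     smooth_into G UNIV \<gamma> \<and> (\<forall>s t. \<gamma> (s + t) = \<gamma> s \<otimes>\<^bsub>G\<^esub> \<gamma> t)"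

text \<open>The Lie algebra \<open>{X. \<forall>t. exp (t X) \<in> H}\<close> of a closed subgroup \<open>H\<close>.\<close>

definition lie_algebra_of ::
    "('a::t2_space, 'e::euclidean_space) lie_structure \<Rightarrow> 'a set \<Rightarrow> 'e set" where
  "lie_algebra_of G H = {left_vel G \<gamma> 0 |\<gamma>. one_param_subgroup G \<gamma> \<and> range \<gamma> \<subseteq> H}"

definition lie_subalgebra ::
    "('a::t2_space, 'e::euclidean_space) lie_structure \<Rightarrow> 'e set \<Rightarrow> bool" where
  "lie_subalgebra G \<kk> \<longleftrightarrow> subspace \<kk> \<and> (\<forall>X\<in>\<kk>. \<forall>Y\<in>\<kk>. bracket G X Y \<in> \<kk>)"

definition generate_lie_algebra ::
    "('a::t2_space, 'e::euclidean_space) lie_structure \<Rightarrow> 'e set \<Rightarrow> bool" where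
  "generate_lie_algebra G S \<longleftrightarrow> (\<forall>\<kk>. lie_subalgebra G \<kk> \<and> S \<subseteq> \<kk> \<longrightarrow> \<kk> = UNIV)"


section \<open>Invariant inner products, modules, metric endomorphisms\<close>

definition linear_on :: "'e::real_vector set \<Rightarrow> ('e \<Rightarrow> 'e) \<Rightarrow> bool" where
  "linear_on V f \<longleftrightarrow>
     (\<forall>X\<in>V. \<forall>Y\<in>V. f (X + Y) = f X + f Y) \<and> (\<forall>r. \<forall>X\<in>V. f (r *\<^sub>R X) = r *\<^sub>R f X)"

definition Ad_invariant_inner ::
    "('a::t2_space, 'e::euclidean_space) lie_structure \<Rightarrow> ('e \<Rightarrow> 'e \<Rightarrow> real) \<Rightarrow> bool" where
  "Ad_invariant_inner G b \<longleftrightarrow>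
     bilinear b \<and> (\<forall>X Y. b X Y = b Y X) \<and> (\<forall>X. X \<noteq> 0 \<longrightarrow> b X X > 0) \<and>
     (\<forall>g\<in>carrier G. \<forall>X Y. b (Ad G g X) (Ad G g Y) = b X Y)"

definition orth_complement :: "('e \<Rightarrow> 'e \<Rightarrow> real) \<Rightarrow> 'e set \<Rightarrow> 'e set" where
  "orth_complement b V = {X. \<forall>Y\<in>V. b X Y = 0}"

definition orth_decomposition ::
    "('e::real_vector \<Rightarrow> 'e \<Rightarrow> real) \<Rightarrow> 'e set \<Rightarrow> 'e set list \<Rightarrow> bool" where
  "orth_decomposition b V Ws \<longleftrightarrow>
     (\<forall>W\<in>set Ws. subspace W) \<and> V = span (\<Union>(set Ws)) \<and>
     (\<forall>i j. i < length Ws \<and> j < length Ws \<and> i \<noteq> j \<longrightarrow> (\<forall>X\<in>Ws ! i. \<forall>Y\<in>Ws ! j. b X Y = 0))"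

definition ad_submodule ::
    "('a::t2_space, 'e::euclidean_space) lie_structure \<Rightarrow> 'e set \<Rightarrow> 'e set \<Rightarrow> bool" where
  "ad_submodule G \<ll> V \<longleftrightarrow> subspace V \<and> (\<forall>Z\<in>\<ll>. \<forall>X\<in>V. bracket G Z X \<in> V)"

definition Ad_submodule ::
    "('a::t2_space, 'e::euclidean_space) lie_structure \<Rightarrow> 'a set \<Rightarrow> 'e set \<Rightarrow> bool" where
  "Ad_submodule G H V \<longleftrightarrow> subspace V \<and> (\<forall>h\<in>H. \<forall>X\<in>V. Ad G h X \<in> V)"

definition Ad_equivalent ::
    "('a::t2_space, 'e::euclidean_space) lie_structure \<Rightarrow> 'a set \<Rightarrow> 'e set \<Rightarrow> 'e set \<Rightarrow> bool" where
  "Ad_equivalent G H V W \<longleftrightarrow>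
     (\<exists>f. linear_on V f \<and> bij_betw f V W \<and> (\<forall>h\<in>H. \<forall>X\<in>V. f (Ad G h X) = Ad G h (f X)))"

definition strictly_nonequivalent ::
    "('a::t2_space, 'e::euclidean_space) lie_structure \<Rightarrow> 'a set \<Rightarrow> 'e set \<Rightarrow> 'e set \<Rightarrow> bool" where
  "strictly_nonequivalent G H V W \<longleftrightarrow>
     \<not> (\<exists>V' W'. V' \<subseteq> V \<and> W' \<subseteq> W \<and> V' \<noteq> {0} \<and> W' \<noteq> {0} \<and>
          Ad_submodule G H V' \<and> Ad_submodule G H W' \<and> Ad_equivalent G H V' W')"

definition metric_endomorphism ::
    "('a::t2_space, 'e::euclidean_space) lie_structure \<Rightarrow> 'a set \<Rightarrow> ('e \<Rightarrow> 'e \<Rightarrow> real) \<Rightarrow> 'e set \<Rightarrow>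
     ('e \<Rightarrow> 'e) \<Rightarrow> bool" where
  "metric_endomorphism G H b \<mm> A \<longleftrightarrow>
     A ` \<mm> \<subseteq> \<mm> \<and> linear_on \<mm> A \<and>
     (\<forall>X\<in>\<mm>. \<forall>Y\<in>\<mm>. b (A X) Y = b X (A Y)) \<and>
     (\<forall>X\<in>\<mm>. X \<noteq> 0 \<longrightarrow> b (A X) X > 0) \<and>
     (\<forall>h\<in>H. \<forall>X\<in>\<mm>. A (Ad G h X) = Ad G h (A X))"

definition endo_metric :: "('e \<Rightarrow> 'e \<Rightarrow> real) \<Rightarrow> ('e \<Rightarrow> 'e) \<Rightarrow> 'e \<Rightarrow> 'e \<Rightarrow> real" where
  "endo_metric b A X Y = b (A X) Y"

definition scalar_on :: "'e::real_vector set \<Rightarrow> ('e \<Rightarrow> 'e) \<Rightarrow> bool" where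
  "scalar_on V A \<longleftrightarrow> (\<exists>c. \<forall>X\<in>V. A X = c *\<^sub>R X)"


section \<open>The homogeneous space and its geodesics\<close>

text \<open>
  Points of \<open>M = G/H\<close> are left cosets. As the projection \<open>G \<rightarrow> M\<close> is a smooth submersion (and so
  has smooth local sections), a map from an open set into \<open>M\<close> is smooth iff it lifts locally to
  a smooth map into \<open>G\<close>.
\<close>

definition smooth_into_quot ::
    "('a::t2_space, 'e::euclidean_space) lie_structure \<Rightarrow> 'a set \<Rightarrow> 'd::euclidean_space set \<Rightarrow>
     ('d \<Rightarrow> 'a set) \<Rightarrow> bool" where
  "smooth_into_quot G H D F \<longleftrightarrow>
     (\<forall>x\<in>D. \<exists>W f. open W \<and> x \<in> W \<and> W \<subseteq> D \<and> smooth_into G W f \<and> (\<forall>y\<in>W. F y = f y <#\<^bsub>G\<^esub> H))"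

text \<open>The projection onto \<open>\<mm>\<close> along \<open>\<hh>\<close>, where the Lie algebra is the direct sum of \<open>\<hh>\<close> and \<open>\<mm>\<close>.\<close>

definition proj_m :: "'e::real_vector set \<Rightarrow> 'e set \<Rightarrow> 'e \<Rightarrow> 'e" where
  "proj_m \<hh> \<mm> X = (THE Y. Y \<in> \<mm> \<and> X - Y \<in> \<hh>)"

text \<open>
  In the rest of this section \<open>g\<close> is an \<open>Ad H\<close>-invariant inner product on \<open>\<mm>\<close>, the tangent space of
  \<open>M\<close> at the base point. The squared speed of a curve \<open>c\<close> in \<open>M\<close>, for the invariant
  Riemannian metric extending \<open>g\<close>: if \<open>c(s) = \<alpha>(s) H\<close> near \<open>t\<close>, translation by \<open>\<alpha>(t)\<inverse>\<close> takes the
  velocity of \<open>c\<close> at \<open>t\<close> to the \<open>\<mm>\<close>-part of \<open>\<alpha>(t)\<inverse> \<alpha>'(t)\<close>. By invariance of \<open>g\<close> the value does not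
  depend on the lift \<open>\<alpha>\<close>.
\<close>

definition speed_sq ::
    "('a::t2_space, 'e::euclidean_space) lie_structure \<Rightarrow> 'a set \<Rightarrow> 'e set \<Rightarrow> ('e \<Rightarrow> 'e \<Rightarrow> real) \<Rightarrow>
     (real \<Rightarrow> 'a set) \<Rightarrow> real \<Rightarrow> real" where
  "speed_sq G H \<mm> g c t =
     (THE r. \<exists>W \<alpha>. open W \<and> t \<in> W \<and> smooth_into G W \<alpha> \<and> (\<forall>s\<in>W. c s = \<alpha> s <#\<^bsub>G\<^esub> H) \<and>
        (let X = proj_m (lie_algebra_of G H) \<mm> (left_vel G \<alpha> t) in r = g X X))"

definition energy ::
    "('a::t2_space, 'e::euclidean_space) lie_structure \<Rightarrow> 'a set \<Rightarrow> 'e set \<Rightarrow> ('e \<Rightarrow> 'e \<Rightarrow> real) \<Rightarrow>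
     real \<Rightarrow> real \<Rightarrow> (real \<Rightarrow> 'a set) \<Rightarrow> real" where
  "energy G H \<mm> g t0 t1 c = integral {t0..t1} (speed_sq G H \<mm> g c) / 2"

text \<open>
  Geodesics (in affine parametrisation) on an open interval \<open>I\<close>: the critical points of the energy
  of all compact subintervals, with respect to smooth variations with fixed end points.
\<close>

definition geodesic ::
    "('a::t2_space, 'e::euclidean_space) lie_structure \<Rightarrow> 'a set \<Rightarrow> 'e set \<Rightarrow> ('e \<Rightarrow> 'e \<Rightarrow> real) \<Rightarrow>
     real set \<Rightarrow> (real \<Rightarrow> 'a set) \<Rightarrow> bool" where
  "geodesic G H \<mm> g I c \<longleftrightarrow>
     open I \<and> is_interval I \<and> smooth_into_quot G H I c \<and>
     (\<forall>t0 t1 \<epsilon> V.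
        t0 < t1 \<and> {t0..t1} \<subseteq> I \<and> \<epsilon> > 0 \<and>
        smooth_into_quot G H ({-\<epsilon><..<\<epsilon>} \<times> I) V \<and>
        (\<forall>t\<in>I. V (0, t) = c t) \<and>
        (\<forall>s\<in>{-\<epsilon><..<\<epsilon>}. V (s, t0) = c t0 \<and> V (s, t1) = c t1) \<longrightarrow>
        ((\<lambda>s. energy G H \<mm> g t0 t1 (\<lambda>t. V (s, t))) has_real_derivative 0) (at 0))"

definition GO_metric ::
    "('a::t2_space, 'e::euclidean_space) lie_structure \<Rightarrow> 'a set \<Rightarrow> 'e set \<Rightarrow> ('e \<Rightarrow> 'e \<Rightarrow> real) \<Rightarrow>
     bool" where
  "GO_metric G H \<mm> g \<longleftrightarrow>
     (\<forall>I c. geodesic G H \<mm> g I c \<longrightarrow>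
        (\<exists>\<gamma> x. one_param_subgroup G \<gamma> \<and> x \<in> lcosets\<^bsub>G\<^esub> H \<and> (\<forall>t\<in>I. c t = \<gamma> t <#\<^bsub>G\<^esub> x)))"

end

theory Submission
  imports Defs
begin

text \<open>
  For a curve \<open>\<alpha>(t)H\<close> with left velocity \<open>\<xi> = \<alpha>\<inverse> \<alpha>'\<close>, the momentum \<open>Ad(\<alpha>) A \<xi>\<^sub>\<mm>\<close> does not depend on the
  lift \<open>\<alpha>\<close>, and the curve is a geodesic iff its momentum is constant. Hence the metric is a GO-metric
  only if for every \<open>X \<in> \<mm>\<close> there is \<open>Z \<in> \<hh>\<close> with \<open>[X + Z, A X] = 0\<close>. Conversely, if \<open>A = \<kappa>\<close> is a scalar and
  \<open>P\<close> is the momentum of a geodesic, then multiplying its lift by \<open>exp(-t P/\<kappa>)\<close> makes the left velocity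
  \<open>\<hh>\<close>-valued, so that the geodesic is the orbit of \<open>exp(t P/\<kappa>)\<close>.

  Applied to \<open>X + Y\<close>, for eigenvectors \<open>X\<close> and \<open>Y\<close> of \<open>A\<close> with different eigenvalues, the condition gives
  \<open>[X, Y] \<in> [\<hh>, X] + [\<hh>, Y]\<close>. Thus the eigenspaces of \<open>A\<close> in \<open>\<pp>1\<close>, \<open>\<pp>2\<close> and \<open>\<nn>\<close> are \<open>ad(\<hh> + \<qq>)\<close>-submodules,
  and eigenspaces in \<open>\<pp>1\<close> and \<open>\<pp>2\<close> with different eigenvalues commute, which is excluded. So \<open>A\<close> is a
  scalar \<open>\<lambda>\<close> on \<open>\<pp>1 + \<pp>2\<close>. An eigenspace in \<open>\<nn>\<close> for \<open>\<mu> \<noteq> \<lambda>\<close> is normalised by both subalgebras, hence an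
  ideal; its orthogonal complement is a subalgebra containing both, so it is zero.
\<close>

section \<open>Smooth maps\<close>

text \<open>Geodesics are defined as critical points of the energy and points of \<open>M\<close>
  are cosets, so the arguments use no connection and no charts of \<open>M\<close>: everything runs
  through local lifts to \<open>G\<close>, and independence of the lift is the recurring obligation.
  The momentum is the conserved quantity that Noether's theorem attaches to the left action of
  \<open>G\<close>. Along a variation with right velocity \<zeta>, the first variation of the energy
  is the integral of its pairing with the derivative of \<zeta>. Along an orbit of
  \<open>exp(t W)\<close> with \<open>W = X + Z\<close> it equals \<open>Ad(exp(t W)) A X\<close>,
  and differentiating this constant at 0 gives the bracket condition.

  Two facts link lifts to cosets: velocities of curves in \<open>H\<close> lie in \<hh>, and a curve
  whose left velocities lie in \<hh> stays in one coset.

  Eigenspaces are submodules because \<open>ad\<close> is skew: for \<open>W\<close> in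
  \<open>\<hh> + \<qq>\<close> and eigenvectors \<open>X\<close>, \<open>Y\<close> of one piece with
  different eigenvalues, \<open><[W, X], Y> = <W, [X, Y]>\<close>, and \<open>[X, Y]\<close> remains
  in that piece, which is orthogonal to \<open>W\<close>.\<close>

lemma frechet_derivative_cong_open:
  assumes "open S" "x \<in> S" "\<And>y. y \<in> S \<Longrightarrow> f y = g y"
  shows "frechet_derivative f (at x) = frechet_derivative g (at x)"
proof -
  have "(f has_derivative D) (at x) = (g has_derivative D) (at x)" for D
    using has_derivative_transform_within_open[OF _ assms(1,2)] assms(3) by metis
  then show ?thesis unfolding frechet_derivative_def by simp
qed

lemma Ck_on_cong:
  assumes "open S" "\<And>x. x \<in> S \<Longrightarrow> f x = g x"
  shows "Ck_on k S f \<longleftrightarrow> Ck_on k S g"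
  using assms(2)
proof (induction k arbitrary: f g)
  case 0
  then show ?case by (simp cong: continuous_on_cong)
next
  case (Suc k)
  have "f differentiable_on S \<longleftrightarrow> g differentiable_on S"
    using Suc.prems by (auto simp: differentiable_on_def intro: differentiable_transform_within[where d=1])
  moreover have "Ck_on k S (\<lambda>x. frechet_derivative f (at x) v) \<longleftrightarrow> Ck_on k S (\<lambda>x. frechet_derivative g (at x) v)" for v
    by (rule Suc.IH) (simp add: frechet_derivative_cong_open[OF assms(1) _ Suc.prems])
  ultimately show ?case by simp
qed

text \<open>\<open>frechet_derivative\<close> is a choice operator; uniqueness of the derivative
  lets an explicit formula \<open>f'\<close> stand in for it. Closure under sums, products and
  composition goes through this rule.\<close>

lemma Ck_on_SucI:
  assumes "open S" "\<And>x. x \<in> S \<Longrightarrow> (f has_derivative f' x) (at x)" "\<And>v. Ck_on k S (\<lambda>x. f' x v)"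
  shows "Ck_on (Suc k) S f"
proof -
  have "f differentiable_on S"
    using assms(2) by (auto simp: differentiable_on_def differentiable_def intro: has_derivative_at_withinI)
  moreover have "Ck_on k S (\<lambda>x. frechet_derivative f (at x) v)" for v
    using assms(3)[of v] Ck_on_cong[OF assms(1), of "\<lambda>x. frechet_derivative f (at x) v" "\<lambda>x. f' x v"]
      frechet_derivative_at[OF assms(2)] by auto
  ultimately show ?thesis by simp
qed

lemma Ck_on_SucD:
  assumes "open S" "Ck_on (Suc k) S f" "x \<in> S"
  shows "(f has_derivative frechet_derivative f (at x)) (at x)"
  using assms frechet_derivative_works by (auto simp: differentiable_on_eq_differentiable_at)

lemma Ck_on_subset:
  "Ck_on k S f \<Longrightarrow> T \<subseteq> S \<Longrightarrow> Ck_on k T f"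
  by (induction k arbitrary: f) (auto intro: continuous_on_subset differentiable_on_subset)

lemma Ck_on_Suc_imp: "Ck_on (Suc k) S f \<Longrightarrow> Ck_on k S f"
proof (induction k arbitrary: f)
  case 0
  then show ?case by (simp add: differentiable_imp_continuous_on)
next
  case (Suc k)
  then show ?case by (metis Ck_on.simps(2))
qed

text \<open>Gluing: maps into \<open>G\<close> and \<open>G/H\<close> are only controlled in charts
  or through local lifts, so smoothness on an open set has to be assembled from
  neighbourhoods.\<close>

lemma Ck_on_local:
  assumes "open S" "\<And>x. x \<in> S \<Longrightarrow> \<exists>T. open T \<and> x \<in> T \<and> Ck_on k (S \<inter> T) f"
  shows "Ck_on k S f"
  using assms(2)
proof (induction k arbitrary: f)
  case 0
  then show ?case
    using continuous_on_eq_continuous_at[OF open_Int[OF assms(1)], of _ f]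
      continuous_on_eq_continuous_at[OF assms(1), of f] by (auto simp: Ball_def)
next
  case (Suc k)
  have "f differentiable_on S"
    using Suc.prems differentiable_on_eq_differentiable_at[OF open_Int[OF assms(1)], of _ f]
      differentiable_on_eq_differentiable_at[OF assms(1), of f] by (auto simp: Ball_def)
  moreover have "Ck_on k S (\<lambda>x. frechet_derivative f (at x) v)" for v
  proof (rule Suc.IH)
    fix x assume "x \<in> S"
    then obtain T where "open T" "x \<in> T" "Ck_on (Suc k) (S \<inter> T) f" using Suc.prems by blast
    then show "\<exists>T. open T \<and> x \<in> T \<and> Ck_on k (S \<inter> T) (\<lambda>x. frechet_derivative f (at x) v)" by auto
  qed
  ultimately show ?case by simp
qed

lemma Ck_on_const: "open S \<Longrightarrow> Ck_on k S (\<lambda>x. c)"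
  by (induction k arbitrary: c) (auto intro: Ck_on_SucI[where f'="\<lambda>x v. 0"])

lemma Ck_on_bounded_linear: "open S \<Longrightarrow> bounded_linear f \<Longrightarrow> Ck_on k S f"
  by (cases k) (simp add: linear_continuous_on,
      metis Ck_on_SucI[where f'="\<lambda>x. f"] Ck_on_const bounded_linear_imp_has_derivative)

lemma Ck_on_add:
  "open S \<Longrightarrow> Ck_on k S f \<Longrightarrow> Ck_on k S g \<Longrightarrow> Ck_on k S (\<lambda>x. f x + g x)"
proof (induction k arbitrary: f g)
  case (Suc k)
  show ?case
  proof (rule Ck_on_SucI[OF Suc.prems(1)])
    fix x assume "x \<in> S"
    then show "((\<lambda>x. f x + g x) has_derivative
        (\<lambda>v. frechet_derivative f (at x) v + frechet_derivative g (at x) v)) (at x)"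
      using Suc.prems by (intro has_derivative_add Ck_on_SucD)
  qed (use Suc in auto)
qed (auto intro: continuous_intros)

lemma Ck_on_sum:
  "open S \<Longrightarrow> (\<And>i. i \<in> I \<Longrightarrow> Ck_on k S (f i)) \<Longrightarrow> Ck_on k S (\<lambda>x. \<Sum>i\<in>I. f i x)"
  by (induction I rule: infinite_finite_induct) (auto intro: Ck_on_const Ck_on_add)

lemma Ck_on_bilinear:
  assumes "bounded_bilinear p" "open S"
  shows "Ck_on k S f \<Longrightarrow> Ck_on k S g \<Longrightarrow> Ck_on k S (\<lambda>x. p (f x) (g x))"
proof (induction k arbitrary: f g)
  case 0
  then show ?case using bounded_bilinear.continuous_on[OF assms(1)] by auto
next
  case (Suc k)
  note Suc' = Suc.prems[THEN Ck_on_Suc_imp]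
  show ?case
  proof (rule Ck_on_SucI[OF assms(2)])
    fix x assume "x \<in> S"
    then show "((\<lambda>x. p (f x) (g x)) has_derivative
        (\<lambda>v. p (f x) (frechet_derivative g (at x) v) + p (frechet_derivative f (at x) v) (g x))) (at x)"
      using Suc.prems assms(2) by (intro bounded_bilinear.FDERIV[OF assms(1)] Ck_on_SucD)
  next
    fix v
    show "Ck_on k S (\<lambda>x. p (f x) (frechet_derivative g (at x) v) + p (frechet_derivative f (at x) v) (g x))"
      using Suc.prems Suc' by (intro Ck_on_add assms(2) Suc.IH) auto
  qed
qed

text \<open>The chain rule evaluates the derivative of \<open>f\<close> at a moving vector, whereas
  \<open>Ck_on\<close> only speaks of derivatives in fixed directions. Expanding the vector in the
  basis leaves a finite sum of products, to which the induction hypothesis and the product rule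
  apply.\<close>

lemma Ck_on_compose:
  fixes f :: "'d::euclidean_space \<Rightarrow> 'f::real_normed_vector"
  assumes "open S" "open T" "g ` S \<subseteq> T"
  shows "Ck_on k T f \<Longrightarrow> Ck_on k S g \<Longrightarrow> Ck_on k S (\<lambda>x. f (g x))"
proof (induction k arbitrary: f)
  case 0
  then show ?case using assms(3) continuous_on_compose2 by (metis Ck_on.simps(1))
next
  case (Suc k)
  show ?case
  proof (rule Ck_on_SucI[OF assms(1)])
    fix x assume x: "x \<in> S"
    have gx: "g x \<in> T" using x assms(3) by auto
    have f: "(f has_derivative frechet_derivative f (at (g x))) (at (g x))"
      using Suc.prems(1) gx assms(2) by (intro Ck_on_SucD)
    have D: "((\<lambda>x. f (g x)) has_derivative
        (\<lambda>v. frechet_derivative f (at (g x)) (frechet_derivative g (at x) v))) (at x)"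
      by (rule has_derivative_compose[OF Ck_on_SucD[OF assms(1) Suc.prems(2) x] f])
    have "frechet_derivative f (at (g x)) w =
        (\<Sum>b\<in>Basis. (w \<bullet> b) *\<^sub>R frechet_derivative f (at (g x)) b)" for w
    proof -
      have "linear (frechet_derivative f (at (g x)))" using f has_derivative_linear by blast
      then have "frechet_derivative f (at (g x)) (\<Sum>b\<in>Basis. (w \<bullet> b) *\<^sub>R b) =
        (\<Sum>b\<in>Basis. (w \<bullet> b) *\<^sub>R frechet_derivative f (at (g x)) b)"
        by (simp add: linear_sum linear_scale)
      then show ?thesis by (simp add: euclidean_representation)
    qed
    then show "((\<lambda>x. f (g x)) has_derivative (\<lambda>v. \<Sum>b\<in>Basis.
        (frechet_derivative g (at x) v \<bullet> b) *\<^sub>R frechet_derivative f (at (g x)) b)) (at x)"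
      by (intro has_derivative_eq_rhs[OF D] ext) blast
  next
    fix v
    have "Ck_on k S (\<lambda>x. frechet_derivative g (at x) v)" using Suc.prems(2) by simp
    moreover have "Ck_on k S (\<lambda>x. frechet_derivative f (at (g x)) b)" for b
      using Suc.prems Ck_on_Suc_imp[OF Suc.prems(2)] by (intro Suc.IH) auto
    ultimately show "Ck_on k S (\<lambda>x. \<Sum>b\<in>Basis.
        (frechet_derivative g (at x) v \<bullet> b) *\<^sub>R frechet_derivative f (at (g x)) b)"
      by (intro Ck_on_sum Ck_on_bilinear[OF bounded_bilinear_scaleR] assms(1)
          Ck_on_bilinear[OF bounded_bilinear_inner] Ck_on_const)
  qed
qed

section \<open>Calculus of smooth maps, as the conjunction of all finite orders\<close>

lemma smooth_on_cong:
  "open S \<Longrightarrow> (\<And>x. x \<in> S \<Longrightarrow> f x = g x) \<Longrightarrow> smooth_on S f \<longleftrightarrow> smooth_on S g"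
  unfolding smooth_on_def using Ck_on_cong by blast

lemma smooth_on_subset: "smooth_on S f \<Longrightarrow> T \<subseteq> S \<Longrightarrow> smooth_on T f"
  unfolding smooth_on_def using Ck_on_subset by blast

lemma smooth_on_local:
  assumes "open S" "\<And>x. x \<in> S \<Longrightarrow> \<exists>T. open T \<and> x \<in> T \<and> smooth_on (S \<inter> T) f"
  shows "smooth_on S f"
  using Ck_on_local[OF assms(1), of _ f] assms(2) unfolding smooth_on_def by blast

lemma smooth_on_const: "open S \<Longrightarrow> smooth_on S (\<lambda>x. c)"
  by (simp add: smooth_on_def Ck_on_const)

lemma smooth_on_bounded_linear: "open S \<Longrightarrow> bounded_linear f \<Longrightarrow> smooth_on S f"
  by (simp add: smooth_on_def Ck_on_bounded_linear)

lemma smooth_on_linear: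
  fixes f :: "'d::euclidean_space \<Rightarrow> 'f::real_normed_vector"
  shows "open S \<Longrightarrow> linear f \<Longrightarrow> smooth_on S f"
  by (simp add: smooth_on_bounded_linear linear_conv_bounded_linear)

lemma smooth_on_id: "open S \<Longrightarrow> smooth_on S (\<lambda>x. x)"
  by (simp add: smooth_on_bounded_linear bounded_linear_ident)

lemma smooth_on_add:
  "open S \<Longrightarrow> smooth_on S f \<Longrightarrow> smooth_on S g \<Longrightarrow> smooth_on S (\<lambda>x. f x + g x)"
  by (simp add: smooth_on_def Ck_on_add)

lemma smooth_on_bilinear:
  "bounded_bilinear p \<Longrightarrow> open S \<Longrightarrow> smooth_on S f \<Longrightarrow> smooth_on S g \<Longrightarrow> smooth_on S (\<lambda>x. p (f x) (g x))"
  by (simp add: smooth_on_def Ck_on_bilinear)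

lemma smooth_on_sum:
  "open S \<Longrightarrow> (\<And>i. i \<in> I \<Longrightarrow> smooth_on S (f i)) \<Longrightarrow> smooth_on S (\<lambda>x. \<Sum>i\<in>I. f i x)"
  by (simp add: smooth_on_def Ck_on_sum)

lemma smooth_on_compose:
  fixes f :: "'d::euclidean_space \<Rightarrow> 'f::real_normed_vector"
  assumes "open S" "open T" "g ` S \<subseteq> T" "smooth_on T f" "smooth_on S g"
  shows "smooth_on S (\<lambda>x. f (g x))"
  using assms unfolding smooth_on_def by (auto intro: Ck_on_compose)

lemma smooth_on_linear_compose:
  fixes f :: "'d::euclidean_space \<Rightarrow> 'f::real_normed_vector"
  assumes "open S" "linear f" "smooth_on S g"
  shows "smooth_on S (\<lambda>x. f (g x))"
  using smooth_on_compose[OF assms(1) open_UNIV _ smooth_on_linear[OF open_UNIV assms(2)] assms(3)] by simp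

lemma smooth_on_Pair:
  fixes f :: "'c::real_normed_vector \<Rightarrow> 'd::euclidean_space" and g :: "'c \<Rightarrow> 'f::euclidean_space"
  assumes "open S" "smooth_on S f" "smooth_on S g"
  shows "smooth_on S (\<lambda>x. (f x, g x))"
proof -
  have "smooth_on S (\<lambda>x. (f x, 0) + (0, g x))"
    using assms by (intro smooth_on_add smooth_on_linear_compose[where f="\<lambda>x. (x,0)"]
        smooth_on_linear_compose[where f="\<lambda>x. (0,x)"]) (auto intro!: linearI)
  then show ?thesis by simp
qed

lemma smooth_on_continuous: "smooth_on S f \<Longrightarrow> continuous_on S f"
  using Ck_on.simps(1) smooth_on_def by blast

lemma smooth_on_has_derivative:
  "open S \<Longrightarrow> smooth_on S f \<Longrightarrow> x \<in> S \<Longrightarrow> (f has_derivative frechet_derivative f (at x)) (at x)"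
  using Ck_on_SucD smooth_on_def by blast

lemma smooth_on_frechet:
  "smooth_on S f \<Longrightarrow> smooth_on S (\<lambda>x. frechet_derivative f (at x) v)"
  unfolding smooth_on_def using Ck_on.simps(2) by blast

section \<open>Curves, solutions of differential equations and Lipschitz bounds\<close>

lemma smooth_on_vector_derivative:
  assumes "open S" "smooth_on S (f :: real \<Rightarrow> 'f::real_normed_vector)"
  shows "smooth_on S (\<lambda>t. vector_derivative f (at t))"
    and "t \<in> S \<Longrightarrow> (f has_vector_derivative vector_derivative f (at t)) (at t)"
proof -
  have D: "(f has_vector_derivative frechet_derivative f (at t) 1) (at t)" if "t \<in> S" for t
  proof -
    have *: "(f has_derivative frechet_derivative f (at t)) (at t)"
      using smooth_on_has_derivative assms that by blast
    then have lin: "linear (frechet_derivative f (at t))" by (rule has_derivative_linear)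
    have "(\<lambda>x. x *\<^sub>R frechet_derivative f (at t) 1) = frechet_derivative f (at t)"
      by (rule ext) (simp only: linear_scale[OF lin, symmetric] real_scaleR_def mult_1_right)
    then show ?thesis
      unfolding has_vector_derivative_def by (rule ssubst[where P="\<lambda>D. (f has_derivative D) (at t)"]) (rule *)
  qed
  then show "t \<in> S \<Longrightarrow> (f has_vector_derivative vector_derivative f (at t)) (at t)"
    using vector_derivative_at[OF D] by simp
  have "smooth_on S (\<lambda>t. frechet_derivative f (at t) 1)" using assms(2) by (rule smooth_on_frechet)
  moreover have "vector_derivative f (at t) = frechet_derivative f (at t) 1" if "t \<in> S" for t
    using D[OF that] by (rule vector_derivative_at)
  ultimately show "smooth_on S (\<lambda>t. vector_derivative f (at t))"
    using smooth_on_cong[OF assms(1), of "\<lambda>t. vector_derivative f (at t)" "\<lambda>t. frechet_derivative f (at t) 1"]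
    by blast
qed

text \<open>Bootstrapping: if the solution is of class \<open>k\<close>, so is the right-hand side
  composed with it, which is its derivative; hence the solution is of class
  \<open>k + 1\<close>.\<close>

lemma smooth_on_ODE_solution:
  fixes F :: "'d::euclidean_space \<Rightarrow> 'd" and x :: "real \<Rightarrow> 'd"
  assumes "open J" "open S" "smooth_on S F" "x ` J \<subseteq> S"
    and "\<And>t. t \<in> J \<Longrightarrow> (x has_vector_derivative F (x t)) (at t)"
  shows "smooth_on J x"
  unfolding smooth_on_def
proof
  fix k
  show "Ck_on k J x"
  proof (induction k)
    case 0
    show ?case
      using has_vector_derivative_continuous[OF assms(5)] by (simp add: continuous_at_imp_continuous_on)
  next
    case (Suc k)
    show ?case
    proof (rule Ck_on_SucI[OF assms(1)])
      show "(x has_derivative (\<lambda>v. v *\<^sub>R F (x t))) (at t)" if "t \<in> J" for t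
        using assms(5)[OF that] unfolding has_vector_derivative_def .
      show "Ck_on k J (\<lambda>t. v *\<^sub>R F (x t))" for v
      proof -
        have "Ck_on k S F" using assms(3) by (simp add: smooth_on_def)
        then show ?thesis
          by (intro Ck_on_bilinear[OF bounded_bilinear_scaleR assms(1)] Ck_on_const assms(1)
            Ck_on_compose[OF assms(1,2,4) _ Suc.IH])
      qed
    qed
  qed
qed

text \<open>The directional derivatives are bounded on a compact ball, and convexity of the ball
  turns the bound into a Lipschitz constant by the mean value inequality.\<close>

lemma smooth_on_lipschitz:
  fixes f :: "'d::euclidean_space \<Rightarrow> 'f::real_normed_vector"
  assumes "open S" "smooth_on S f" "x0 \<in> S"
  obtains r L where "r > 0" "L \<ge> 0" "cball x0 r \<subseteq> S"
    "\<And>x y. x \<in> cball x0 r \<Longrightarrow> y \<in> cball x0 r \<Longrightarrow> norm (f x - f y) \<le> L * norm (x - y)"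
proof -
  obtain r where r: "r > 0" "cball x0 r \<subseteq> S" using assms open_contains_cball by blast
  have c: "continuous_on (cball x0 r) (\<lambda>x. \<Sum>b\<in>Basis. norm (frechet_derivative f (at x) b))"
    by (intro continuous_intros continuous_on_subset[OF smooth_on_continuous[OF smooth_on_frechet[OF assms(2)]] r(2)])
  have "bounded ((\<lambda>x. \<Sum>b\<in>Basis. norm (frechet_derivative f (at x) b)) ` cball x0 r)"
    by (rule compact_imp_bounded[OF compact_continuous_image[OF c compact_cball]])
  then obtain L where "\<forall>y\<in>(\<lambda>x. \<Sum>b\<in>Basis. norm (frechet_derivative f (at x) b)) ` cball x0 r. norm y \<le> L"
    unfolding bounded_iff by blast
  then have L: "(\<Sum>b\<in>Basis. norm (frechet_derivative f (at x) b)) \<le> L" if "x \<in> cball x0 r" for x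
    using that abs_le_D1 by fastforce
  \<comment> \<open>The operator norm is estimated through the basis directions because continuity
    of the derivative is known direction by direction.\<close>
  have on: "onorm (frechet_derivative f (at x)) \<le> L" if "x \<in> cball x0 r" for x
  proof (rule onorm_le)
    fix v
    have "linear (frechet_derivative f (at x))"
      using smooth_on_has_derivative[OF assms(1,2)] that r has_derivative_linear by blast
    then have "frechet_derivative f (at x) v = (\<Sum>b\<in>Basis. (v \<bullet> b) *\<^sub>R frechet_derivative f (at x) b)"
      using linear_sum[of "frechet_derivative f (at x)" "\<lambda>b. (v \<bullet> b) *\<^sub>R b" Basis]
      by (simp add: euclidean_representation linear_scale)
    then have "norm (frechet_derivative f (at x) v) \<le> (\<Sum>b\<in>Basis. \<bar>v \<bullet> b\<bar> * norm (frechet_derivative f (at x) b))"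
      by (simp add: sum_norm_le)
    also have "\<dots> \<le> (\<Sum>b\<in>Basis. norm v * norm (frechet_derivative f (at x) b))"
      by (intro sum_mono mult_right_mono Basis_le_norm) auto
    also have "\<dots> \<le> L * norm v"
      using mult_right_mono[OF L[OF that] norm_ge_zero[of v]] by (simp add: sum_distrib_left[symmetric] mult.commute)
    finally show "norm (frechet_derivative f (at x) v) \<le> L * norm v" .
  qed
  have "norm (f x - f y) \<le> L * norm (x - y)" if "x \<in> cball x0 r" "y \<in> cball x0 r" for x y
  proof (rule differentiable_bound[of "cball x0 r" f "\<lambda>x. frechet_derivative f (at x)"])
    fix z assume "z \<in> cball x0 r"
    then have "z \<in> S" using r by blast
    then show "(f has_derivative frechet_derivative f (at z)) (at z within cball x0 r)"
      by (rule has_derivative_at_withinI[OF smooth_on_has_derivative[OF assms(1,2)]])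
  qed (use that on in simp_all)
  moreover have "0 \<le> L"
  proof -
    have "0 \<le> (\<Sum>b\<in>Basis. norm (frechet_derivative f (at x0) b))" by (intro sum_nonneg) simp
    also have "\<dots> \<le> L" using r by (intro L) simp
    finally show ?thesis .
  qed
  ultimately show ?thesis using that[OF r(1) _ r(2)] by blast
qed

section \<open>Partial derivatives and ordinary differential equations\<close>

text \<open>The common source of smooth dependence on a parameter: \<open>Ad\<close>,
  \<open>lder\<close> and the differential of left translation are all derivatives in a second
  variable, at a base point \<open>j x\<close> which is either constant or \<open>x\<close>
  itself.\<close>

lemma smooth_on_partial:
  fixes K :: "'c::euclidean_space \<times> 'd::euclidean_space \<Rightarrow> 'f::real_normed_vector"
  assumes "open D" "smooth_on D K" "open S" "smooth_on S j" "\<And>x. x \<in> S \<Longrightarrow> (x, j x) \<in> D"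
  shows "x \<in> S \<Longrightarrow> ((\<lambda>y. K (x, y)) has_derivative (\<lambda>v. frechet_derivative K (at (x, j x)) (0, v))) (at (j x))"
    and "smooth_on S (\<lambda>x. frechet_derivative K (at (x, j x)) (0, v))"
proof -
  assume x: "x \<in> S"
  have "((\<lambda>y. (x, y)) has_derivative (\<lambda>v. (0, v))) (at (j x))"
    by (intro derivative_eq_intros) auto
  from has_derivative_compose[OF this smooth_on_has_derivative[OF assms(1,2) assms(5)[OF x]]]
  show "((\<lambda>y. K (x, y)) has_derivative (\<lambda>v. frechet_derivative K (at (x, j x)) (0, v))) (at (j x))" .
next
  show "smooth_on S (\<lambda>x. frechet_derivative K (at (x, j x)) (0, v))"
  proof (rule smooth_on_compose[OF assms(3,1) _ smooth_on_frechet[OF assms(2)]])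
    show "(\<lambda>x. (x, j x)) ` S \<subseteq> D" using assms(5) by blast
    show "smooth_on S (\<lambda>x. (x, j x))"
      by (rule smooth_on_Pair[OF assms(3) smooth_on_id[OF assms(3)] assms(4)])
  qed
qed

lemma smooth_on_slices:
  fixes f :: "real \<times> real \<Rightarrow> 'f::real_normed_vector"
  assumes "open S" "smooth_on S f" "(s, t) \<in> S"
  shows "((\<lambda>s. f (s, t)) has_vector_derivative frechet_derivative f (at (s, t)) (1, 0)) (at s)"
    and "((\<lambda>t. f (s, t)) has_vector_derivative frechet_derivative f (at (s, t)) (0, 1)) (at t)"
proof -
  note D = smooth_on_has_derivative[OF assms]
  have lin: "linear (frechet_derivative f (at (s, t)))" using D by (rule has_derivative_linear)
  have "((\<lambda>s. (s, t)) has_derivative (\<lambda>v. (v, 0))) (at s)" by (intro derivative_eq_intros) auto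
  from has_derivative_compose[OF this D]
  have "((\<lambda>s. f (s, t)) has_derivative (\<lambda>v. frechet_derivative f (at (s, t)) (v, 0))) (at s)" .
  moreover have "(\<lambda>v. frechet_derivative f (at (s, t)) (v, 0)) = (\<lambda>v. v *\<^sub>R frechet_derivative f (at (s, t)) (1, 0))"
    by (rule ext) (simp only: linear_scale[OF lin, symmetric] scaleR_Pair real_scaleR_def mult_1_right mult_zero_right)
  ultimately show "((\<lambda>s. f (s, t)) has_vector_derivative frechet_derivative f (at (s, t)) (1, 0)) (at s)"
    unfolding has_vector_derivative_def by metis
  have "((\<lambda>t. (s, t)) has_derivative (\<lambda>v. (0, v))) (at t)" by (intro derivative_eq_intros) auto
  from has_derivative_compose[OF this D]
  have "((\<lambda>t. f (s, t)) has_derivative (\<lambda>v. frechet_derivative f (at (s, t)) (0, v))) (at t)" .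
  moreover have "(\<lambda>v. frechet_derivative f (at (s, t)) (0, v)) = (\<lambda>v. v *\<^sub>R frechet_derivative f (at (s, t)) (0, 1))"
    by (rule ext) (simp only: linear_scale[OF lin, symmetric] scaleR_Pair real_scaleR_def mult_1_right mult_zero_right)
  ultimately show "((\<lambda>t. f (s, t)) has_vector_derivative frechet_derivative f (at (s, t)) (0, 1)) (at t)"
    unfolding has_vector_derivative_def by metis
qed

lemma open_contains_square:
  fixes S :: "(real \<times> real) set"
  assumes "open S" "(s0, t0) \<in> S"
  obtains r where "r > 0" "{s0 - r..s0 + r} \<times> {t0 - r..t0 + r} \<subseteq> S"
proof -
  from open_prod_elim[OF assms] obtain A B where AB: "open A" "open B" "(s0, t0) \<in> A \<times> B" "A \<times> B \<subseteq> S" .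
  obtain r1 where r1: "r1 > 0" "cball s0 r1 \<subseteq> A" using AB open_contains_cball by blast
  obtain r2 where r2: "r2 > 0" "cball t0 r2 \<subseteq> B" using AB open_contains_cball by blast
  have "{s0 - min r1 r2..s0 + min r1 r2} \<subseteq> cball s0 r1" "{t0 - min r1 r2..t0 + min r1 r2} \<subseteq> cball t0 r2"
    by (auto simp: dist_real_def)
  then have "{s0 - min r1 r2..s0 + min r1 r2} \<times> {t0 - min r1 r2..t0 + min r1 r2} \<subseteq> S"
    using r1(2) r2(2) AB(4) by blast
  then show ?thesis using that[of "min r1 r2"] r1(1) r2(1) by simp
qed

text \<open>Symmetry of second derivatives in a form where the inner derivatives are only prescribed
  on the lines \<open>t = t0\<close> and \<open>s = s0\<close>; for group-valued maps these are
  where velocities can be computed. Integrating the mixed derivative in \<open>t\<close> and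
  differentiating under the integral in \<open>s\<close> compares the two orders.\<close>

lemma mixed_partials:
  fixes w :: "real \<times> real \<Rightarrow> 'f::euclidean_space"
  assumes S: "open S" and w: "smooth_on S w" and p: "(s0, t0) \<in> S"
    and 1: "\<And>s. (s, t0) \<in> S \<Longrightarrow> ((\<lambda>t. w (s, t)) has_vector_derivative a s) (at t0)"
    and 2: "(a has_vector_derivative A) (at s0)"
    and 3: "\<And>t. (s0, t) \<in> S \<Longrightarrow> ((\<lambda>s. w (s, t)) has_vector_derivative b t) (at s0)"
    and 4: "(b has_vector_derivative B) (at t0)"
  shows "A = B"
proof -
  define D1 where "D1 p = frechet_derivative w (at p) (1, 0)" for p
  define D2 where "D2 p = frechet_derivative w (at p) (0, 1)" for p
  have sD: "smooth_on S D1" "smooth_on S D2"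
    unfolding D1_def D2_def using w by (auto intro: smooth_on_frechet)
  define K where "K p = frechet_derivative D2 (at p) (1, 0)" for p
  have cK: "continuous_on S K" unfolding K_def by (rule smooth_on_continuous[OF smooth_on_frechet[OF sD(2)]])
  have d1: "((\<lambda>s. w (s, t)) has_vector_derivative D1 (s, t)) (at s)" if "(s, t) \<in> S" for s t
    unfolding D1_def by (rule smooth_on_slices[OF S w that])
  have d2: "((\<lambda>t. w (s, t)) has_vector_derivative D2 (s, t)) (at t)" if "(s, t) \<in> S" for s t
    unfolding D2_def by (rule smooth_on_slices[OF S w that])
  have dK: "((\<lambda>s. D2 (s, t)) has_vector_derivative K (s, t)) (at s)" if "(s, t) \<in> S" for s t
    unfolding K_def by (rule smooth_on_slices[OF S sD(2) that])
  obtain r where r: "r > 0" "{s0 - r..s0 + r} \<times> {t0 - r..t0 + r} \<subseteq> S"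
    using open_contains_square[OF S p] .
  have sub: "(s, t) \<in> S" if "s \<in> {s0 - r..s0 + r}" "t \<in> {t0..t0 + r}" for s t
    using that r by (intro subsetD[OF r(2)]) auto
  have inS: "\<forall>\<^sub>F s in nhds s0. (s, t0) \<in> S" "\<forall>\<^sub>F t in nhds t0. (s0, t) \<in> S"
  proof -
    have "\<forall>\<^sub>F s in nhds s0. s \<in> {s0 - r<..<s0 + r}" "\<forall>\<^sub>F t in nhds t0. t \<in> {t0 - r<..<t0 + r}"
      using r(1) by (intro eventually_nhds_in_open; simp)+
    then show "\<forall>\<^sub>F s in nhds s0. (s, t0) \<in> S" "\<forall>\<^sub>F t in nhds t0. (s0, t) \<in> S"
      using r by (auto elim!: eventually_mono intro!: subsetD[OF r(2)])
  qed
  have A: "A = K (s0, t0)"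
  proof -
    have ev: "\<forall>\<^sub>F s in nhds s0. a s = D2 (s, t0)"
      using inS(1) by eventually_elim (metis 1 d2 vector_derivative_at)
    have "(a has_vector_derivative A) (at s0) = ((\<lambda>s. D2 (s, t0)) has_vector_derivative A) (at s0)"
      by (rule has_vector_derivative_cong_ev) (use ev eventually_nhds_x_imp_x[OF ev] in simp_all)
    with 2 have "((\<lambda>s. D2 (s, t0)) has_vector_derivative A) (at s0)" by blast
    then show ?thesis using dK[OF p] by (metis vector_derivative_at)
  qed
  have B: "((\<lambda>t. D1 (s0, t)) has_vector_derivative B) (at t0)"
  proof -
    have ev: "\<forall>\<^sub>F t in nhds t0. b t = D1 (s0, t)"
      using inS(2) by eventually_elim (metis 3 d1 vector_derivative_at)
    have "(b has_vector_derivative B) (at t0) = ((\<lambda>t. D1 (s0, t)) has_vector_derivative B) (at t0)"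
      by (rule has_vector_derivative_cong_ev) (use ev eventually_nhds_x_imp_x[OF ev] in simp_all)
    with 4 show ?thesis by blast
  qed
  have int: "D1 (s0, t) - D1 (s0, t0) = integral {t0..t} (\<lambda>\<tau>. K (s0, \<tau>))" if t: "t \<in> {t0..t0 + r}" for t
  proof -
    have ftc: "((\<lambda>\<tau>. D2 (s, \<tau>)) has_integral w (s, t) - w (s, t0)) {t0..t}" if "s \<in> {s0 - r..s0 + r}" for s
      using t that by (intro fundamental_theorem_of_calculus has_vector_derivative_at_within[OF d2[OF sub]]) auto
    have I: "((\<lambda>s. integral (cbox t0 t) (\<lambda>\<tau>. D2 (s, \<tau>))) has_vector_derivative
        integral (cbox t0 t) (\<lambda>\<tau>. K (s0, \<tau>))) (at s0 within {s0 - r..s0 + r})"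
    proof (rule leibniz_rule_vector_derivative[where fx="\<lambda>s \<tau>. K (s, \<tau>)"])
      show "((\<lambda>x. D2 (x, \<tau>)) has_vector_derivative K (x, \<tau>)) (at x within {s0 - r..s0 + r})"
        if "x \<in> {s0 - r..s0 + r}" "\<tau> \<in> cbox t0 t" for x \<tau>
        using that t by (intro has_vector_derivative_at_within[OF dK[OF sub]]) auto
      show "(\<lambda>\<tau>. D2 (x, \<tau>)) integrable_on cbox t0 t" if "x \<in> {s0 - r..s0 + r}" for x
        using ftc[OF that] by auto
      show "continuous_on ({s0 - r..s0 + r} \<times> cbox t0 t) (\<lambda>(x, t). K (x, t))"
      proof -
        have "{s0 - r..s0 + r} \<times> cbox t0 t \<subseteq> S" using t by (auto intro!: sub)
        then show ?thesis using continuous_on_subset[OF cK] by simp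
      qed
    qed (use r in auto)
    have J: "integral (cbox t0 t) (\<lambda>\<tau>. D2 (s, \<tau>)) = w (s, t) - w (s, t0)" if "s \<in> {s0 - r..s0 + r}" for s
      using ftc[OF that] by (simp add: integral_unique)
    have "((\<lambda>s. w (s, t) - w (s, t0)) has_vector_derivative
        integral (cbox t0 t) (\<lambda>\<tau>. K (s0, \<tau>))) (at s0 within {s0 - r..s0 + r})"
      by (rule has_vector_derivative_transform[OF _ _ I]) (use r J in auto)
    moreover have "((\<lambda>s. w (s, t) - w (s, t0)) has_vector_derivative D1 (s0, t) - D1 (s0, t0)) (at s0 within {s0 - r..s0 + r})"
      using t r by (intro has_vector_derivative_diff has_vector_derivative_at_within[OF d1[OF sub]]) auto
    ultimately show ?thesis
      using vector_derivative_unique_within_closed_interval[of "s0 - r" "s0 + r" s0] r(1) by simp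
  qed
  have cK0: "continuous_on {t0..t0 + r} (\<lambda>\<tau>. K (s0, \<tau>))"
  proof (rule continuous_on_compose2[OF cK])
    show "continuous_on {t0..t0 + r} (\<lambda>\<tau>. (s0, \<tau>))" by (intro continuous_intros)
    show "Pair s0 ` {t0..t0 + r} \<subseteq> S" using r(1) by (auto intro!: sub)
  qed
  \<comment> \<open>A one-sided derivative is enough: both candidates are derivatives within the
    same nondegenerate interval, where derivatives are unique.\<close>
  have "((\<lambda>t. integral {t0..t} (\<lambda>\<tau>. K (s0, \<tau>))) has_vector_derivative K (s0, t0)) (at t0 within {t0..t0 + r})"
    using integral_has_vector_derivative[OF cK0, of t0] r by simp
  then have "((\<lambda>t. D1 (s0, t) - D1 (s0, t0)) has_vector_derivative K (s0, t0)) (at t0 within {t0..t0 + r})"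
    by (rule has_vector_derivative_transform[rotated 2]) (use r(1) int in auto)
  moreover have "((\<lambda>t. D1 (s0, t) - D1 (s0, t0)) has_vector_derivative B - 0) (at t0 within {t0..t0 + r})"
    by (intro has_vector_derivative_diff has_vector_derivative_at_within[OF B] has_vector_derivative_const)
  ultimately have "K (s0, t0) = B"
    using vector_derivative_unique_within_closed_interval[of t0 "t0 + r" t0] r(1) by simp
  then show ?thesis using A by simp
qed

text \<open>Picard iteration: a solution is the fixed point of a contracting integral operator on
  the complete space of bounded continuous functions.\<close>

lemma ODE_solution_exists:
  fixes F :: "'d::euclidean_space \<Rightarrow> 'd"
  assumes S: "open S" and F: "smooth_on S F" and x0: "x0 \<in> S"
  obtains e x where "e > 0" "x 0 = x0"
    "\<And>t. t \<in> {-e<..<e} \<Longrightarrow> x t \<in> S \<and> (x has_vector_derivative F (x t)) (at t)"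
proof -
  obtain r L where r: "r > 0" "L \<ge> 0" "cball x0 r \<subseteq> S"
    "\<And>x y. x \<in> cball x0 r \<Longrightarrow> y \<in> cball x0 r \<Longrightarrow> norm (F x - F y) \<le> L * norm (x - y)"
    by (rule smooth_on_lipschitz[OF assms]) (rule that)
  \<comment> \<open>Composing with the nearest-point retraction of the ball, which does not increase
    distances, makes the field globally bounded and Lipschitz with the same constant
    \<open>L\<close>.\<close>
  define cp where "cp = closest_point (cball x0 r)"
  define F' where "F' y = F (cp y)" for y
  have cp_in: "cp y \<in> cball x0 r" for y
    unfolding cp_def using r by (intro closest_point_in_set) auto
  have cp_id: "y \<in> cball x0 r \<Longrightarrow> cp y = y" for y
    unfolding cp_def by (rule closest_point_self)
  have lip: "norm (F' y - F' z) \<le> L * norm (y - z)" for y z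
  proof -
    have "norm (F' y - F' z) \<le> L * norm (cp y - cp z)" unfolding F'_def by (intro r cp_in)
    also have "norm (cp y - cp z) \<le> norm (y - z)"
      using closest_point_lipschitz[of "cball x0 r" y z] r unfolding cp_def dist_norm by auto
    finally show ?thesis using r by (simp add: mult_left_mono)
  qed
  define M where "M = norm (F x0) + L * r + 1"
  have M: "norm (F' y) \<le> M" for y
  proof -
    have "norm (F (cp y) - F x0) \<le> L * norm (cp y - x0)" using r cp_in by auto
    also have "\<dots> \<le> L * r" using cp_in[of y] r by (intro mult_left_mono) (auto simp: dist_norm norm_minus_commute)
    finally show ?thesis unfolding F'_def M_def
      using norm_triangle_ineq2[of "F (cp y)" "F x0"] by linarith
  qed
  have M0: "M > 0" unfolding M_def using r by (simp add: add_nonneg_pos)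
  \<comment> \<open>\<open>J u t\<close> and \<open>J u 0\<close> are each bounded by
    \<open>2 * e * M\<close>, so \<open>4 * e * M \<le> r\<close> keeps the solution in the ball; in
    the same way \<open>4 * e * L \<le> 1 / 2\<close> gives the contraction factor 1/2. The divisor
    has \<open>L + 1\<close> because \<open>L\<close> may be 0.\<close>
  define e where "e = min (r / (4 * M)) (1 / (8 * (L + 1)))"
  have e: "e > 0" "4 * e * M \<le> r" "4 * e * L \<le> 1 / 2"
  proof -
    show "e > 0" using r M0 by (simp add: e_def)
    have "e \<le> r / (4 * M)" "e \<le> 1 / (8 * (L + 1))" by (simp_all add: e_def)
    then have "e * (4 * M) \<le> r" "e * (8 * (L + 1)) \<le> 1"
      using M0 r by (simp_all add: pos_le_divide_eq)
    then show "4 * e * M \<le> r" "4 * e * L \<le> 1 / 2" using \<open>e > 0\<close> by (auto simp: algebra_simps)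
  qed
  \<comment> \<open>Freezing time outside \<open>{-e..e}\<close> makes the iterates bounded
    functions on the whole line, as the type of bounded continuous functions demands.\<close>
  define cl where "cl t = max (-e) (min e t)" for t
  have cl: "cl t \<in> {-e..e}" for t using e by (auto simp: cl_def)
  have cont_F': "continuous_on UNIV F'"
    by (rule lipschitz_on_continuous_on[of L]) (use lip r in \<open>auto simp: lipschitz_on_def dist_norm\<close>)
  \<comment> \<open>The integral starts at \<open>-e\<close> so that \<open>J u t - J u 0\<close> is
    the integral from 0 to \<open>t\<close> for both signs of \<open>t\<close>.\<close>
  define J where "J u t = integral {-e..t} (\<lambda>s. F' (apply_bcontfun u s))" for u t
  have cu: "continuous_on T (\<lambda>s. F' (apply_bcontfun u s))" for T u
    by (rule continuous_on_compose2[OF cont_F']) (auto intro: continuous_on_subset)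
  have J_cont: "continuous_on {-e..e} (J u)" for u
    unfolding J_def by (intro indefinite_integral_continuous_1 integrable_continuous_interval cu)
  have J_bound: "norm (J u t) \<le> 2 * e * M" if "t \<in> {-e..e}" for u t
  proof -
    have "norm (J u t) \<le> M * (t - - e)"
      unfolding J_def using that M by (intro integral_bound cu) auto
    also have "\<dots> \<le> M * (2 * e)" using that M0 by (intro mult_left_mono) auto
    finally show ?thesis by (simp add: mult_ac)
  qed
  have J_diff: "norm (J u t - J v t) \<le> 2 * e * (L * dist u v)" if "t \<in> {-e..e}" for u v t
  proof -
    have "J u t - J v t = integral {-e..t} (\<lambda>s. F' (apply_bcontfun u s) - F' (apply_bcontfun v s))"
      unfolding J_def by (intro Henstock_Kurzweil_Integration.integral_diff[symmetric] integrable_continuous_interval cu)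
    also have "norm \<dots> \<le> (L * dist u v) * (t - - e)"
    proof (rule integral_bound)
      fix s
      have "norm (F' (apply_bcontfun u s) - F' (apply_bcontfun v s)) \<le> L * norm (apply_bcontfun u s - apply_bcontfun v s)"
        by (rule lip)
      also have "\<dots> \<le> L * dist u v" using r dist_bounded[of u s v] by (intro mult_left_mono) (auto simp: dist_norm)
      finally show "norm (F' (apply_bcontfun u s) - F' (apply_bcontfun v s)) \<le> L * dist u v" .
    qed (use that in \<open>auto intro!: continuous_on_diff cu\<close>)
    also have "\<dots> \<le> (L * dist u v) * (2 * e)" using that r by (intro mult_left_mono) auto
    finally show ?thesis by (simp add: mult_ac)
  qed
  define T where "T u = Bcontfun (\<lambda>t. x0 + J u (cl t) - J u 0)" for u
  have T: "apply_bcontfun (T u) t = x0 + J u (cl t) - J u 0" for u t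
  proof -
    have "continuous_on UNIV (\<lambda>t. J u (cl t))"
      by (rule continuous_on_compose2[OF J_cont]) (use cl in \<open>auto simp: cl_def intro!: continuous_intros\<close>)
    then have "continuous_on UNIV (\<lambda>t. x0 + J u (cl t) - J u 0)" by (intro continuous_intros)
    moreover have "norm (x0 + J u (cl t) - J u 0) \<le> norm x0 + 2 * e * M + norm (J u 0)" for t
      using J_bound[OF cl, of u t] norm_triangle_ineq4[of "x0 + J u (cl t)" "J u 0"] norm_triangle_ineq[of x0 "J u (cl t)"]
      by linarith
    ultimately have "(\<lambda>t. x0 + J u (cl t) - J u 0) \<in> bcontfun"
      by (intro bcontfun_normI)
    then show ?thesis unfolding T_def by (simp add: Bcontfun_inverse)
  qed
  have zero: "0 \<in> {-e..e}" using e by auto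
  have "dist (T u) (T v) \<le> 1 / 2 * dist u v" for u v
  proof (rule dist_bound)
    fix t
    have "dist (apply_bcontfun (T u) t) (apply_bcontfun (T v) t) = norm ((J u (cl t) - J v (cl t)) - (J u 0 - J v 0))"
      by (simp add: T dist_norm algebra_simps)
    also have "\<dots> \<le> 2 * e * (L * dist u v) + 2 * e * (L * dist u v)"
      using norm_triangle_ineq4 J_diff[OF cl, of u t v] J_diff[OF zero, of u v] by (smt (verit))
    also have "\<dots> = (4 * e * L) * dist u v" by simp
    also have "\<dots> \<le> 1 / 2 * dist u v" using e by (intro mult_right_mono) auto
    finally show "dist (apply_bcontfun (T u) t) (apply_bcontfun (T v) t) \<le> 1 / 2 * dist u v" .
  qed
  then obtain u where u: "T u = u" using banach_fix_type[of "1/2" T] by auto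
  have u_eq: "apply_bcontfun u t = x0 + J u t - J u 0" if "t \<in> {-e..e}" for t
    using T[of u t] u that by (simp add: cl_def)
  have u_in: "apply_bcontfun u t \<in> cball x0 r" if "t \<in> {-e..e}" for t
  proof -
    have "norm (J u t - J u 0) \<le> r"
      using norm_triangle_ineq4[of "J u t" "J u 0"] J_bound[OF that, of u] J_bound[OF zero, of u] e by linarith
    then show ?thesis using u_eq[OF that] by (simp add: dist_norm norm_minus_commute)
  qed
  have "(apply_bcontfun u has_vector_derivative F (apply_bcontfun u t)) (at t)" if t: "t \<in> {-e<..<e}" for t
  proof -
    have t': "t \<in> {-e..e}" using t by auto
    have "((\<lambda>t. J u t) has_vector_derivative F' (apply_bcontfun u t)) (at t within {-e..e})"
      unfolding J_def by (rule integral_has_vector_derivative[OF cu t'])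
    then have "((\<lambda>t. J u t) has_vector_derivative F' (apply_bcontfun u t)) (at t)"
      using at_within_interior[of t "{-e..e}"] t by (simp add: interior_atLeastAtMost_real)
    then have "((\<lambda>t. x0 + J u t - J u 0) has_vector_derivative 0 + F' (apply_bcontfun u t) - 0) (at t)"
      by (intro has_vector_derivative_add has_vector_derivative_diff has_vector_derivative_const)
    then have "(apply_bcontfun u has_vector_derivative 0 + F' (apply_bcontfun u t) - 0) (at t)"
      by (rule has_vector_derivative_transform_within_open[of _ _ _ "{-e<..<e}"]) (use t u_eq in auto)
    moreover have "F' (apply_bcontfun u t) = F (apply_bcontfun u t)"
      unfolding F'_def using u_in[OF t'] by (simp add: cp_id)
    ultimately show ?thesis by simp
  qed
  then show ?thesis
    using that[of e "apply_bcontfun u"] e(1) u_eq[OF zero] u_in r(3) by fastforce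
qed

section \<open>Smooth maps into a Lie group\<close>

locale lie_grp =
  fixes G :: "('a::t2_space, 'e::euclidean_space) lie_structure" (structure)
  assumes lie: "lie_group G"

sublocale lie_grp \<subseteq> group G
  using lie unfolding lie_group_def by (elim conjE)

context lie_grp
begin

abbreviation dom0 :: "'a set" where "dom0 \<equiv> fst (base_chart G)"
abbreviation cd :: "'a \<Rightarrow> 'e" where "cd \<equiv> coord G"
abbreviation ci :: "'e \<Rightarrow> 'a" where "ci \<equiv> coord_inv G"
abbreviation e0 :: 'e where "e0 \<equiv> coord G \<one>"

section \<open>Charts and coordinates around the identity\<close>

lemma atlas_chart:
  assumes "(U, \<phi>) \<in> atlas G"
  shows "U \<subseteq> carrier G" "openin (top_of_set (carrier G)) U" "open (\<phi> ` U)"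
    "homeomorphism U (\<phi> ` U) \<phi> (inv_into U \<phi>)" "inj_on \<phi> U"
proof -
  have A: "smooth_atlas (carrier G) (atlas G)" using lie unfolding lie_group_def by (elim conjE)
  then have *: "\<forall>(U, \<phi>)\<in>atlas G. openin (top_of_set (carrier G)) U \<and> open (\<phi> ` U) \<and>
        homeomorphism U (\<phi> ` U) \<phi> (inv_into U \<phi>)"
    unfolding smooth_atlas_def by (elim conjE)
  show "openin (top_of_set (carrier G)) U" "open (\<phi> ` U)"
    "homeomorphism U (\<phi> ` U) \<phi> (inv_into U \<phi>)"
    using bspec[OF * assms] by simp_all
  then show "U \<subseteq> carrier G" "inj_on \<phi> U"
    by (auto simp: openin_subtopology homeomorphism_def intro: inj_on_inverseI)
qed

lemma atlas_cover:
  assumes "x \<in> carrier G"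
  obtains U \<phi> where "(U, \<phi>) \<in> atlas G" "x \<in> U"
proof -
  have "smooth_atlas (carrier G) (atlas G)" using lie unfolding lie_group_def by (elim conjE)
  then have "(\<Union>(U, \<phi>)\<in>atlas G. U) = carrier G" unfolding smooth_atlas_def by (elim conjE)
  then show ?thesis using assms that by auto
qed

lemma base_atlas: "(dom0, cd) \<in> atlas G" and one_dom0: "\<one> \<in> dom0"
  using lie unfolding lie_group_def by simp_all

lemma cd_open: "open (cd ` dom0)" and dom0_carrier: "x \<in> dom0 \<Longrightarrow> x \<in> carrier G"
  using atlas_chart[OF base_atlas] by auto

lemma ci_cd [simp]: "x \<in> dom0 \<Longrightarrow> ci (cd x) = x"
  using atlas_chart(5)[OF base_atlas] by simp

lemma e0_in: "e0 \<in> cd ` dom0" using one_dom0 by simp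

lemma ci_in: "z \<in> cd ` dom0 \<Longrightarrow> ci z \<in> dom0" by (rule inv_into_into)

lemma cd_ci [simp]: "z \<in> cd ` dom0 \<Longrightarrow> cd (ci z) = z" by (rule f_inv_into_f)

lemma mult_cont: "continuous_on (carrier G \<times> carrier G) (\<lambda>(x, y). x \<otimes> y)"
  and inv_cont: "continuous_on (carrier G) (\<lambda>x. inv x)"
  using lie unfolding lie_group_def by simp_all

lemma mult_smooth_chart:
  assumes "(U, \<phi>) \<in> atlas G" "(V, \<psi>) \<in> atlas G" "(W, \<theta>) \<in> atlas G"
  shows "smooth_on {(x, y). x \<in> \<phi> ` U \<and> y \<in> \<psi> ` V \<and> inv_into U \<phi> x \<otimes> inv_into V \<psi> y \<in> W}
          (\<lambda>(x, y). \<theta> (inv_into U \<phi> x \<otimes> inv_into V \<psi> y))"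
proof -
  have *: "\<forall>(U, \<phi>)\<in>atlas G. \<forall>(V, \<psi>)\<in>atlas G. \<forall>(W, \<theta>)\<in>atlas G.
        smooth_on {(x, y). x \<in> \<phi> ` U \<and> y \<in> \<psi> ` V \<and> inv_into U \<phi> x \<otimes> inv_into V \<psi> y \<in> W}
          (\<lambda>(x, y). \<theta> (inv_into U \<phi> x \<otimes> inv_into V \<psi> y))"
    using lie unfolding lie_group_def by (elim conjE)
  note 1 = bspec[OF * assms(1), unfolded prod.case]
  note 2 = bspec[OF 1 assms(2), unfolded prod.case]
  show ?thesis by (rule bspec[OF 2 assms(3), unfolded prod.case])
qed

lemma inv_smooth_chart:
  assumes "(U, \<phi>) \<in> atlas G" "(W, \<theta>) \<in> atlas G"
  shows "smooth_on {x \<in> \<phi> ` U. inv (inv_into U \<phi> x) \<in> W} (\<lambda>x. \<theta> (inv (inv_into U \<phi> x)))"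
proof -
  have *: "\<forall>(U, \<phi>)\<in>atlas G. \<forall>(W, \<theta>)\<in>atlas G.
        smooth_on {x \<in> \<phi> ` U. inv (inv_into U \<phi> x) \<in> W} (\<lambda>x. \<theta> (inv (inv_into U \<phi> x)))"
    using lie unfolding lie_group_def by (elim conjE)
  note 1 = bspec[OF * assms(1), unfolded prod.case]
  show ?thesis by (rule bspec[OF 1 assms(2), unfolded prod.case])
qed

lemma transition_smooth:
  assumes "(U, \<phi>) \<in> atlas G" "(V, \<psi>) \<in> atlas G"
  shows "smooth_on (\<phi> ` (U \<inter> V)) (\<lambda>x. \<psi> (inv_into U \<phi> x))"
proof -
  have "smooth_atlas (carrier G) (atlas G)" using lie unfolding lie_group_def by (elim conjE)
  then have *: "\<forall>(U, \<phi>)\<in>atlas G. \<forall>(V, \<psi>)\<in>atlas G. smooth_on (\<phi> ` (U \<inter> V)) (\<lambda>x. \<psi> (inv_into U \<phi> x))"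
    unfolding smooth_atlas_def by (elim conjE)
  note 1 = bspec[OF * assms(1), unfolded prod.case]
  show ?thesis by (rule bspec[OF 1 assms(2), unfolded prod.case])
qed

lemma open_chart_preimage:
  assumes "open D" "continuous_on D f" "f ` D \<subseteq> carrier G" "(U, \<phi>) \<in> atlas G"
  shows "open (D \<inter> f -` U)"
proof -
  obtain T where T: "open T" "U = carrier G \<inter> T"
    using atlas_chart(2)[OF assms(4)] by (auto simp: openin_open)
  have "D \<inter> f -` U = D \<inter> f -` T" using T assms(3) by auto
  then show ?thesis using continuous_open_preimage[OF assms(2,1) T(1)] by simp
qed

section \<open>Closure properties of smooth maps into the group\<close>

lemma smooth_intoI:
  assumes "f ` D \<subseteq> carrier G" "continuous_on D f"
    "\<And>U \<phi>. (U, \<phi>) \<in> atlas G \<Longrightarrow> smooth_on (D \<inter> f -` U) (\<lambda>x. \<phi> (f x))"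
  shows "smooth_into G D f"
  using assms unfolding smooth_into_def by blast

lemma smooth_intoD:
  assumes "smooth_into G D f"
  shows "x \<in> D \<Longrightarrow> f x \<in> carrier G" "f ` D \<subseteq> carrier G" "continuous_on D f"
    "(U, \<phi>) \<in> atlas G \<Longrightarrow> smooth_on (D \<inter> f -` U) (\<lambda>x. \<phi> (f x))"
  using assms unfolding smooth_into_def by auto

lemma smooth_into_open:
  "smooth_into G D f \<Longrightarrow> open D \<Longrightarrow> (U, \<phi>) \<in> atlas G \<Longrightarrow> open (D \<inter> f -` U)"
  by (rule open_chart_preimage[OF _ smooth_intoD(3) smooth_intoD(2)])

lemma smooth_into_cong:
  assumes "open D" "smooth_into G D f" "\<And>x. x \<in> D \<Longrightarrow> f x = g x"
  shows "smooth_into G D g"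
proof (rule smooth_intoI)
  show "g ` D \<subseteq> carrier G" using assms smooth_intoD(1) by fastforce
  show "continuous_on D g" using smooth_intoD(3)[OF assms(2)] assms(3) by (simp cong: continuous_on_cong)
  fix U \<phi> assume U: "(U, \<phi>) \<in> atlas G"
  have "D \<inter> g -` U = D \<inter> f -` U" using assms(3) by auto
  then show "smooth_on (D \<inter> g -` U) (\<lambda>x. \<phi> (g x))"
    using smooth_intoD(4)[OF assms(2) U] assms(3)
      smooth_on_cong[OF smooth_into_open[OF assms(2,1) U], of "\<lambda>x. \<phi> (f x)" "\<lambda>x. \<phi> (g x)"] by auto
qed

lemma smooth_into_local:
  assumes "open D" "\<And>x. x \<in> D \<Longrightarrow> \<exists>T. open T \<and> x \<in> T \<and> smooth_into G (D \<inter> T) f"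
  shows "smooth_into G D f"
proof (rule smooth_intoI)
  show im: "f ` D \<subseteq> carrier G" using assms(2) smooth_intoD(1) by blast
  show c: "continuous_on D f"
    unfolding continuous_on_eq_continuous_at[OF assms(1)]
  proof
    fix x assume x: "x \<in> D"
    then obtain T where T: "open T" "x \<in> T" "smooth_into G (D \<inter> T) f" using assms(2) by blast
    show "isCont f x"
      using smooth_intoD(3)[OF T(3)] continuous_on_eq_continuous_at[OF open_Int[OF assms(1) T(1)]] x T(2)
      by blast
  qed
  fix U \<phi> assume U: "(U, \<phi>) \<in> atlas G"
  show "smooth_on (D \<inter> f -` U) (\<lambda>x. \<phi> (f x))"
  proof (rule smooth_on_local)
    show "open (D \<inter> f -` U)" by (rule open_chart_preimage[OF assms(1) c im U])
    fix x assume "x \<in> D \<inter> f -` U"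
    then obtain T where T: "open T" "x \<in> T" "smooth_into G (D \<inter> T) f" using assms(2) by blast
    have "D \<inter> f -` U \<inter> T = D \<inter> T \<inter> f -` U" by auto
    then show "\<exists>T. open T \<and> x \<in> T \<and> smooth_on (D \<inter> f -` U \<inter> T) (\<lambda>x. \<phi> (f x))"
      using T smooth_intoD(4)[OF T(3) U] by auto
  qed
qed

lemma smooth_into_const: "open D \<Longrightarrow> g \<in> carrier G \<Longrightarrow> smooth_into G D (\<lambda>x. g)"
  by (rule smooth_intoI) (auto intro: smooth_on_subset[OF smooth_on_const[of D]])

lemma smooth_into_compose:
  fixes f :: "'d::euclidean_space \<Rightarrow> 'a" and h :: "'c::euclidean_space \<Rightarrow> 'd"
  assumes "open S" "open T" "h ` S \<subseteq> T" "smooth_into G T f" "smooth_on S h"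
  shows "smooth_into G S (\<lambda>x. f (h x))"
proof (rule smooth_intoI)
  show im: "(\<lambda>x. f (h x)) ` S \<subseteq> carrier G" using assms(3) smooth_intoD(1)[OF assms(4)] by auto
  show c: "continuous_on S (\<lambda>x. f (h x))"
    by (rule continuous_on_compose2[OF smooth_intoD(3)[OF assms(4)] smooth_on_continuous[OF assms(5)] assms(3)])
  fix U \<phi> assume U: "(U, \<phi>) \<in> atlas G"
  show "smooth_on (S \<inter> (\<lambda>x. f (h x)) -` U) (\<lambda>x. \<phi> (f (h x)))"
  proof (rule smooth_on_compose[OF _ smooth_into_open[OF assms(4,2) U] _ smooth_intoD(4)[OF assms(4) U]])
    show "open (S \<inter> (\<lambda>x. f (h x)) -` U)" by (rule open_chart_preimage[OF assms(1) c im U])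
    show "h ` (S \<inter> (\<lambda>x. f (h x)) -` U) \<subseteq> T \<inter> f -` U" using assms(3) by auto
    show "smooth_on (S \<inter> (\<lambda>x. f (h x)) -` U) h" by (rule smooth_on_subset[OF assms(5)]) auto
  qed
qed

lemma smooth_into_chart_inv:
  assumes "(U, \<phi>) \<in> atlas G"
  shows "smooth_into G (\<phi> ` U) (inv_into U \<phi>)"
proof (rule smooth_intoI)
  show "inv_into U \<phi> ` \<phi> ` U \<subseteq> carrier G" using atlas_chart(1)[OF assms] inv_into_into[of _ \<phi> U] by blast
  show "continuous_on (\<phi> ` U) (inv_into U \<phi>)" using atlas_chart(4)[OF assms] homeomorphism_def by blast
  fix V \<psi> assume V: "(V, \<psi>) \<in> atlas G"
  have "\<phi> ` U \<inter> inv_into U \<phi> -` V = \<phi> ` (U \<inter> V)"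
    using atlas_chart(5)[OF assms] by auto
  then show "smooth_on (\<phi> ` U \<inter> inv_into U \<phi> -` V) (\<lambda>x. \<psi> (inv_into U \<phi> x))"
    using transition_smooth[OF assms V] by simp
qed

lemma smooth_into_ci: "smooth_into G (cd ` dom0) ci"
  by (rule smooth_into_chart_inv[OF base_atlas])

text \<open>The group axioms express multiplication in charts only. Near a point, charts around the
  values of \<open>f\<close> and \<open>g\<close> and a chart around the product are chosen, and the
  local statements are glued.\<close>

lemma smooth_into_mult:
  fixes f g :: "'d::euclidean_space \<Rightarrow> 'a"
  assumes D: "open D" and f: "smooth_into G D f" and g: "smooth_into G D g"
  shows "smooth_into G D (\<lambda>x. f x \<otimes> g x)"
proof (rule smooth_intoI)
  show im: "(\<lambda>x. f x \<otimes> g x) ` D \<subseteq> carrier G" using smooth_intoD(1) f g by auto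
  have "continuous_on D (\<lambda>x. case (f x, g x) of (x, y) \<Rightarrow> x \<otimes> y)"
    by (rule continuous_on_compose2[OF mult_cont continuous_on_Pair[OF smooth_intoD(3)[OF f] smooth_intoD(3)[OF g]]])
      (use smooth_intoD(1) f g in auto)
  then show c: "continuous_on D (\<lambda>x. f x \<otimes> g x)" by simp
  fix W \<theta> assume W: "(W, \<theta>) \<in> atlas G"
  let ?S = "D \<inter> (\<lambda>x. f x \<otimes> g x) -` W"
  have oS: "open ?S" by (rule open_chart_preimage[OF D c im W])
  show "smooth_on ?S (\<lambda>x. \<theta> (f x \<otimes> g x))"
  proof (rule smooth_on_local[OF oS])
    fix x assume x: "x \<in> ?S"
    obtain U \<phi> where U: "(U, \<phi>) \<in> atlas G" "f x \<in> U" using atlas_cover smooth_intoD(1)[OF f] x by blast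
    obtain V \<psi> where V: "(V, \<psi>) \<in> atlas G" "g x \<in> V" using atlas_cover smooth_intoD(1)[OF g] x by blast
    define T where "T = (D \<inter> f -` U) \<inter> (D \<inter> g -` V)"
    have T: "open T" "x \<in> T" using smooth_into_open[OF f D U(1)] smooth_into_open[OF g D V(1)] x U V
      by (auto simp: T_def)
    \<comment> \<open>The domain of the chart expression of the product. The composition rule for
      smooth maps needs it to be open, which comes from continuity of multiplication.\<close>
    let ?N = "{(x, y). x \<in> \<phi> ` U \<and> y \<in> \<psi> ` V \<and> inv_into U \<phi> x \<otimes> inv_into V \<psi> y \<in> W}"
    have oN: "open ?N"
    proof -
      let ?m = "\<lambda>p. inv_into U \<phi> (fst p) \<otimes> inv_into V \<psi> (snd p)"
      have cU: "continuous_on (\<phi> ` U) (inv_into U \<phi>)" "inv_into U \<phi> ` \<phi> ` U \<subseteq> carrier G"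
        and cV: "continuous_on (\<psi> ` V) (inv_into V \<psi>)" "inv_into V \<psi> ` \<psi> ` V \<subseteq> carrier G"
        using smooth_into_chart_inv[OF U(1)] smooth_into_chart_inv[OF V(1)] smooth_intoD(2,3) by blast+
      have "continuous_on (\<phi> ` U \<times> \<psi> ` V) (\<lambda>p. (inv_into U \<phi> (fst p), inv_into V \<psi> (snd p)))"
        by (intro continuous_on_Pair continuous_on_compose2[OF cU(1)] continuous_on_compose2[OF cV(1)])
          (auto intro: continuous_intros)
      then have "continuous_on (\<phi> ` U \<times> \<psi> ` V) (\<lambda>p. case (inv_into U \<phi> (fst p), inv_into V \<psi> (snd p)) of (x, y) \<Rightarrow> x \<otimes> y)"
        by (rule continuous_on_compose2[OF mult_cont]) (use cU cV in fastforce)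
      then have cm: "continuous_on (\<phi> ` U \<times> \<psi> ` V) ?m" by simp
      have "open ((\<phi> ` U \<times> \<psi> ` V) \<inter> ?m -` W)"
      proof (rule open_chart_preimage[OF _ cm _ W])
        show "open (\<phi> ` U \<times> \<psi> ` V)" using atlas_chart(3)[OF U(1)] atlas_chart(3)[OF V(1)] by (rule open_Times)
        show "?m ` (\<phi> ` U \<times> \<psi> ` V) \<subseteq> carrier G" using cU(2) cV(2) by fastforce
      qed
      moreover have "(\<phi> ` U \<times> \<psi> ` V) \<inter> ?m -` W = ?N" by auto
      ultimately show ?thesis by simp
    qed
    have inj: "inj_on \<phi> U" "inj_on \<psi> V" using atlas_chart(5) U V by auto
    have "smooth_on (?S \<inter> T) (\<lambda>x. (\<lambda>(x, y). \<theta> (inv_into U \<phi> x \<otimes> inv_into V \<psi> y)) (\<phi> (f x), \<psi> (g x)))"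
    proof (rule smooth_on_compose[OF _ oN _ mult_smooth_chart[OF U(1) V(1) W]])
      show "open (?S \<inter> T)" using oS T by blast
      then show "smooth_on (?S \<inter> T) (\<lambda>x. (\<phi> (f x), \<psi> (g x)))"
        by (intro smooth_on_Pair smooth_on_subset[OF smooth_intoD(4)[OF f U(1)]]
            smooth_on_subset[OF smooth_intoD(4)[OF g V(1)]]) (auto simp: T_def)
      show "(\<lambda>x. (\<phi> (f x), \<psi> (g x))) ` (?S \<inter> T) \<subseteq> ?N"
        using inj by (auto simp: T_def)
    qed
    moreover have "smooth_on (?S \<inter> T) (\<lambda>x. (\<lambda>(x, y). \<theta> (inv_into U \<phi> x \<otimes> inv_into V \<psi> y)) (\<phi> (f x), \<psi> (g x)))
       \<longleftrightarrow> smooth_on (?S \<inter> T) (\<lambda>x. \<theta> (f x \<otimes> g x))"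
      by (rule smooth_on_cong) (use oS T inj in \<open>auto simp: T_def\<close>)
    ultimately show "\<exists>T. open T \<and> x \<in> T \<and> smooth_on (?S \<inter> T) (\<lambda>x. \<theta> (f x \<otimes> g x))"
      using T by blast
  qed
qed

lemma smooth_into_inv:
  fixes f :: "'d::euclidean_space \<Rightarrow> 'a"
  assumes D: "open D" and f: "smooth_into G D f"
  shows "smooth_into G D (\<lambda>x. inv (f x))"
proof (rule smooth_intoI)
  show im: "(\<lambda>x. inv (f x)) ` D \<subseteq> carrier G" using smooth_intoD(1) f by auto
  show c: "continuous_on D (\<lambda>x. inv (f x))"
    by (rule continuous_on_compose2[OF inv_cont smooth_intoD(3)[OF f] smooth_intoD(2)[OF f]])
  fix W \<theta> assume W: "(W, \<theta>) \<in> atlas G"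
  let ?S = "D \<inter> (\<lambda>x. inv (f x)) -` W"
  have oS: "open ?S" by (rule open_chart_preimage[OF D c im W])
  show "smooth_on ?S (\<lambda>x. \<theta> (inv (f x)))"
  proof (rule smooth_on_local[OF oS])
    fix x assume x: "x \<in> ?S"
    obtain U \<phi> where U: "(U, \<phi>) \<in> atlas G" "f x \<in> U" using atlas_cover smooth_intoD(1)[OF f] x by blast
    define T where "T = D \<inter> f -` U"
    have T: "open T" "x \<in> T" using smooth_into_open[OF f D U(1)] x U by (auto simp: T_def)
    let ?N = "{x \<in> \<phi> ` U. inv (inv_into U \<phi> x) \<in> W}"
    have cU: "continuous_on (\<phi> ` U) (inv_into U \<phi>)" "inv_into U \<phi> ` \<phi> ` U \<subseteq> carrier G"
      using smooth_into_chart_inv[OF U(1)] smooth_intoD(2,3) by blast+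
    have "open (\<phi> ` U \<inter> (\<lambda>x. inv (inv_into U \<phi> x)) -` W)"
      by (rule open_chart_preimage[OF atlas_chart(3)[OF U(1)] continuous_on_compose2[OF inv_cont cU] _ W])
        (use cU in fastforce)
    moreover have "\<phi> ` U \<inter> (\<lambda>x. inv (inv_into U \<phi> x)) -` W = ?N" by auto
    ultimately have oN: "open ?N" by simp
    have inj: "inj_on \<phi> U" using atlas_chart(5) U by auto
    have "smooth_on (?S \<inter> T) (\<lambda>x. \<theta> (inv (inv_into U \<phi> (\<phi> (f x)))))"
    proof (rule smooth_on_compose[OF _ oN _ inv_smooth_chart[OF U(1) W]])
      show "open (?S \<inter> T)" using oS T by blast
      then show "smooth_on (?S \<inter> T) (\<lambda>x. \<phi> (f x))"
        by (intro smooth_on_subset[OF smooth_intoD(4)[OF f U(1)]]) (auto simp: T_def)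
      show "(\<lambda>x. \<phi> (f x)) ` (?S \<inter> T) \<subseteq> ?N" using inj by (auto simp: T_def)
    qed
    moreover have "smooth_on (?S \<inter> T) (\<lambda>x. \<theta> (inv (inv_into U \<phi> (\<phi> (f x)))))
       \<longleftrightarrow> smooth_on (?S \<inter> T) (\<lambda>x. \<theta> (inv (f x)))"
      by (rule smooth_on_cong) (use oS T inj in \<open>auto simp: T_def\<close>)
    ultimately show "\<exists>T. open T \<and> x \<in> T \<and> smooth_on (?S \<inter> T) (\<lambda>x. \<theta> (inv (f x)))"
      using T by blast
  qed
qed

lemma smooth_into_cd:
  assumes "open D" "smooth_into G D f"
  shows "open (D \<inter> f -` dom0)" "smooth_on (D \<inter> f -` dom0) (\<lambda>x. cd (f x))"
  using smooth_into_open[OF assms(2,1) base_atlas] smooth_intoD(4)[OF assms(2) base_atlas] by auto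

end

section \<open>Velocities of curves and the adjoint representation\<close>

lemma has_vector_derivative_ev_cong:
  assumes "(f has_vector_derivative X) (at t)" "\<forall>\<^sub>F s in nhds t. f s = g s"
  shows "(g has_vector_derivative X) (at t)"
proof -
  have "(f has_vector_derivative X) (at t) = (g has_vector_derivative X) (at t)"
    by (rule has_vector_derivative_cong_ev) (use assms(2) eventually_nhds_x_imp_x[OF assms(2)] in simp_all)
  with assms(1) show ?thesis by blast
qed

lemma has_vector_derivative_compose:
  assumes "(x has_vector_derivative X) (at t)" "(f has_derivative K) (at (x t))"
  shows "((\<lambda>s. f (x s)) has_vector_derivative K X) (at t)"
  using vector_derivative_diff_chain_within[of x X t UNIV f K] assms has_derivative_at_withinI
  by (fastforce simp: o_def)

lemma isCont_eventually_nhds: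
  assumes "isCont f t" "\<forall>\<^sub>F y in nhds (f t). P y"
  shows "\<forall>\<^sub>F s in nhds t. P (f s)"
  using assms eventually_compose_filterlim[of P "nhds (f t)" f "nhds t"]
  by (simp add: isCont_def tendsto_at_iff_tendsto_nhds)

lemma isCont_eventually_in_open:
  assumes "isCont f t" "open N" "f t \<in> N"
  shows "\<forall>\<^sub>F s in nhds t. f s \<in> N"
  by (rule isCont_eventually_nhds[OF assms(1) eventually_nhds_in_open[OF assms(2,3)]])

context lie_grp
begin

lemma inv_mult_cancel [simp]:
  "x \<in> carrier G \<Longrightarrow> y \<in> carrier G \<Longrightarrow> inv x \<otimes> (x \<otimes> y) = y"
  "x \<in> carrier G \<Longrightarrow> y \<in> carrier G \<Longrightarrow> x \<otimes> (inv x \<otimes> y) = y"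
  by (simp_all flip: m_assoc)

text \<open>The velocity of a curve passing through the identity, read in the base chart. As a
  relation it certifies differentiability, which the total function \<open>left_vel\<close> cannot;
  the curve has to stay in \<open>dom0\<close> nearby, since coordinates mean nothing
  elsewhere.\<close>

definition vel1 :: "(real \<Rightarrow> 'a) \<Rightarrow> real \<Rightarrow> 'e \<Rightarrow> bool" where
  "vel1 p t X \<longleftrightarrow> p t = \<one> \<and> (\<forall>\<^sub>F s in nhds t. p s \<in> dom0) \<and>
     ((\<lambda>s. cd (p s)) has_vector_derivative X) (at t)"

lemma vel1_unique: "vel1 p t X \<Longrightarrow> vel1 p t Y \<Longrightarrow> X = Y"
  unfolding vel1_def using vector_derivative_unique_at by blast

lemma vel1_cong:
  assumes "vel1 p t X" "\<forall>\<^sub>F s in nhds t. p s = q s"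
  shows "vel1 q t X"
  unfolding vel1_def
proof (intro conjI)
  have p: "p t = \<one>" "\<forall>\<^sub>F s in nhds t. p s \<in> dom0" "((\<lambda>s. cd (p s)) has_vector_derivative X) (at t)"
    using assms(1) unfolding vel1_def by auto
  show "q t = \<one>" using p(1) eventually_nhds_x_imp_x[OF assms(2)] by simp
  show "\<forall>\<^sub>F s in nhds t. q s \<in> dom0" using p(2) assms(2) by eventually_elim simp
  show "((\<lambda>s. cd (q s)) has_vector_derivative X) (at t)"
    by (rule has_vector_derivative_ev_cong[OF p(3)]) (use assms(2) in \<open>eventually_elim; simp\<close>)
qed

text \<open>A smooth map that fixes the identity acts on velocities by its differential there.
  Conjugation gives \<open>Ad\<close>, inversion gives the sign change.\<close>

lemma vel1_map:
  assumes "vel1 p t X" and F: "smooth_into G (cd ` dom0) (\<lambda>z. F (ci z))" and F1: "F \<one> = \<one>"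
  shows "vel1 (\<lambda>s. F (p s)) t (frechet_derivative (\<lambda>z. cd (F (ci z))) (at e0) X)"
    and "((\<lambda>z. cd (F (ci z))) has_derivative frechet_derivative (\<lambda>z. cd (F (ci z))) (at e0)) (at e0)"
proof -
  have p: "p t = \<one>" "\<forall>\<^sub>F s in nhds t. p s \<in> dom0" "((\<lambda>s. cd (p s)) has_vector_derivative X) (at t)"
    using assms(1) unfolding vel1_def by auto
  let ?N = "cd ` dom0 \<inter> (\<lambda>z. F (ci z)) -` dom0"
  note N = smooth_into_cd[OF cd_open F]
  have e: "e0 \<in> ?N" using e0_in F1 one_dom0 by simp
  show D: "((\<lambda>z. cd (F (ci z))) has_derivative frechet_derivative (\<lambda>z. cd (F (ci z))) (at e0)) (at e0)"
    by (rule smooth_on_has_derivative[OF N e])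
  have "isCont (\<lambda>s. cd (p s)) t" using p(3) has_vector_derivative_continuous by blast
  then have "\<forall>\<^sub>F s in nhds t. cd (p s) \<in> ?N"
    by (rule isCont_eventually_in_open[OF _ N(1)]) (use e p(1) in simp)
  then have ev: "\<forall>\<^sub>F s in nhds t. F (p s) \<in> dom0 \<and> cd (F (ci (cd (p s)))) = cd (F (p s))"
    using p(2) by eventually_elim simp
  have D': "((\<lambda>z. cd (F (ci z))) has_derivative frechet_derivative (\<lambda>z. cd (F (ci z))) (at e0)) (at (cd (p t)))"
    using D p(1) by simp
  show "vel1 (\<lambda>s. F (p s)) t (frechet_derivative (\<lambda>z. cd (F (ci z))) (at e0) X)"
    unfolding vel1_def
  proof (intro conjI)
    show "F (p t) = \<one>" using p(1) F1 by simp
    show "\<forall>\<^sub>F s in nhds t. F (p s) \<in> dom0" using ev by eventually_elim simp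
    show "((\<lambda>s. cd (F (p s))) has_vector_derivative frechet_derivative (\<lambda>z. cd (F (ci z))) (at e0) X) (at t)"
      by (rule has_vector_derivative_ev_cong[OF has_vector_derivative_compose[OF p(3) D']])
        (use ev in \<open>eventually_elim; simp\<close>)
  qed
qed

lemma vel1_exists: "vel1 (\<lambda>s. ci (e0 + s *\<^sub>R X)) 0 X"
proof -
  have c: "((\<lambda>s. e0 + s *\<^sub>R X) has_vector_derivative X) (at 0)"
    by (auto intro!: derivative_eq_intros)
  then have "\<forall>\<^sub>F s in nhds 0. e0 + s *\<^sub>R X \<in> cd ` dom0"
    by (intro isCont_eventually_in_open cd_open has_vector_derivative_continuous) (use one_dom0 in auto)
  then have ev: "\<forall>\<^sub>F s in nhds 0. ci (e0 + s *\<^sub>R X) \<in> dom0 \<and> e0 + s *\<^sub>R X = cd (ci (e0 + s *\<^sub>R X))"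
    by eventually_elim (simp add: ci_in)
  show ?thesis unfolding vel1_def
    using one_dom0 ev by (auto intro: has_vector_derivative_ev_cong[OF c] elim: eventually_mono)
qed

lemma vel1_const: "vel1 (\<lambda>s. \<one>) t 0"
  unfolding vel1_def using one_dom0 by simp

lemma smooth_into_pair_mult:
  "smooth_into G (cd ` dom0 \<times> cd ` dom0) (\<lambda>p. ci (fst p) \<otimes> ci (snd p))"
proof (rule smooth_into_mult)
  show o: "open (cd ` dom0 \<times> cd ` dom0)" by (intro open_Times cd_open)
  show "smooth_into G (cd ` dom0 \<times> cd ` dom0) (\<lambda>p. ci (fst p))"
    by (rule smooth_into_compose[OF o cd_open _ smooth_into_ci])
      (auto intro!: smooth_on_bounded_linear o bounded_linear_fst)
  show "smooth_into G (cd ` dom0 \<times> cd ` dom0) (\<lambda>p. ci (snd p))"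
    by (rule smooth_into_compose[OF o cd_open _ smooth_into_ci])
      (auto intro!: smooth_on_bounded_linear o bounded_linear_snd)
qed

text \<open>The differential of multiplication at the identity restricts to the identity map on each
  factor, because \<one> is neutral; by linearity it is addition.\<close>

lemma vel1_mult:
  assumes "vel1 p t X" "vel1 q t Y"
  shows "vel1 (\<lambda>s. p s \<otimes> q s) t (X + Y)"
proof -
  have p: "p t = \<one>" "\<forall>\<^sub>F s in nhds t. p s \<in> dom0" "((\<lambda>s. cd (p s)) has_vector_derivative X) (at t)"
    using assms(1) unfolding vel1_def by auto
  have q: "q t = \<one>" "\<forall>\<^sub>F s in nhds t. q s \<in> dom0" "((\<lambda>s. cd (q s)) has_vector_derivative Y) (at t)"
    using assms(2) unfolding vel1_def by auto
  let ?f = "\<lambda>p. ci (fst p) \<otimes> ci (snd p)"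
  let ?N = "(cd ` dom0 \<times> cd ` dom0) \<inter> ?f -` dom0"
  let ?K = "\<lambda>p. cd (?f p)"
  note N = smooth_into_cd[OF open_Times[OF cd_open cd_open] smooth_into_pair_mult]
  have e: "(e0, e0) \<in> ?N" using e0_in one_dom0 by simp
  let ?D = "frechet_derivative ?K (at (e0, e0))"
  have D: "(?K has_derivative ?D) (at (e0, e0))" by (rule smooth_on_has_derivative[OF N e])
  have lin: "linear ?D" using D by (rule has_derivative_linear)
  have id: "((\<lambda>z. z) has_derivative (\<lambda>z. z)) (at e0)" by (rule has_derivative_ident)
  have "((\<lambda>z. (z, e0)) has_derivative (\<lambda>v. (v, 0))) (at e0)" by (intro derivative_eq_intros) auto
  from has_derivative_compose[OF this D]
  have "((\<lambda>z. ?K (z, e0)) has_derivative (\<lambda>v. ?D (v, 0))) (at e0)" .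
  then have "((\<lambda>z. z) has_derivative (\<lambda>v. ?D (v, 0))) (at e0)"
    by (rule has_derivative_transform_within_open[OF _ cd_open e0_in]) (auto simp: one_dom0 dom0_carrier)
  from fun_cong[OF has_derivative_unique[OF this id], of X] have DX: "?D (X, 0) = X" .
  have "((\<lambda>z. (e0, z)) has_derivative (\<lambda>v. (0, v))) (at e0)" by (intro derivative_eq_intros) auto
  from has_derivative_compose[OF this D]
  have "((\<lambda>z. ?K (e0, z)) has_derivative (\<lambda>v. ?D (0, v))) (at e0)" .
  then have "((\<lambda>z. z) has_derivative (\<lambda>v. ?D (0, v))) (at e0)"
    by (rule has_derivative_transform_within_open[OF _ cd_open e0_in]) (auto simp: one_dom0 dom0_carrier)
  from fun_cong[OF has_derivative_unique[OF this id], of Y] have DY: "?D (0, Y) = Y" .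
  have DXY: "?D (X, Y) = X + Y" using linear_add[OF lin, of "(X, 0)" "(0, Y)"] DX DY by simp
  have pq: "((\<lambda>s. (cd (p s), cd (q s))) has_vector_derivative (X, Y)) (at t)"
    using p(3) q(3) by (rule has_vector_derivative_Pair)
  then have "isCont (\<lambda>s. (cd (p s), cd (q s))) t" by (rule has_vector_derivative_continuous)
  then have "\<forall>\<^sub>F s in nhds t. (cd (p s), cd (q s)) \<in> ?N"
    by (rule isCont_eventually_in_open[OF _ N(1)]) (use e p(1) q(1) in simp)
  then have ev: "\<forall>\<^sub>F s in nhds t. p s \<otimes> q s \<in> dom0 \<and> ?K (cd (p s), cd (q s)) = cd (p s \<otimes> q s)"
    using p(2) q(2) by eventually_elim simp
  have "(?K has_derivative ?D) (at (cd (p t), cd (q t)))" using D p(1) q(1) by simp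
  from has_vector_derivative_compose[OF pq this]
  have "((\<lambda>s. ?K (cd (p s), cd (q s))) has_vector_derivative X + Y) (at t)" unfolding DXY .
  then have "((\<lambda>s. cd (p s \<otimes> q s)) has_vector_derivative X + Y) (at t)"
    by (rule has_vector_derivative_ev_cong) (use ev in \<open>eventually_elim; simp\<close>)
  moreover have "\<forall>\<^sub>F s in nhds t. p s \<otimes> q s \<in> dom0" using ev by eventually_elim simp
  ultimately show ?thesis unfolding vel1_def using p(1) q(1) by simp
qed

text \<open>Smoothness of inversion gives some velocity \<open>Y\<close>; the product with
  \<open>p\<close> is constant, which forces \<open>X + Y = 0\<close>.\<close>

lemma vel1_inv:
  assumes "vel1 p t X"
  shows "vel1 (\<lambda>s. inv (p s)) t (- X)"
proof -
  have "smooth_into G (cd ` dom0) (\<lambda>z. inv (ci z))"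
    by (rule smooth_into_inv[OF cd_open smooth_into_ci])
  from vel1_map(1)[OF assms this] obtain Y where Y: "vel1 (\<lambda>s. inv (p s)) t Y" by auto
  have "\<forall>\<^sub>F s in nhds t. p s \<otimes> inv (p s) = \<one>"
    using assms unfolding vel1_def by (auto elim!: eventually_mono simp: dom0_carrier)
  from vel1_cong[OF vel1_mult[OF assms Y] this] have "X + Y = 0" using vel1_const vel1_unique by blast
  then show ?thesis using Y by (simp add: minus_unique)
qed

section \<open>The adjoint representation\<close>

lemma Ad_has_derivative:
  assumes "g \<in> carrier G"
  shows "((\<lambda>x. cd (g \<otimes> ci x \<otimes> inv g)) has_derivative Ad G g) (at e0)"
    and "vel1 p t X \<Longrightarrow> vel1 (\<lambda>s. g \<otimes> p s \<otimes> inv g) t (Ad G g X)"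
proof -
  have F: "smooth_into G (cd ` dom0) (\<lambda>z. g \<otimes> ci z \<otimes> inv g)"
    using assms by (intro smooth_into_mult smooth_into_const smooth_into_ci cd_open) auto
  have F1: "g \<otimes> \<one> \<otimes> inv g = \<one>" using assms by simp
  note map = vel1_map[where F="\<lambda>x. g \<otimes> x \<otimes> inv g", OF _ F F1]
  show "((\<lambda>x. cd (g \<otimes> ci x \<otimes> inv g)) has_derivative Ad G g) (at e0)"
    unfolding Ad_def by (rule map(2)[OF vel1_exists])
  show "vel1 p t X \<Longrightarrow> vel1 (\<lambda>s. g \<otimes> p s \<otimes> inv g) t (Ad G g X)"
    unfolding Ad_def by (rule map(1))
qed

lemma linear_Ad: "g \<in> carrier G \<Longrightarrow> linear (Ad G g)"
  using Ad_has_derivative(1) has_derivative_linear by blast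

lemma vel1_ev_carrier: "vel1 p t X \<Longrightarrow> \<forall>\<^sub>F s in nhds t. p s \<in> carrier G"
  unfolding vel1_def using dom0_carrier by (auto elim!: eventually_mono)

lemma Ad_one: "Ad G \<one> X = X"
proof -
  have "\<forall>\<^sub>F s in nhds 0. \<one> \<otimes> ci (e0 + s *\<^sub>R X) \<otimes> inv \<one> = ci (e0 + s *\<^sub>R X)"
    using vel1_ev_carrier[OF vel1_exists[of X]] by eventually_elim simp
  from vel1_cong[OF Ad_has_derivative(2)[OF one_closed vel1_exists] this]
  show ?thesis using vel1_exists vel1_unique by blast
qed

text \<open>Both sides are velocities of the same conjugated curve. Comparing two computations of
  one velocity replaces chain rules in charts here and later.\<close>

lemma Ad_mult:
  assumes "g \<in> carrier G" "h \<in> carrier G"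
  shows "Ad G (g \<otimes> h) X = Ad G g (Ad G h X)"
proof -
  have "\<forall>\<^sub>F s in nhds 0. g \<otimes> h \<otimes> ci (e0 + s *\<^sub>R X) \<otimes> inv (g \<otimes> h)
      = g \<otimes> (h \<otimes> ci (e0 + s *\<^sub>R X) \<otimes> inv h) \<otimes> inv g"
    using vel1_ev_carrier[OF vel1_exists[of X]]
    by eventually_elim (use assms in \<open>simp add: inv_mult_group m_assoc\<close>)
  from vel1_cong[OF Ad_has_derivative(2)[OF _ vel1_exists] this]
  have "vel1 (\<lambda>s. g \<otimes> (h \<otimes> ci (e0 + s *\<^sub>R X) \<otimes> inv h) \<otimes> inv g) 0 (Ad G (g \<otimes> h) X)" using assms by simp
  moreover have "vel1 (\<lambda>s. g \<otimes> (h \<otimes> ci (e0 + s *\<^sub>R X) \<otimes> inv h) \<otimes> inv g) 0 (Ad G g (Ad G h X))"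
    using assms by (intro Ad_has_derivative(2) vel1_exists)
  ultimately show ?thesis by (rule vel1_unique)
qed

lemma Ad_inv [simp]:
  assumes "g \<in> carrier G"
  shows "Ad G (inv g) (Ad G g X) = X" "Ad G g (Ad G (inv g) X) = X"
  using Ad_mult[of "inv g" g X] Ad_mult[of g "inv g" X] assms by (simp_all add: Ad_one)

text \<open>The relational form of \<open>left_vel\<close>: the curve is translated so that it
  passes through the identity at time \<open>t\<close>. Existence is part of the statement, so that
  product, inverse and reparametrisation rules can be composed.\<close>

definition has_lvel :: "(real \<Rightarrow> 'a) \<Rightarrow> real \<Rightarrow> 'e \<Rightarrow> bool" where
  "has_lvel \<alpha> t X \<longleftrightarrow> \<alpha> t \<in> carrier G \<and> (\<forall>\<^sub>F s in nhds t. \<alpha> s \<in> carrier G) \<and>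
     vel1 (\<lambda>s. inv (\<alpha> t) \<otimes> \<alpha> s) t X"

lemma has_lvel_carrier: "has_lvel \<alpha> t X \<Longrightarrow> \<alpha> t \<in> carrier G"
  and has_lvel_ev_carrier: "has_lvel \<alpha> t X \<Longrightarrow> \<forall>\<^sub>F s in nhds t. \<alpha> s \<in> carrier G"
  and has_lvel_vel1: "has_lvel \<alpha> t X \<Longrightarrow> vel1 (\<lambda>s. inv (\<alpha> t) \<otimes> \<alpha> s) t X"
  unfolding has_lvel_def by simp_all

lemma has_lvel_unique: "has_lvel \<alpha> t X \<Longrightarrow> has_lvel \<alpha> t Y \<Longrightarrow> X = Y"
  unfolding has_lvel_def using vel1_unique by blast

lemma has_lvel_left_vel: "has_lvel \<alpha> t X \<Longrightarrow> left_vel G \<alpha> t = X"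
  unfolding has_lvel_def vel1_def left_vel_def by (auto intro: vector_derivative_at)

lemma has_lvel_cong:
  assumes "has_lvel \<alpha> t X" "\<forall>\<^sub>F s in nhds t. \<alpha> s = \<beta> s"
  shows "has_lvel \<beta> t X"
proof -
  have "\<alpha> t = \<beta> t" using assms(2) by (rule eventually_nhds_x_imp_x)
  moreover have "\<forall>\<^sub>F s in nhds t. \<beta> s \<in> carrier G"
    using has_lvel_ev_carrier[OF assms(1)] assms(2) by eventually_elim simp
  moreover have "\<forall>\<^sub>F s in nhds t. inv (\<alpha> t) \<otimes> \<alpha> s = inv (\<alpha> t) \<otimes> \<beta> s"
    using assms(2) by eventually_elim simp
  ultimately show ?thesis
    using assms(1) vel1_cong[OF has_lvel_vel1[OF assms(1)]] unfolding has_lvel_def by simp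
qed

lemma has_lvel_const: "g \<in> carrier G \<Longrightarrow> has_lvel (\<lambda>s. g) t 0"
  unfolding has_lvel_def using vel1_const by simp

text \<open>Translating the product back to the identity conjugates the translate of \<alpha> by
  \<open>inv (\<beta> t)\<close> and multiplies it by the translate of \<beta>; the conjugation is
  the source of \<open>Ad\<close>.\<close>

lemma has_lvel_mult:
  assumes a: "has_lvel \<alpha> t X" and b: "has_lvel \<beta> t Y"
  shows "has_lvel (\<lambda>s. \<alpha> s \<otimes> \<beta> s) t (Ad G (inv (\<beta> t)) X + Y)"
  unfolding has_lvel_def
proof (intro conjI)
  note c = has_lvel_carrier[OF a] has_lvel_carrier[OF b]
  show "\<alpha> t \<otimes> \<beta> t \<in> carrier G" using c by simp
  show "\<forall>\<^sub>F s in nhds t. \<alpha> s \<otimes> \<beta> s \<in> carrier G"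
    using has_lvel_ev_carrier[OF a] has_lvel_ev_carrier[OF b] by eventually_elim simp
  have "vel1 (\<lambda>s. (inv (\<beta> t) \<otimes> (inv (\<alpha> t) \<otimes> \<alpha> s) \<otimes> inv (inv (\<beta> t))) \<otimes> (inv (\<beta> t) \<otimes> \<beta> s)) t
      (Ad G (inv (\<beta> t)) X + Y)"
    using c by (intro vel1_mult Ad_has_derivative(2) has_lvel_vel1[OF a] has_lvel_vel1[OF b]) simp
  then show "vel1 (\<lambda>s. inv (\<alpha> t \<otimes> \<beta> t) \<otimes> (\<alpha> s \<otimes> \<beta> s)) t (Ad G (inv (\<beta> t)) X + Y)"
  proof (rule vel1_cong)
    show "\<forall>\<^sub>F s in nhds t. (inv (\<beta> t) \<otimes> (inv (\<alpha> t) \<otimes> \<alpha> s) \<otimes> inv (inv (\<beta> t))) \<otimes> (inv (\<beta> t) \<otimes> \<beta> s)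
      = inv (\<alpha> t \<otimes> \<beta> t) \<otimes> (\<alpha> s \<otimes> \<beta> s)"
      using has_lvel_ev_carrier[OF a] has_lvel_ev_carrier[OF b]
      by eventually_elim (use c in \<open>simp add: inv_mult_group m_assoc\<close>)
  qed
qed

lemma has_lvel_inv:
  assumes a: "has_lvel \<alpha> t X"
  shows "has_lvel (\<lambda>s. inv (\<alpha> s)) t (- Ad G (\<alpha> t) X)"
  unfolding has_lvel_def
proof (intro conjI)
  note c = has_lvel_carrier[OF a]
  show "inv (\<alpha> t) \<in> carrier G" using c by simp
  show "\<forall>\<^sub>F s in nhds t. inv (\<alpha> s) \<in> carrier G"
    using has_lvel_ev_carrier[OF a] by eventually_elim simp
  have "vel1 (\<lambda>s. \<alpha> t \<otimes> inv (inv (\<alpha> t) \<otimes> \<alpha> s) \<otimes> inv (\<alpha> t)) t (Ad G (\<alpha> t) (- X))"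
    by (intro vel1_inv Ad_has_derivative(2) has_lvel_vel1[OF a] c)
  then have "vel1 (\<lambda>s. inv (inv (\<alpha> t)) \<otimes> inv (\<alpha> s)) t (Ad G (\<alpha> t) (- X))"
  proof (rule vel1_cong)
    show "\<forall>\<^sub>F s in nhds t. \<alpha> t \<otimes> inv (inv (\<alpha> t) \<otimes> \<alpha> s) \<otimes> inv (\<alpha> t) = inv (inv (\<alpha> t)) \<otimes> inv (\<alpha> s)"
      using has_lvel_ev_carrier[OF a]
      by eventually_elim (use c in \<open>simp add: inv_mult_group m_assoc\<close>)
  qed
  then show "vel1 (\<lambda>s. inv (inv (\<alpha> t)) \<otimes> inv (\<alpha> s)) t (- Ad G (\<alpha> t) X)"
    using linear_neg[OF linear_Ad[OF c]] by simp
qed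

lemma has_lvel_cmult:
  assumes "g \<in> carrier G" "has_lvel \<alpha> t X"
  shows "has_lvel (\<lambda>s. g \<otimes> \<alpha> s) t X"
  using has_lvel_mult[OF has_lvel_const[OF assms(1)] assms(2)] has_lvel_carrier[OF assms(2)]
  by (simp add: linear_0[OF linear_Ad])

lemma has_lvel_mult_const:
  assumes "g \<in> carrier G" "has_lvel \<alpha> t X"
  shows "has_lvel (\<lambda>s. \<alpha> s \<otimes> g) t (Ad G (inv g) X)"
  using has_lvel_mult[OF assms(2) has_lvel_const[OF assms(1)]] by simp

lemma has_lvel_reparam:
  assumes a: "has_lvel \<alpha> (\<phi> t) X" and f: "(\<phi> has_real_derivative r) (at t)"
  shows "has_lvel (\<lambda>s. \<alpha> (\<phi> s)) t (r *\<^sub>R X)"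
proof -
  have c: "isCont \<phi> t" using f by (rule DERIV_isCont)
  have v: "inv (\<alpha> (\<phi> t)) \<otimes> \<alpha> (\<phi> t) = \<one>" "\<forall>\<^sub>F s in nhds (\<phi> t). inv (\<alpha> (\<phi> t)) \<otimes> \<alpha> s \<in> dom0"
    "((\<lambda>s. cd (inv (\<alpha> (\<phi> t)) \<otimes> \<alpha> s)) has_vector_derivative X) (at (\<phi> t))"
    using has_lvel_vel1[OF a] unfolding vel1_def by auto
  have "(\<phi> has_vector_derivative r) (at t)" using f by (simp add: has_real_derivative_iff_has_vector_derivative)
  from vector_diff_chain_at[OF this v(3)]
  have "((\<lambda>s. cd (inv (\<alpha> (\<phi> t)) \<otimes> \<alpha> (\<phi> s))) has_vector_derivative r *\<^sub>R X) (at t)" by (simp add: o_def)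
  then show ?thesis
    unfolding has_lvel_def vel1_def
    using has_lvel_carrier[OF a] v(1) isCont_eventually_nhds[OF c v(2)]
      isCont_eventually_nhds[OF c has_lvel_ev_carrier[OF a]] by simp
qed

text \<open>The pullback of the left Maurer-Cartan form under \<open>f\<close>. It extends
  \<open>left_vel\<close> to several real parameters.\<close>

definition lder :: "('d::euclidean_space \<Rightarrow> 'a) \<Rightarrow> 'd \<Rightarrow> 'd \<Rightarrow> 'e" where
  "lder f x v = frechet_derivative (\<lambda>z. cd (inv (f x) \<otimes> f z)) (at x) v"

text \<open>The map \<open>(x, z) \<mapsto> inv (f x) \<otimes> f z\<close> is the identity element
  on the diagonal, so it is in the base chart nearby, and \<open>lder\<close> is its partial
  derivative in the second variable on the diagonal.\<close>

lemma lder_lemma: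
  assumes D: "open D" and f: "smooth_into G D f"
  shows "x \<in> D \<Longrightarrow> ((\<lambda>z. cd (inv (f x) \<otimes> f z)) has_derivative lder f x) (at x)"
    and "smooth_on D (\<lambda>x. lder f x v)"
proof -
  let ?h = "\<lambda>p. inv (f (fst p)) \<otimes> f (snd p)"
  have o: "open (D \<times> D)" by (intro open_Times D)
  have h: "smooth_into G (D \<times> D) ?h"
    by (intro smooth_into_mult smooth_into_inv smooth_into_compose[OF o D _ f])
      (auto intro!: o smooth_on_bounded_linear bounded_linear_fst bounded_linear_snd)
  note N = smooth_into_cd[OF o h]
  have diag: "(x, x) \<in> (D \<times> D) \<inter> ?h -` dom0" if "x \<in> D" for x
    using that smooth_intoD(1)[OF f] one_dom0 by simp
  note P = smooth_on_partial[OF N D smooth_on_id[OF D] diag]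
  have 1: "((\<lambda>z. cd (inv (f x) \<otimes> f z)) has_derivative
     (\<lambda>v. frechet_derivative (\<lambda>p. cd (?h p)) (at (x, x)) (0, v))) (at x)" if "x \<in> D" for x
    using P(1)[OF _ that] by simp
  then have 2: "lder f x = (\<lambda>v. frechet_derivative (\<lambda>p. cd (?h p)) (at (x, x)) (0, v))" if "x \<in> D" for x
    unfolding lder_def using frechet_derivative_at[OF 1[OF that]] by simp
  show "x \<in> D \<Longrightarrow> ((\<lambda>z. cd (inv (f x) \<otimes> f z)) has_derivative lder f x) (at x)" using 1 2 by simp
  show "smooth_on D (\<lambda>x. lder f x v)"
    using P(2)[of v] smooth_on_cong[OF D, of "\<lambda>x. lder f x v"] 2 by simp
qed

lemma has_lvel_lder:
  assumes D: "open D" and f: "smooth_into G D f" and x: "x t \<in> D" "(x has_vector_derivative v) (at t)"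
  shows "has_lvel (\<lambda>s. f (x s)) t (lder f (x t) v)"
proof -
  have c: "isCont x t" using x(2) by (rule has_vector_derivative_continuous)
  have ft: "f (x t) \<in> carrier G" using smooth_intoD(1)[OF f] x by auto
  have h: "smooth_into G D (\<lambda>z. inv (f (x t)) \<otimes> f z)"
    by (intro smooth_into_mult smooth_into_const f D) (use ft in simp)
  have "\<forall>\<^sub>F s in nhds t. x s \<in> D \<inter> (\<lambda>z. inv (f (x t)) \<otimes> f z) -` dom0"
    by (rule isCont_eventually_in_open[OF c smooth_into_cd(1)[OF D h]]) (use x ft one_dom0 in simp)
  then have ev: "\<forall>\<^sub>F s in nhds t. x s \<in> D \<and> inv (f (x t)) \<otimes> f (x s) \<in> dom0" by eventually_elim simp
  show ?thesis unfolding has_lvel_def vel1_def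
  proof (intro conjI)
    show "\<forall>\<^sub>F s in nhds t. f (x s) \<in> carrier G" using ev smooth_intoD(1)[OF f] by (auto elim!: eventually_mono)
    show "\<forall>\<^sub>F s in nhds t. inv (f (x t)) \<otimes> f (x s) \<in> dom0" using ev by eventually_elim simp
    show "((\<lambda>s. cd (inv (f (x t)) \<otimes> f (x s))) has_vector_derivative lder f (x t) v) (at t)"
      by (rule has_vector_derivative_compose[OF x(2) lder_lemma(1)[OF D f x(1)]])
  qed (use ft in simp_all)
qed

lemma linear_lder: "open D \<Longrightarrow> smooth_into G D f \<Longrightarrow> x \<in> D \<Longrightarrow> linear (lder f x)"
  using lder_lemma(1) has_derivative_linear by blast

lemma has_lvel_smooth:
  assumes "open D" "smooth_into G D \<alpha>" "t \<in> D"
  shows "has_lvel \<alpha> t (left_vel G \<alpha> t)"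
proof -
  have "has_lvel (\<lambda>s. \<alpha> s) t (lder \<alpha> t 1)"
    by (rule has_lvel_lder[OF assms(1,2)]) (use assms in \<open>auto intro!: derivative_eq_intros\<close>)
  then show ?thesis using has_lvel_left_vel by fastforce
qed

text \<open>\<open>Ad\<close> is the partial derivative, at the fixed point \<open>e0\<close>, of
  conjugation as a joint function of parameter and group element.\<close>

lemma Ad_smooth:
  fixes f :: "'d::euclidean_space \<Rightarrow> 'a"
  assumes D: "open D" and f: "smooth_into G D f"
  shows "smooth_on D (\<lambda>x. Ad G (f x) Y)"
proof -
  let ?h = "\<lambda>p. f (fst p) \<otimes> ci (snd p) \<otimes> inv (f (fst p))"
  have o: "open (D \<times> cd ` dom0)" by (intro open_Times D cd_open)
  have h: "smooth_into G (D \<times> cd ` dom0) ?h"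
    by (intro smooth_into_mult smooth_into_inv smooth_into_compose[OF o D _ f]
        smooth_into_compose[OF o cd_open _ smooth_into_ci])
      (auto intro!: o smooth_on_bounded_linear bounded_linear_fst bounded_linear_snd)
  note N = smooth_into_cd[OF o h]
  have e: "(x, e0) \<in> (D \<times> cd ` dom0) \<inter> ?h -` dom0" if "x \<in> D" for x
    using that smooth_intoD(1)[OF f] one_dom0 by simp
  note P = smooth_on_partial[OF N D smooth_on_const[OF D] e]
  have "Ad G (f x) = (\<lambda>v. frechet_derivative (\<lambda>p. cd (?h p)) (at (x, e0)) (0, v))" if "x \<in> D" for x
  proof (rule has_derivative_unique)
    show "((\<lambda>y. cd (f x \<otimes> ci y \<otimes> inv (f x))) has_derivative Ad G (f x)) (at e0)"
      by (rule Ad_has_derivative[OF smooth_intoD(1)[OF f that]])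
    show "((\<lambda>y. cd (f x \<otimes> ci y \<otimes> inv (f x))) has_derivative
      (\<lambda>v. frechet_derivative (\<lambda>p. cd (?h p)) (at (x, e0)) (0, v))) (at e0)"
      using P(1)[OF _ that] by simp
  qed
  then show ?thesis using P(2)[of Y] smooth_on_cong[OF D, of "\<lambda>x. Ad G (f x) Y"] by simp
qed

section \<open>The bracket as the derivative of the adjoint representation\<close>

lemma bracket_eq:
  "bracket G X Y = frechet_derivative (\<lambda>z. Ad G (ci z) Y) (at e0) X"
  "((\<lambda>z. Ad G (ci z) Y) has_derivative (\<lambda>X. bracket G X Y)) (at e0)"
proof -
  have D: "((\<lambda>z. Ad G (ci z) Y) has_derivative frechet_derivative (\<lambda>z. Ad G (ci z) Y) (at e0)) (at e0)"
    by (rule smooth_on_has_derivative[OF cd_open Ad_smooth[OF cd_open smooth_into_ci] e0_in])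
  have *: "bracket G X Y = frechet_derivative (\<lambda>z. Ad G (ci z) Y) (at e0) X" for X
  proof -
    have "((\<lambda>s. e0 + s *\<^sub>R X) has_vector_derivative X) (at 0)" by (auto intro!: derivative_eq_intros)
    from has_vector_derivative_compose[OF this, of "\<lambda>z. Ad G (ci z) Y"] D
    show ?thesis unfolding bracket_def by (auto intro: vector_derivative_at)
  qed
  then show "bracket G X Y = frechet_derivative (\<lambda>z. Ad G (ci z) Y) (at e0) X" .
  show "((\<lambda>z. Ad G (ci z) Y) has_derivative (\<lambda>X. bracket G X Y)) (at e0)"
    unfolding * using D .
qed

text \<open>\<open>Ad G (\<alpha> s)\<close> is \<open>Ad G (\<alpha> t)\<close> after
  \<open>Ad\<close> of a curve through the identity, and at the identity the derivative of
  \<open>Ad\<close> is the bracket by definition.\<close>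

lemma Ad_deriv:
  assumes a: "has_lvel \<alpha> t X"
  shows "((\<lambda>s. Ad G (\<alpha> s) Y) has_vector_derivative Ad G (\<alpha> t) (bracket G X Y)) (at t)"
proof -
  let ?p = "\<lambda>s. inv (\<alpha> t) \<otimes> \<alpha> s"
  have p: "?p t = \<one>" "\<forall>\<^sub>F s in nhds t. ?p s \<in> dom0" "((\<lambda>s. cd (?p s)) has_vector_derivative X) (at t)"
    using has_lvel_vel1[OF a] unfolding vel1_def by auto
  have "((\<lambda>z. Ad G (ci z) Y) has_derivative (\<lambda>X. bracket G X Y)) (at (cd (?p t)))"
    unfolding p(1) by (rule bracket_eq)
  from has_vector_derivative_compose[OF p(3) this]
  have 1: "((\<lambda>s. Ad G (ci (cd (?p s))) Y) has_vector_derivative bracket G X Y) (at t)" .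
  have l: "bounded_linear (Ad G (\<alpha> t))" using linear_Ad[OF has_lvel_carrier[OF a]] linear_conv_bounded_linear by blast
  have "((\<lambda>s. Ad G (\<alpha> t) (Ad G (ci (cd (?p s))) Y)) has_vector_derivative Ad G (\<alpha> t) (bracket G X Y)) (at t)"
    using bounded_linear.has_vector_derivative[OF l 1] .
  then show ?thesis
  proof (rule has_vector_derivative_ev_cong)
    show "\<forall>\<^sub>F s in nhds t. Ad G (\<alpha> t) (Ad G (ci (cd (?p s))) Y) = Ad G (\<alpha> s) Y"
      using p(2) has_lvel_ev_carrier[OF a]
    proof eventually_elim
      case (elim s)
      then show ?case using has_lvel_carrier[OF a] by (simp flip: Ad_mult)
    qed
  qed
qed

lemma linear_bracket_left: "linear (\<lambda>X. bracket G X Y)"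
  using bracket_eq(2) has_derivative_linear by blast

text \<open>Linearity in the second argument is inherited from each map \<open>Ad G g\<close>, by
  differentiating along one curve with velocity \<open>X\<close>.\<close>

lemma linear_bracket_right: "linear (bracket G X)"
proof (rule linearI)
  have v: "vel1 (\<lambda>s. ci (e0 + s *\<^sub>R X)) 0 X" by (rule vel1_exists)
  then have ev: "\<forall>\<^sub>F s in nhds 0. ci (e0 + s *\<^sub>R X) \<in> carrier G" by (rule vel1_ev_carrier)
  have one: "ci (e0 + 0 *\<^sub>R X) = \<one>" using one_dom0 by simp
  have lv: "has_lvel (\<lambda>s. ci (e0 + s *\<^sub>R X)) 0 X"
    unfolding has_lvel_def one using ev
    by (auto intro!: vel1_cong[OF v] elim: eventually_mono)
  note D = Ad_deriv[OF lv, unfolded one Ad_one]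
  fix Y Z :: 'e and r :: real
  have "((\<lambda>s. Ad G (ci (e0 + s *\<^sub>R X)) (Y + Z)) has_vector_derivative bracket G X Y + bracket G X Z) (at 0)"
    by (rule has_vector_derivative_ev_cong[OF has_vector_derivative_add[OF D D]])
      (use ev in \<open>auto elim!: eventually_mono simp: linear_add[OF linear_Ad]\<close>)
  then show "bracket G X (Y + Z) = bracket G X Y + bracket G X Z"
    using D vector_derivative_unique_at by blast
  have "((\<lambda>s. Ad G (ci (e0 + s *\<^sub>R X)) (r *\<^sub>R Y)) has_vector_derivative r *\<^sub>R bracket G X Y) (at 0)"
    by (rule has_vector_derivative_ev_cong[OF bounded_linear.has_vector_derivative[OF bounded_linear_scaleR_right D]])
      (use ev in \<open>auto elim!: eventually_mono simp: linear_scale[OF linear_Ad]\<close>)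
  then show "bracket G X (r *\<^sub>R Y) = r *\<^sub>R bracket G X Y"
    using D vector_derivative_unique_at by blast
qed

end

section \<open>One-parameter subgroups\<close>

context lie_grp
begin

text \<open>The differential of left translation by \<open>ci z\<close> in coordinates: it converts
  left velocities into coordinate velocities, so that equations on the group become ordinary
  differential equations in the chart.\<close>

definition lf :: "'e \<Rightarrow> 'e \<Rightarrow> 'e" where
  "lf z v = frechet_derivative (\<lambda>p. cd (ci (fst p) \<otimes> ci (snd p))) (at (z, e0)) (0, v)"

lemma lf_lemma:
  shows "z \<in> cd ` dom0 \<Longrightarrow> ((\<lambda>y. cd (ci z \<otimes> ci y)) has_derivative lf z) (at e0)"
    and "smooth_on (cd ` dom0) (\<lambda>z. lf z v)"
proof -
  let ?h = "\<lambda>p. ci (fst p) \<otimes> ci (snd p)"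
  note N = smooth_into_cd[OF open_Times[OF cd_open cd_open] smooth_into_pair_mult]
  have e: "(z, e0) \<in> (cd ` dom0 \<times> cd ` dom0) \<inter> ?h -` dom0" if "z \<in> cd ` dom0" for z
    using that e0_in one_dom0 by (auto simp: dom0_carrier)
  note P = smooth_on_partial[OF N cd_open smooth_on_const[OF cd_open] e]
  show "z \<in> cd ` dom0 \<Longrightarrow> ((\<lambda>y. cd (ci z \<otimes> ci y)) has_derivative lf z) (at e0)"
    using P(1) unfolding lf_def by simp
  show "smooth_on (cd ` dom0) (\<lambda>z. lf z v)" using P(2)[of v] unfolding lf_def by simp
qed

lemma has_lvel_coord:
  assumes a: "has_lvel \<alpha> t X" and "\<alpha> t \<in> dom0"
  shows "((\<lambda>s. cd (\<alpha> s)) has_vector_derivative lf (cd (\<alpha> t)) X) (at t)"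
proof -
  let ?p = "\<lambda>s. inv (\<alpha> t) \<otimes> \<alpha> s"
  have p: "?p t = \<one>" "\<forall>\<^sub>F s in nhds t. ?p s \<in> dom0" "((\<lambda>s. cd (?p s)) has_vector_derivative X) (at t)"
    using has_lvel_vel1[OF a] unfolding vel1_def by auto
  have "((\<lambda>y. cd (ci (cd (\<alpha> t)) \<otimes> ci y)) has_derivative lf (cd (\<alpha> t))) (at (cd (?p t)))"
    unfolding p(1) using assms(2) by (intro lf_lemma) simp
  from has_vector_derivative_compose[OF p(3) this]
  have "((\<lambda>s. cd (ci (cd (\<alpha> t)) \<otimes> ci (cd (?p s)))) has_vector_derivative lf (cd (\<alpha> t)) X) (at t)" .
  then show ?thesis
  proof (rule has_vector_derivative_ev_cong)
    show "\<forall>\<^sub>F s in nhds t. cd (ci (cd (\<alpha> t)) \<otimes> ci (cd (?p s))) = cd (\<alpha> s)"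
      using p(2) has_lvel_ev_carrier[OF a]
      by eventually_elim (use assms(2) in \<open>simp add: dom0_carrier\<close>)
  qed
qed

lemma vel1_has_lvel:
  assumes "vel1 p t X"
  shows "has_lvel p t X"
proof -
  have "p t = \<one>" using assms unfolding vel1_def by simp
  then show ?thesis unfolding has_lvel_def
    using vel1_ev_carrier[OF assms] by (auto intro!: vel1_cong[OF assms] elim: eventually_mono)
qed

text \<open>The converse of \<open>has_lvel_coord\<close>. That \<open>lder ci z\<close> undoes
  \<open>lf z\<close> is seen on the curve \<open>ci z \<otimes> ci (e0 + s *\<^sub>R X)\<close>,
  whose left velocity is computed once directly and once through the chart.\<close>

lemma has_lvel_of_coord:
  assumes z: "z t \<in> cd ` dom0" "(z has_vector_derivative lf (z t) X) (at t)"
  shows "has_lvel (\<lambda>s. ci (z s)) t X"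
proof -
  have "lder ci (z t) (lf (z t) X) = X"
  proof -
    let ?a = "\<lambda>s. ci (z t) \<otimes> ci (e0 + s *\<^sub>R X)"
    have zt: "ci (z t) \<in> carrier G" "ci (z t) \<in> dom0" using z(1) ci_in dom0_carrier by auto
    have a: "has_lvel ?a 0 X" by (rule has_lvel_cmult[OF zt(1) vel1_has_lvel[OF vel1_exists]])
    have a0: "?a 0 = ci (z t)" using one_dom0 zt by simp
    from has_lvel_coord[OF a] a0 zt(2) z(1)
    have d: "((\<lambda>s. cd (?a s)) has_vector_derivative lf (z t) X) (at 0)" by simp
    have "has_lvel (\<lambda>s. ci (cd (?a s))) 0 (lder ci (cd (?a 0)) (lf (z t) X))"
      by (rule has_lvel_lder[OF cd_open smooth_into_ci _ d]) (use a0 z(1) in simp)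
    then have "has_lvel (\<lambda>s. ci (cd (?a s))) 0 (lder ci (z t) (lf (z t) X))" using a0 z(1) by simp
    moreover have "\<forall>\<^sub>F s in nhds 0. ci (cd (?a s)) = ?a s"
    proof -
      have "\<forall>\<^sub>F s in nhds 0. cd (?a s) \<in> cd ` dom0"
        by (rule isCont_eventually_in_open[OF has_vector_derivative_continuous[OF d] cd_open]) (use a0 z(1) in simp)
      have "smooth_into G (cd ` dom0) (\<lambda>y. ci (z t) \<otimes> ci y)"
        by (intro smooth_into_mult smooth_into_const smooth_into_ci cd_open zt)
      note o = smooth_into_cd(1)[OF cd_open this]
      have "isCont (\<lambda>s. e0 + s *\<^sub>R X) 0" by (intro continuous_intros)
      then have "\<forall>\<^sub>F s in nhds 0. e0 + s *\<^sub>R X \<in> cd ` dom0 \<inter> (\<lambda>y. ci (z t) \<otimes> ci y) -` dom0"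
        by (rule isCont_eventually_in_open[OF _ o]) (use e0_in a0 zt(2) in simp)
      then show ?thesis by eventually_elim simp
    qed
    ultimately have "has_lvel ?a 0 (lder ci (z t) (lf (z t) X))" by (rule has_lvel_cong)
    then show ?thesis using a has_lvel_unique by blast
  qed
  then show ?thesis using has_lvel_lder[OF cd_open smooth_into_ci z] by simp
qed

text \<open>A group curve steered by an auxiliary vector \<open>N\<close> whose own equation does
  not involve the group. With \<open>Q = 0\<close> it yields local one-parameter subgroups, with the
  Euler equation for \<open>Q\<close> it yields geodesics.\<close>

lemma lie_ODE:
  fixes B Q :: "'e \<Rightarrow> 'e"
  assumes B: "linear B" and Q: "smooth_on UNIV Q"
  obtains e \<alpha> N where "e > 0" "smooth_into G {-e<..<e} \<alpha>" "\<alpha> 0 = \<one>" "N 0 = N0"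
    "\<And>t. t \<in> {-e<..<e} \<Longrightarrow> has_lvel \<alpha> t (B (N t))"
    "\<And>t. t \<in> {-e<..<e} \<Longrightarrow> (N has_vector_derivative Q (N t)) (at t)"
proof -
  let ?S = "cd ` dom0 \<times> (UNIV :: 'e set)"
  have oS: "open ?S" by (intro open_Times cd_open open_UNIV)
  \<comment> \<open>\<open>lf\<close> is expanded in the basis since its smoothness in the base
    point is available for fixed directions.\<close>
  define F where "F p = (\<Sum>b\<in>Basis. (B (snd p) \<bullet> b) *\<^sub>R lf (fst p) b, Q (snd p))" for p :: "'e \<times> 'e"
  have s1: "smooth_on ?S fst" "smooth_on ?S snd"
    by (intro smooth_on_bounded_linear oS bounded_linear_fst bounded_linear_snd)+
  have s2: "smooth_on ?S (\<lambda>p. B (snd p))" by (rule smooth_on_linear_compose[OF oS B s1(2)])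
  have s3: "smooth_on ?S (\<lambda>p. lf (fst p) b)" for b
    by (rule smooth_on_compose[OF oS cd_open _ lf_lemma(2) s1(1)]) auto
  have s4: "smooth_on ?S (\<lambda>p. Q (snd p))"
    by (rule smooth_on_compose[OF oS open_UNIV _ Q s1(2)]) auto
  have F: "smooth_on ?S F"
    unfolding F_def
    by (intro smooth_on_Pair smooth_on_sum oS s4 smooth_on_bilinear[OF bounded_bilinear_scaleR oS _ s3]
        smooth_on_bilinear[OF bounded_bilinear_inner oS s2 smooth_on_const])
  have lf_sum: "(\<Sum>b\<in>Basis. (w \<bullet> b) *\<^sub>R lf z b) = lf z w" if "z \<in> cd ` dom0" for z w
  proof -
    have "linear (lf z)" using lf_lemma(1)[OF that] by (rule has_derivative_linear)
    then have "lf z (\<Sum>b\<in>Basis. (w \<bullet> b) *\<^sub>R b) = (\<Sum>b\<in>Basis. (w \<bullet> b) *\<^sub>R lf z b)"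
      by (simp add: linear_sum linear_scale)
    then show ?thesis by (simp add: euclidean_representation)
  qed
  have "(e0, N0) \<in> ?S" using e0_in by simp
  from ODE_solution_exists[OF oS F this] obtain e x where e: "e > 0" "x 0 = (e0, N0)"
    and x: "\<And>t. t \<in> {-e<..<e} \<Longrightarrow> x t \<in> ?S \<and> (x has_vector_derivative F (x t)) (at t)" by blast
  have xin: "fst (x t) \<in> cd ` dom0" if "t \<in> {-e<..<e}" for t
    using conjunct1[OF x[OF that]] by (simp only: mem_Times_iff)
  have xs: "smooth_on {-e<..<e} x"
    by (rule smooth_on_ODE_solution[OF open_greaterThanLessThan oS F]) (use x in blast)+
  have zs: "smooth_on {-e<..<e} (\<lambda>t. fst (x t))"
    by (rule smooth_on_linear_compose[OF _ linear_fst xs]) simp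
  have N: "((\<lambda>t. snd (x t)) has_vector_derivative Q (snd (x t))) (at t)" if "t \<in> {-e<..<e}" for t
    using bounded_linear.has_vector_derivative[OF bounded_linear_snd conjunct2[OF x[OF that]]] by (simp add: F_def)
  have z: "has_lvel (\<lambda>t. ci (fst (x t))) t (B (snd (x t)))" if "t \<in> {-e<..<e}" for t
  proof (rule has_lvel_of_coord)
    show zt: "fst (x t) \<in> cd ` dom0" by (rule xin[OF that])
    show "((\<lambda>t. fst (x t)) has_vector_derivative lf (fst (x t)) (B (snd (x t)))) (at t)"
      using bounded_linear.has_vector_derivative[OF bounded_linear_fst conjunct2[OF x[OF that]]] lf_sum[OF zt]
      by (simp add: F_def)
  qed
  have "smooth_into G {-e<..<e} (\<lambda>t. ci (fst (x t)))"
    by (rule smooth_into_compose[OF open_greaterThanLessThan cd_open _ smooth_into_ci zs])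
      (use xin in blast)
  moreover have "ci (fst (x 0)) = \<one>" "snd (x 0) = N0" using e(2) one_dom0 by simp_all
  ultimately show ?thesis by (intro that[OF e(1) _ _ _ z N])
qed

text \<open>Around each time the translated curve lies in the base chart and its coordinates have
  derivative \<open>lf\<close> of 0, that is 0. So the curve is locally constant, and the domain is
  connected.\<close>

lemma has_lvel_zero_const:
  assumes "open I" "connected I" and d: "\<And>t. t \<in> I \<Longrightarrow> has_lvel \<delta> t 0" and "s \<in> I" "t \<in> I"
  shows "\<delta> s = \<delta> t"
proof (rule connected_local_const[OF assms(2,4,5)], rule ballI)
  fix t0 assume t0: "t0 \<in> I"
  note v = has_lvel_vel1[OF d[OF t0], unfolded vel1_def]
  have "\<forall>\<^sub>F s in nhds t0. inv (\<delta> t0) \<otimes> \<delta> s \<in> dom0 \<and> s \<in> I"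
    using v eventually_nhds_in_open[OF assms(1) t0] by (auto elim: eventually_elim2)
  then obtain r where r: "r > 0" "\<And>s. s \<in> ball t0 r \<Longrightarrow> inv (\<delta> t0) \<otimes> \<delta> s \<in> dom0 \<and> s \<in> I"
    by (auto simp: eventually_nhds_metric dist_commute)
  have g: "\<delta> t0 \<in> carrier G" using d[OF t0] by (rule has_lvel_carrier)
  have "((\<lambda>s. cd (inv (\<delta> t0) \<otimes> \<delta> s)) has_derivative (\<lambda>h. 0)) (at s within ball t0 r)" if s: "s \<in> ball t0 r" for s
  proof -
    have "has_lvel (\<lambda>s. inv (\<delta> t0) \<otimes> \<delta> s) s 0"
      using r(2)[OF s] g by (intro has_lvel_cmult d) auto
    from has_lvel_coord[OF this conjunct1[OF r(2)[OF s]]]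
    have "((\<lambda>s. cd (inv (\<delta> t0) \<otimes> \<delta> s)) has_vector_derivative 0) (at s)"
      using linear_0[OF has_derivative_linear[OF lf_lemma(1)]] r(2)[OF s] by simp
    then show ?thesis unfolding has_vector_derivative_def by (simp add: has_derivative_at_withinI)
  qed
  from has_derivative_zero_constant[OF convex_ball this] obtain c
    where c: "\<And>s. s \<in> ball t0 r \<Longrightarrow> cd (inv (\<delta> t0) \<otimes> \<delta> s) = c" by blast
  have "\<delta> t0 = \<delta> s" if s: "s \<in> ball t0 r" for s
  proof -
    have t: "t0 \<in> ball t0 r" using r by simp
    have "ci (cd (inv (\<delta> t0) \<otimes> \<delta> s)) = ci (cd (inv (\<delta> t0) \<otimes> \<delta> t0))" using c[OF s] c[OF t] by simp
    then have "inv (\<delta> t0) \<otimes> \<delta> s = inv (\<delta> t0) \<otimes> \<delta> t0" using r(2)[OF s] r(2)[OF t] ci_cd by metis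
    then have "\<delta> t0 \<otimes> (inv (\<delta> t0) \<otimes> \<delta> s) = \<delta> t0 \<otimes> (inv (\<delta> t0) \<otimes> \<delta> t0)" by simp
    then show ?thesis using g has_lvel_carrier[OF d[of s]] r(2)[OF s] by (simp del: l_inv)
  qed
  then have "\<forall>\<^sub>F s in at t0. \<delta> t0 = \<delta> s"
    using r(1) by (auto simp: eventually_at dist_commute)
  then show "\<forall>\<^sub>F s in at t0 within I. \<delta> t0 = \<delta> s"
    by (rule filter_leD[OF at_le[OF subset_UNIV]])
qed

text \<open>In \<open>\<alpha> \<otimes> inv \<beta>\<close> the contributions of the two equal left
  velocities cancel under \<open>Ad G (\<beta> s)\<close>, so this product is constant.\<close>

lemma has_lvel_determines:
  assumes I: "open I" "connected I" and a: "\<And>t. t \<in> I \<Longrightarrow> has_lvel \<alpha> t (X t)"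
    and b: "\<And>t. t \<in> I \<Longrightarrow> has_lvel \<beta> t (X t)" and "t0 \<in> I" "\<alpha> t0 = \<beta> t0" "t \<in> I"
  shows "\<alpha> t = \<beta> t"
proof -
  have z: "has_lvel (\<lambda>s. \<alpha> s \<otimes> inv (\<beta> s)) s 0" if "s \<in> I" for s
  proof -
    have c: "\<beta> s \<in> carrier G" using b[OF that] by (rule has_lvel_carrier)
    show ?thesis using has_lvel_mult[OF a[OF that] has_lvel_inv[OF b[OF that]]] c by simp
  qed
  have "\<alpha> t \<otimes> inv (\<beta> t) = \<alpha> t0 \<otimes> inv (\<beta> t0)"
    by (rule has_lvel_zero_const[OF I z]) (use assms in auto)
  also have "\<dots> = \<one>" using assms has_lvel_carrier[OF b] by simp
  finally show ?thesis
    using has_lvel_carrier[OF a[OF assms(7)]] has_lvel_carrier[OF b[OF assms(7)]]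
    by (metis inv_equality inv_inv inv_closed)
qed

lemma one_param_subgroupD:
  assumes "one_param_subgroup G \<gamma>"
  shows "\<gamma> t \<in> carrier G" "\<gamma> (s + t) = \<gamma> s \<otimes> \<gamma> t" "\<gamma> 0 = \<one>" "\<gamma> (- t) = inv (\<gamma> t)"
    "smooth_into G UNIV \<gamma>"
proof -
  show c: "\<gamma> t \<in> carrier G" for t
    using assms smooth_intoD(1) unfolding one_param_subgroup_def by blast
  show m: "\<gamma> (s + t) = \<gamma> s \<otimes> \<gamma> t" for s t
    using assms unfolding one_param_subgroup_def by blast
  show s: "smooth_into G UNIV \<gamma>" using assms unfolding one_param_subgroup_def by blast
  have "\<gamma> 0 \<otimes> \<gamma> 0 = \<gamma> 0" using m[of 0 0] by simp
  then show z: "\<gamma> 0 = \<one>" using c[of 0] by (metis r_cancel_one)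
  show "\<gamma> (- t) = inv (\<gamma> t)"
    using m[of "-t" t] z c by (metis add.left_inverse inv_equality)
qed

lemma one_param_subgroup_lvel:
  assumes g: "one_param_subgroup G \<gamma>" and v: "has_lvel \<gamma> 0 X"
  shows "has_lvel \<gamma> t X"
proof -
  have "has_lvel (\<lambda>s. \<gamma> (s - t)) t (1 *\<^sub>R X)"
    by (rule has_lvel_reparam) (use v in \<open>auto intro!: derivative_eq_intros\<close>)
  from has_lvel_cmult[OF one_param_subgroupD(1)[OF g, of t] this]
  have "has_lvel (\<lambda>s. \<gamma> t \<otimes> \<gamma> (s - t)) t X" by simp
  moreover have "\<gamma> t \<otimes> \<gamma> (s - t) = \<gamma> s" for s
  proof -
    have "\<gamma> t \<otimes> \<gamma> (s - t) = \<gamma> (t + (s - t))" by (rule one_param_subgroupD(2)[OF g, symmetric])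
    then show ?thesis by (simp only: add_diff_cancel_left' add_diff_eq)
  qed
  ultimately show ?thesis by (simp only:)
qed

text \<open>The local solution is a local homomorphism, because translates of it have the same left
  velocity. It is continued to all times by powers of values at small times.\<close>

lemma one_param_subgroup_exists:
  obtains \<gamma> where "one_param_subgroup G \<gamma>" "has_lvel \<gamma> 0 X"
proof -
  obtain e \<alpha> N where e: "e > 0" "smooth_into G {-e<..<e} \<alpha>" "\<alpha> 0 = \<one>" "N 0 = X"
    and a: "\<And>t. t \<in> {-e<..<e} \<Longrightarrow> has_lvel \<alpha> t (N t)"
    and N: "\<And>t. t \<in> {-e<..<e} \<Longrightarrow> (N has_vector_derivative 0) (at t)"
    by (rule lie_ODE[OF linear_ident smooth_on_const[OF open_UNIV], of X 0]) (rule that)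
  have NX: "N t = X" if "t \<in> {-e<..<e}" for t
  proof -
    have "(N has_derivative (\<lambda>h. 0)) (at s within {-e<..<e})" if "s \<in> {-e<..<e}" for s
      using N[OF that] unfolding has_vector_derivative_def by (simp add: has_derivative_at_withinI)
    from has_derivative_zero_constant[OF _ this] obtain c where "\<And>s. s \<in> {-e<..<e} \<Longrightarrow> N s = c"
      using convex_real_interval by blast
    from this[of t] this[of 0] show ?thesis using that e(1,4) by simp
  qed
  have aX: "has_lvel \<alpha> t X" if "\<bar>t\<bar> < e" for t
  proof -
    have "t \<in> {-e<..<e}" using that by (simp add: abs_less_iff)
    then show ?thesis using a[of t] NX[of t] by simp
  qed
  have ac: "\<alpha> t \<in> carrier G" if "\<bar>t\<bar> < e" for t by (rule has_lvel_carrier[OF aX[OF that]])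
  have add: "\<alpha> (s + t) = \<alpha> s \<otimes> \<alpha> t" if "\<bar>s\<bar> + \<bar>t\<bar> < e" for s t
  proof -
    define I where "I = {- (e - \<bar>s\<bar>)<..<e - \<bar>s\<bar>}"
    show ?thesis
    proof (rule has_lvel_determines[where I=I and X="\<lambda>t. X" and ?t0.0=0])
      show "open I" "connected I" "0 \<in> I" "t \<in> I" using that by (auto simp: I_def)
      show "\<alpha> (s + 0) = \<alpha> s \<otimes> \<alpha> 0" using e(3) ac[of s] that by simp
      fix u assume u: "u \<in> I"
      have "has_lvel (\<lambda>t. \<alpha> (s + t)) u (1 *\<^sub>R X)"
        by (rule has_lvel_reparam) (use u in \<open>auto simp: I_def intro!: aX derivative_eq_intros\<close>)
      then show "has_lvel (\<lambda>t. \<alpha> (s + t)) u X" by simp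
      show "has_lvel (\<lambda>t. \<alpha> s \<otimes> \<alpha> t) u X"
        using u that by (intro has_lvel_cmult ac aX) (auto simp: I_def)
    qed
  qed
  have pow: "\<alpha> (real m * u) = \<alpha> u [^] m" if "real m * \<bar>u\<bar> < e" for m u
    using that
  proof (induction m)
    case (Suc m)
    have "\<alpha> (real (Suc m) * u) = \<alpha> (real m * u + u)" by (simp add: algebra_simps)
    also have "\<dots> = \<alpha> (real m * u) \<otimes> \<alpha> u"
      by (rule add) (use Suc.prems in \<open>simp add: abs_mult algebra_simps\<close>)
    also have "\<alpha> (real m * u) = \<alpha> u [^] m"
    proof (rule Suc.IH)
      have "real (Suc m) * \<bar>u\<bar> = real m * \<bar>u\<bar> + \<bar>u\<bar>" by (simp add: algebra_simps)
      then show "real m * \<bar>u\<bar> < e" using Suc.prems abs_ge_zero[of u] by linarith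
    qed
    finally show ?case by simp
  qed (use e in simp)
  \<comment> \<open>With this \<open>n t\<close> the argument \<open>t / real (n t)\<close> is
    smaller than \<open>e / 2\<close>, inside the domain of the local solution. As the exponent
    depends on \<open>t\<close>, the homomorphism property needs independence of the
    exponent.\<close>
  define n where "n t = Suc (nat \<lceil>2 * \<bar>t\<bar> / e\<rceil>)" for t
  define \<gamma> where "\<gamma> t = \<alpha> (t / real (n t)) [^] n t" for t
  have n: "\<bar>t / real (n t)\<bar> < e / 2" for t
  proof -
    have "2 * \<bar>t\<bar> / e < real (n t)" unfolding n_def by linarith
    then have "2 * \<bar>t\<bar> < real (n t) * e" using e(1) by (simp add: divide_less_eq)
    then show ?thesis by (simp add: n_def abs_divide field_simps)
  qed
  have n0: "n t > 0" for t by (simp add: n_def)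
  \<comment> \<open>Two exponents are compared through their product: both roots are powers of the
    value at \<open>t / (m * n t)\<close>.\<close>
  have eq: "\<gamma> t = \<alpha> (t / real m) [^] m" if m: "m > 0" "\<bar>t / real m\<bar> < e" for t m
  proof -
    let ?k = "n t"
    have div: "\<bar>t / real (i * j)\<bar> * real j = \<bar>t / real i\<bar>" if "j > 0" for i j
      using that by (simp add: abs_divide)
    have lt: "\<bar>t / real ?k\<bar> < e" using n[of t] e(1) by linarith
    have 1: "\<alpha> (t / real m) = \<alpha> (t / real (m * ?k)) [^] ?k"
      using pow[of ?k "t / real (m * ?k)"] div[of ?k m] m(2) n0[of t] by (simp add: mult.commute)
    have 2: "\<alpha> (t / real ?k) = \<alpha> (t / real (?k * m)) [^] m"
      using pow[of m "t / real (?k * m)"] div[of m ?k] lt m(1) by (simp add: mult.commute)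
    have "\<bar>t / real (m * ?k)\<bar> \<le> \<bar>t / real m\<bar>"
      using n0[of t] m(1) mult_left_mono[of 1 "real (n t)" "\<bar>t\<bar>"] by (simp add: abs_divide field_simps)
    then have c: "\<alpha> (t / real (m * ?k)) \<in> carrier G" using m(2) by (intro ac) simp
    show ?thesis unfolding \<gamma>_def 1 2 using c by (simp add: nat_pow_pow mult.commute)
  qed
  have gc: "\<gamma> t \<in> carrier G" for t
    unfolding \<gamma>_def using n[of t] e(1) by (intro nat_pow_closed ac) linarith
  have ga: "\<gamma> t = \<alpha> t" if "\<bar>t\<bar> < e" for t
    using eq[of 1 t] that ac by simp
  have hom: "\<gamma> (s + t) = \<gamma> s \<otimes> \<gamma> t" for s t
  proof -
    \<comment> \<open>One exponent, chosen for \<open>\<bar>s\<bar> + \<bar>t\<bar>\<close>, serves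
      \<open>s\<close>, \<open>t\<close> and \<open>s + t\<close>. The power of the product splits
      because the two factors commute: in either order they give the value at
      \<open>(s + t) / m\<close>.\<close>
    define m where "m = n (\<bar>s\<bar> + \<bar>t\<bar>)"
    have m0: "m > 0" unfolding m_def by (rule n0)
    have "\<bar>(\<bar>s\<bar> + \<bar>t\<bar>) / real m\<bar> < e / 2" unfolding m_def by (rule n)
    then have sum: "\<bar>s / real m\<bar> + \<bar>t / real m\<bar> < e / 2" by (simp add: abs_divide add_divide_distrib)
    then have l: "\<bar>s / real m\<bar> < e" "\<bar>t / real m\<bar> < e" "\<bar>(s + t) / real m\<bar> < e"
      using e(1) by (simp_all only: add_divide_distrib)
    have c: "\<alpha> (s / real m) \<in> carrier G" "\<alpha> (t / real m) \<in> carrier G" using l by (auto intro: ac)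
    have st: "\<alpha> ((s + t) / real m) = \<alpha> (s / real m) \<otimes> \<alpha> (t / real m)"
      unfolding add_divide_distrib by (rule add) (use sum e(1) in linarith)
    have ts: "\<alpha> ((s + t) / real m) = \<alpha> (t / real m) \<otimes> \<alpha> (s / real m)"
      unfolding add_divide_distrib add.commute[of "s / real m"] by (rule add) (use sum e(1) in linarith)
    have "\<gamma> (s + t) = (\<alpha> (s / real m) \<otimes> \<alpha> (t / real m)) [^] m" using eq[OF m0 l(3)] st by simp
    also have "\<dots> = \<alpha> (s / real m) [^] m \<otimes> \<alpha> (t / real m) [^] m"
      using st ts c by (intro pow_mult_distrib) auto
    finally show ?thesis using eq[OF m0 l(1)] eq[OF m0 l(2)] by simp
  qed
  have "smooth_into G UNIV \<gamma>"
  proof (rule smooth_into_local[OF open_UNIV])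
    fix t0 :: real
    let ?T = "{t0 - e<..<t0 + e}"
    have "smooth_into G ?T (\<lambda>t. \<gamma> t0 \<otimes> \<alpha> (t - t0))"
    proof (intro smooth_into_mult smooth_into_const gc smooth_into_compose[OF _ _ _ e(2)])
      have "smooth_on ?T (\<lambda>t. t + (- t0))"
        by (intro smooth_on_add smooth_on_id smooth_on_const open_greaterThanLessThan)
      then show "smooth_on ?T (\<lambda>t. t - t0)" by simp
    qed auto
    then have "smooth_into G ?T \<gamma>"
    proof (rule smooth_into_cong[rotated])
      fix t assume "t \<in> ?T"
      then have "\<gamma> (t - t0) = \<alpha> (t - t0)" by (intro ga) auto
      then show "\<gamma> t0 \<otimes> \<alpha> (t - t0) = \<gamma> t" using hom[of t0 "t - t0"] by simp
    qed simp
    then show "\<exists>T. open T \<and> t0 \<in> T \<and> smooth_into G (UNIV \<inter> T) \<gamma>"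
      using e(1) by (intro exI[of _ ?T]) auto
  qed
  then have "one_param_subgroup G \<gamma>" unfolding one_param_subgroup_def using hom by blast
  moreover have "has_lvel \<gamma> 0 X"
  proof (rule has_lvel_cong[OF aX])
    have "\<forall>\<^sub>F s in nhds 0. s \<in> {-e<..<e}" using e(1) by (intro eventually_nhds_in_open) auto
    then show "\<forall>\<^sub>F s in nhds 0. \<alpha> s = \<gamma> s" by eventually_elim (use ga in auto)
  qed (use e in simp)
  ultimately show ?thesis using that by blast
qed

text \<open>A one-parameter subgroup is commutative, so its \<open>Ad\<close> fixes its own
  velocity; differentiating this gives 0, and polarisation then yields skew-symmetry.\<close>

lemma bracket_self: "bracket G X X = 0"
proof -
  obtain \<gamma> where g: "one_param_subgroup G \<gamma>" "has_lvel \<gamma> 0 X" by (rule one_param_subgroup_exists)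
  note gD = one_param_subgroupD[OF g(1)]
  have v: "vel1 \<gamma> 0 X" by (rule vel1_cong[OF has_lvel_vel1[OF g(2)]]) (simp add: gD)
  have "Ad G (\<gamma> t) X = X" for t
  proof (rule vel1_unique[OF _ v])
    have "\<gamma> t \<otimes> \<gamma> s \<otimes> inv (\<gamma> t) = \<gamma> s" for s
      using gD(2)[of t s] gD(2)[of "t + s" "- t"] gD(4)[of t] by simp
    then show "vel1 \<gamma> 0 (Ad G (\<gamma> t) X)" using Ad_has_derivative(2)[OF gD(1) v, of t] by simp
  qed
  then have "((\<lambda>s. X) has_vector_derivative Ad G (\<gamma> 0) (bracket G X X)) (at 0)"
    using Ad_deriv[OF g(2), of X] by simp
  from vector_derivative_unique_at[OF this has_vector_derivative_const] show ?thesis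
    by (simp add: gD(3) Ad_one)
qed

lemma bracket_skew: "bracket G X Y = - bracket G Y X"
proof -
  have "bracket G (X + Y) (X + Y) = bracket G X X + bracket G X Y + (bracket G Y X + bracket G Y Y)"
    using linear_add[OF linear_bracket_left] linear_add[OF linear_bracket_right] by simp
  then show ?thesis using bracket_self by (simp add: eq_neg_iff_add_eq_0)
qed

lemma Ad_bracket:
  assumes "g \<in> carrier G"
  shows "Ad G g (bracket G X Y) = bracket G (Ad G g X) (Ad G g Y)"
proof -
  obtain \<gamma> where g: "one_param_subgroup G \<gamma>" "has_lvel \<gamma> 0 X" by (rule one_param_subgroup_exists)
  note gD = one_param_subgroupD[OF g(1)]
  have v: "vel1 \<gamma> 0 X" by (rule vel1_cong[OF has_lvel_vel1[OF g(2)]]) (simp add: gD)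
  have "has_lvel (\<lambda>s. g \<otimes> \<gamma> s \<otimes> inv g) 0 (Ad G g X)"
    by (rule vel1_has_lvel[OF Ad_has_derivative(2)[OF assms v]])
  note 1 = Ad_deriv[OF this, of "Ad G g Y"]
  have E: "(\<lambda>s. Ad G (g \<otimes> \<gamma> s \<otimes> inv g) (Ad G g Y)) = (\<lambda>s. Ad G g (Ad G (\<gamma> s) Y))"
    using assms gD(1) by (intro ext) (simp add: Ad_mult)
  have "bounded_linear (Ad G g)" using linear_Ad[OF assms] linear_conv_bounded_linear by blast
  from bounded_linear.has_vector_derivative[OF this Ad_deriv[OF g(2)]]
  have "((\<lambda>s. Ad G g (Ad G (\<gamma> s) Y)) has_vector_derivative Ad G g (Ad G (\<gamma> 0) (bracket G X Y))) (at 0)" .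
  from vector_derivative_unique_at[OF this 1[unfolded E]] show ?thesis
    using assms by (simp add: gD(3) Ad_one)
qed

text \<open>The derivative at 0 of the statement that \<open>Ad G (\<gamma> s)\<close> preserves
  brackets, along a one-parameter subgroup with velocity \<open>Z\<close>.\<close>

lemma jacobi: "bracket G Z (bracket G X Y) = bracket G (bracket G Z X) Y + bracket G X (bracket G Z Y)"
proof -
  obtain \<gamma> where g: "one_param_subgroup G \<gamma>" "has_lvel \<gamma> 0 Z" by (rule one_param_subgroup_exists)
  note gD = one_param_subgroupD[OF g(1)]
  have bb: "bounded_bilinear (bracket G)"
    using linear_bracket_left linear_bracket_right bilinear_conv_bounded_bilinear
    unfolding bilinear_def by blast
  have D: "((\<lambda>s. Ad G (\<gamma> s) Y) has_vector_derivative bracket G Z Y) (at 0)" for Y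
    using Ad_deriv[OF g(2), of Y] gD(3) Ad_one by simp
  have "((\<lambda>s. bracket G (Ad G (\<gamma> s) X) (Ad G (\<gamma> s) Y)) has_vector_derivative
      bracket G (Ad G (\<gamma> 0) X) (bracket G Z Y) + bracket G (bracket G Z X) (Ad G (\<gamma> 0) Y)) (at 0)"
    by (rule bounded_bilinear.has_vector_derivative[OF bb D D])
  moreover have "(\<lambda>s. bracket G (Ad G (\<gamma> s) X) (Ad G (\<gamma> s) Y)) = (\<lambda>s. Ad G (\<gamma> s) (bracket G X Y))"
    using gD(1) by (intro ext) (simp add: Ad_bracket)
  ultimately have "((\<lambda>s. Ad G (\<gamma> s) (bracket G X Y)) has_vector_derivative
      bracket G (Ad G (\<gamma> 0) X) (bracket G Z Y) + bracket G (bracket G Z X) (Ad G (\<gamma> 0) Y)) (at 0)"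
    by (simp only:)
  from vector_derivative_unique_at[OF D[of "bracket G X Y"] this] show ?thesis
    by (simp add: gD(3) Ad_one add.commute)
qed

end

section \<open>Closed subgroups\<close>

text \<open>The bound is uniform in the first variable, which will be the time of a conjugating
  element or the coordinates of a partial product.\<close>

lemma smooth_on_lipschitz_snd:
  fixes K :: "'c::euclidean_space \<times> 'd::euclidean_space \<Rightarrow> 'f::real_normed_vector"
  assumes "open N" "smooth_on N K" "(a, b) \<in> N"
  obtains r L where "r > 0" "L \<ge> 0"
    "\<And>x y. dist a x \<le> r \<Longrightarrow> dist b y \<le> r \<Longrightarrow> (x, y) \<in> N \<and> norm (K (x, y) - K (x, b)) \<le> L * norm (y - b)"
proof -
  obtain r L where r: "r > 0" "L \<ge> 0" "cball (a, b) r \<subseteq> N"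
    and L: "\<And>p q. p \<in> cball (a, b) r \<Longrightarrow> q \<in> cball (a, b) r \<Longrightarrow> norm (K p - K q) \<le> L * norm (p - q)"
    by (rule smooth_on_lipschitz[OF assms]) (rule that)
  have in_ball: "(x, y) \<in> cball (a, b) r" if "dist a x \<le> r / 2" "dist b y \<le> r / 2" for x y
  proof -
    have "dist (a, b) (x, y) \<le> dist a x + dist b y"
      unfolding dist_Pair_Pair by (intro sqrt_sum_squares_le_sum) auto
    then show ?thesis using that by simp
  qed
  have "(x, y) \<in> N \<and> norm (K (x, y) - K (x, b)) \<le> L * norm (y - b)"
    if "dist a x \<le> r / 2" "dist b y \<le> r / 2" for x y
  proof -
    have "(x, b) \<in> cball (a, b) r" using that(1) r(1) by (intro in_ball) auto
    from L[OF in_ball[OF that] this] show ?thesis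
      using in_ball[OF that] r(3) by (auto simp: norm_Pair)
  qed
  then show ?thesis using that[of "r / 2" L] r by simp
qed

locale lie_closed_subgroup = lie_grp G for G :: "('a::t2_space, 'e::euclidean_space) lie_structure" (structure) +
  fixes H :: "'a set"
  assumes subH: "subgroup H G" and closedH: "closedin (top_of_set (carrier G)) H"

context lie_closed_subgroup
begin

abbreviation hh :: "'e set" where "hh \<equiv> lie_algebra_of G H"

lemma H_carrier: "h \<in> H \<Longrightarrow> h \<in> carrier G"
  and H_mult: "h \<in> H \<Longrightarrow> k \<in> H \<Longrightarrow> h \<otimes> k \<in> H"
  and H_inv: "h \<in> H \<Longrightarrow> inv h \<in> H"
  and H_one: "\<one> \<in> H"
  using subH subgroup.mem_carrier subgroup.m_closed subgroup.m_inv_closed subgroup.one_closed by metis+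

lemma H_pow: "h \<in> H \<Longrightarrow> h [^] (n::nat) \<in> H"
  by (induction n) (auto simp: H_one H_mult)

text \<open>With \<open>p(s) = \<gamma>(s) \<delta>(s)\<close> and \<open>\<delta>'(0) = 0\<close>, the group element \<open>p(u/n)\<^sup>n \<gamma>(u)\<inverse>\<close> is the product
  of the conjugates \<open>\<gamma>(ku/n) \<delta>(u/n) \<gamma>(ku/n)\<inverse>\<close>, each of which is within \<open>o(1/n)\<close> of the identity.\<close>

lemma one_param_subgroup_in_closed:
  assumes g: "one_param_subgroup G \<gamma>" "has_lvel \<gamma> 0 X"
    and p: "vel1 p 0 X" "\<forall>\<^sub>F s in nhds 0. p s \<in> H"
  shows "\<gamma> u \<in> H"
proof -
  note gD = one_param_subgroupD[OF g(1)]
  let ?h1 = "\<lambda>q. \<gamma> (fst q) \<otimes> ci (snd q) \<otimes> inv (\<gamma> (fst q))"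
  have o1: "open ((UNIV :: real set) \<times> cd ` dom0)" by (intro open_Times cd_open open_UNIV)
  have h1: "smooth_into G (UNIV \<times> cd ` dom0) ?h1"
    by (intro smooth_into_mult smooth_into_inv smooth_into_compose[OF o1 open_UNIV _ gD(5)]
        smooth_into_compose[OF o1 cd_open _ smooth_into_ci])
      (auto intro!: o1 smooth_on_bounded_linear bounded_linear_fst bounded_linear_snd)
  note N1 = smooth_into_cd[OF o1 h1]
  have "(0, e0) \<in> (UNIV \<times> cd ` dom0) \<inter> ?h1 -` dom0" using one_dom0 gD(3) by simp
  then obtain r1 L1 where r1: "r1 > 0" "L1 \<ge> 0"
    and K1: "\<And>x y. dist 0 x \<le> r1 \<Longrightarrow> dist e0 y \<le> r1 \<Longrightarrow>
      (x, y) \<in> (UNIV \<times> cd ` dom0) \<inter> ?h1 -` dom0 \<and> norm (cd (?h1 (x, y)) - cd (?h1 (x, e0))) \<le> L1 * norm (y - e0)"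
    by (rule smooth_on_lipschitz_snd[OF N1]) (rule that)
  let ?h2 = "\<lambda>q. ci (fst q) \<otimes> ci (snd q)"
  note N2 = smooth_into_cd[OF open_Times[OF cd_open cd_open] smooth_into_pair_mult]
  have "(e0, e0) \<in> (cd ` dom0 \<times> cd ` dom0) \<inter> ?h2 -` dom0" using one_dom0 by simp
  then obtain r2 L2 where r2: "r2 > 0" "L2 \<ge> 0"
    and K2: "\<And>x y. dist e0 x \<le> r2 \<Longrightarrow> dist e0 y \<le> r2 \<Longrightarrow>
      (x, y) \<in> (cd ` dom0 \<times> cd ` dom0) \<inter> ?h2 -` dom0 \<and> norm (cd (?h2 (x, y)) - cd (?h2 (x, e0))) \<le> L2 * norm (y - e0)"
    by (rule smooth_on_lipschitz_snd[OF N2]) (rule that)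
  define \<delta> where "\<delta> s = inv (\<gamma> s) \<otimes> p s" for s
  have vg: "vel1 \<gamma> 0 X" by (rule vel1_cong[OF has_lvel_vel1[OF g(2)]]) (simp add: gD)
  have vd: "vel1 \<delta> 0 0" unfolding \<delta>_def using vel1_mult[OF vel1_inv[OF vg] p(1)] by simp
  obtain T where T: "closed T" "H = carrier G \<inter> T" using closedH by (auto simp: closedin_closed)
  \<comment> \<open>The restriction on \<open>u\<close> keeps all conjugating elements
    \<open>\<gamma> (real k * s)\<close> within reach of the uniform estimate \<open>K1\<close>.
    Arbitrary times are powers of small ones.\<close>
  have small: "\<gamma> u \<in> H" if u: "\<bar>u\<bar> \<le> r1" for u
  proof (rule ccontr)
    assume "\<gamma> u \<notin> H"
    then have guT: "\<gamma> u \<in> - T" using gD(1) T by auto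
    \<comment> \<open>Coordinates of elements whose product with \<open>\<gamma> u\<close> misses
      the closed set \<open>T\<close>. The element \<open>W n\<close> below has coordinates near
      \<open>e0\<close>, yet its product with \<open>\<gamma> u\<close> is a power of
      \<open>p s\<close> and lies in \<open>H\<close>.\<close>
    let ?D = "cd ` dom0 \<inter> (\<lambda>z. ci z \<otimes> \<gamma> u) -` (- T)"
    have "smooth_into G (cd ` dom0) (\<lambda>z. ci z \<otimes> \<gamma> u)"
      by (intro smooth_into_mult smooth_into_const smooth_into_ci cd_open gD)
    from continuous_open_preimage[OF smooth_intoD(3)[OF this] cd_open open_Compl[OF T(1)]]
    have "open ?D" .
    moreover have "e0 \<in> ?D" using guT one_dom0 gD(1) by simp
    ultimately obtain \<epsilon>0 where e0: "\<epsilon>0 > 0" "cball e0 \<epsilon>0 \<subseteq> ?D" using open_contains_cball by blast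
    define \<epsilon> where "\<epsilon> = min \<epsilon>0 r2"
    have \<epsilon>: "\<epsilon> > 0" "\<epsilon> \<le> r2" "\<epsilon> \<le> \<epsilon>0" using e0 r2 by (auto simp: \<epsilon>_def)
    \<comment> \<open>The summands 1, \<open>L1\<close> and \<open>L2 * L1\<close> serve three
      smallness conditions: for the coordinates of \<open>\<delta> s\<close>, of its conjugates, and
      of the product of \<open>n\<close> conjugates. In \<eta>, \<open>\<bar>u\<bar> + 1\<close>
      replaces \<open>\<bar>u\<bar>\<close> because \<open>u\<close> may be 0.\<close>
    define C where "C = 1 + L1 + L2 * L1"
    have C: "C \<ge> 1" "C \<ge> L1" "C \<ge> L2 * L1" using r1 r2 by (auto simp: C_def)
    define \<kappa> where "\<kappa> = min r1 (min r2 \<epsilon>)"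
    have \<kappa>: "\<kappa> > 0" "\<kappa> \<le> r1" "\<kappa> \<le> r2" "\<kappa> \<le> \<epsilon>" using r1 r2 \<epsilon> by (auto simp: \<kappa>_def)
    define \<eta> where "\<eta> = \<kappa> / (C * (\<bar>u\<bar> + 1))"
    have \<eta>: "\<eta> > 0" "C * (\<eta> * \<bar>u\<bar>) \<le> \<kappa>"
    proof -
      show "\<eta> > 0" using \<kappa> C by (simp add: \<eta>_def add_nonneg_pos)
      have nz: "C * (\<bar>u\<bar> + 1) \<noteq> 0" using C(1) abs_ge_zero[of u] by auto
      have "C * (\<eta> * (\<bar>u\<bar> + 1)) = \<kappa> / (C * (\<bar>u\<bar> + 1)) * (C * (\<bar>u\<bar> + 1))"
        unfolding \<eta>_def by (simp only: mult_ac)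
      also have "\<dots> = \<kappa>" by (rule nonzero_eq_divide_eq[THEN iffD1, OF nz refl, symmetric, THEN sym])
      finally have "C * (\<eta> * (\<bar>u\<bar> + 1)) = \<kappa>" .
      moreover have "C * (\<eta> * \<bar>u\<bar>) \<le> C * (\<eta> * (\<bar>u\<bar> + 1))"
        using C(1) \<open>\<eta> > 0\<close> by (intro mult_left_mono) auto
      ultimately show "C * (\<eta> * \<bar>u\<bar>) \<le> \<kappa>" by simp
    qed
    have "((\<lambda>s. cd (\<delta> s)) has_derivative (\<lambda>h. h *\<^sub>R 0)) (at 0)"
      using vd unfolding vel1_def has_vector_derivative_def by simp
    then obtain d where d: "d > 0" "\<And>s. norm (s - 0) < d \<Longrightarrow>
        norm (cd (\<delta> s) - cd (\<delta> 0) - (s - 0) *\<^sub>R 0) \<le> \<eta> * norm (s - 0)"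
      using \<eta>(1) unfolding has_derivative_at_alt by blast
    have ev: "\<forall>\<^sub>F s in nhds 0. \<delta> s \<in> dom0 \<and> p s \<in> H"
      using vd p(2) unfolding vel1_def by (auto elim: eventually_elim2)
    then obtain d' where d': "d' > 0" "\<And>s. dist s 0 < d' \<Longrightarrow> \<delta> s \<in> dom0 \<and> p s \<in> H"
      unfolding eventually_nhds_metric by blast
    obtain n :: nat where n: "n > 0" "\<bar>u\<bar> / real n < min d d'"
    proof -
      define dm where "dm = min d d'"
      have dm: "dm > 0" using d(1) d'(1) by (simp add: dm_def)
      obtain n :: nat where n: "\<bar>u\<bar> / dm < real n" using reals_Archimedean2 by blast
      moreover have "real n > 0" using n dm by (smt (verit) divide_nonneg_pos abs_ge_zero)
      ultimately have "\<bar>u\<bar> / real n < dm" using dm by (simp add: field_simps)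
      then show ?thesis using \<open>real n > 0\<close> by (intro that[of n]) (simp_all add: dm_def)
    qed
    define s where "s = u / real n"
    have sn: "\<bar>s\<bar> < d" "dist s 0 < d'" using n by (auto simp: s_def abs_divide)
    have del: "\<delta> s \<in> dom0" "p s \<in> H" using d'(2)[OF sn(2)] by auto
    have d0: "\<delta> 0 = \<one>" using vd unfolding vel1_def by simp
    define y where "y = cd (\<delta> s)"
    have y: "norm (y - e0) \<le> \<eta> * (\<bar>u\<bar> / real n)"
      using d(2)[of s] sn(1) d0 by (simp add: y_def s_def abs_divide)
    have y': "real n * norm (y - e0) \<le> \<eta> * \<bar>u\<bar>" using y n(1) by (simp add: field_simps)
    have yle: "norm (y - e0) \<le> real n * norm (y - e0)" using n(1) mult_right_mono[of 1 "real n" "norm (y - e0)"] by simp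
    define \<beta> where "\<beta> = L1 * norm (y - e0)"
    have y_r1: "norm (y - e0) \<le> r1"
    proof -
      have "norm (y - e0) \<le> \<eta> * \<bar>u\<bar>" using yle y' by simp
      also have "\<dots> \<le> C * (\<eta> * \<bar>u\<bar>)" using C(1) \<eta>(1) mult_right_mono[of 1 C "\<eta> * \<bar>u\<bar>"] by simp
      finally show ?thesis using \<eta>(2) \<kappa>(2) by simp
    qed
    have b_r2: "\<beta> \<le> r2"
    proof -
      have "\<beta> \<le> L1 * (\<eta> * \<bar>u\<bar>)" unfolding \<beta>_def using yle y' r1(2) by (intro mult_left_mono) auto
      also have "\<dots> \<le> C * (\<eta> * \<bar>u\<bar>)" using C(2) \<eta>(1) by (intro mult_right_mono) auto
      finally show ?thesis using \<eta>(2) \<kappa>(3) by simp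
    qed
    have nb: "real n * (L2 * \<beta>) \<le> \<epsilon>"
    proof -
      have "real n * (L2 * \<beta>) = (L2 * L1) * (real n * norm (y - e0))" by (simp add: \<beta>_def)
      also have "\<dots> \<le> (L2 * L1) * (\<eta> * \<bar>u\<bar>)" using y' r1(2) r2(2) by (intro mult_left_mono) auto
      also have "\<dots> \<le> C * (\<eta> * \<bar>u\<bar>)" using C(3) \<eta>(1) by (intro mult_right_mono) auto
      finally show ?thesis using \<eta>(2) \<kappa>(4) by simp
    qed
    have b0: "L2 * \<beta> \<ge> 0" using r1 r2 by (simp add: \<beta>_def)
    have pc: "p s \<in> carrier G" using del(2) by (rule H_carrier)
    define c where "c k = \<gamma> (real k * s) \<otimes> \<delta> s \<otimes> inv (\<gamma> (real k * s))" for k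
    have c: "c k \<in> dom0 \<and> norm (cd (c k) - e0) \<le> \<beta>" if k: "k \<le> n" for k
    proof -
      have "\<bar>real k * s\<bar> = (real k / real n) * \<bar>u\<bar>" by (simp add: s_def abs_mult)
      also have "\<dots> \<le> 1 * \<bar>u\<bar>" using k n(1) by (intro mult_right_mono) auto
      finally have "dist 0 (real k * s) \<le> r1" using u by simp
      from K1[OF this, of y] y_r1 have "(real k * s, y) \<in> (UNIV \<times> cd ` dom0) \<inter> ?h1 -` dom0 \<and>
         norm (cd (?h1 (real k * s, y)) - cd (?h1 (real k * s, e0))) \<le> \<beta>"
        by (simp add: \<beta>_def dist_norm norm_minus_commute)
      moreover have "?h1 (real k * s, y) = c k" using del(1) by (simp add: c_def y_def)
      moreover have "?h1 (real k * s, e0) = \<one>" using one_dom0 gD(1) by simp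
      ultimately show ?thesis by simp
    qed
    \<comment> \<open>Partial products: \<open>W (Suc k)\<close> is \<open>W k\<close> times the
      conjugate \<open>c (Suc k)\<close>, so each factor moves the coordinates by at most
      \<open>L2 * \<beta>\<close>, and \<open>n\<close> of these moves stay below
      \<epsilon>.\<close>
    define W where "W k = p s [^] k \<otimes> inv (\<gamma> (real k * s))" for k :: nat
    have W: "W k \<in> dom0 \<and> norm (cd (W k) - e0) \<le> real k * (L2 * \<beta>)" if "k \<le> n" for k
      using that
    proof (induction k)
      case 0
      then show ?case using one_dom0 gD(3) by (simp add: W_def)
    next
      case (Suc k)
      have IH: "W k \<in> dom0" "norm (cd (W k) - e0) \<le> real k * (L2 * \<beta>)" using Suc by auto
      have "real k * (L2 * \<beta>) \<le> real n * (L2 * \<beta>)" using Suc.prems b0 by (intro mult_right_mono) auto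
      then have 1: "dist e0 (cd (W k)) \<le> r2" using IH(2) nb \<epsilon>(2) by (simp add: dist_norm norm_minus_commute)
      have cS: "c (Suc k) \<in> dom0" "norm (cd (c (Suc k)) - e0) \<le> \<beta>" using c[OF Suc.prems] by auto
      then have 2: "dist e0 (cd (c (Suc k))) \<le> r2" using b_r2 by (simp add: dist_norm norm_minus_commute)
      have WS: "W (Suc k) = W k \<otimes> c (Suc k)"
      proof -
        have "\<gamma> (real (Suc k) * s) = \<gamma> (real k * s) \<otimes> \<gamma> s"
          using gD(2)[of "real k * s" s] by (simp add: algebra_simps)
        then show ?thesis
          using gD(1) pc by (simp add: W_def c_def \<delta>_def inv_mult_group m_assoc)
      qed
      have K: "ci (cd (W k)) \<otimes> ci (cd (c (Suc k))) = W (Suc k)" using IH(1) cS(1) WS by simp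
      have Ke: "ci (cd (W k)) \<otimes> ci e0 = W k" using IH(1) one_dom0 dom0_carrier by simp
      from K2[OF 1 2] have K': "W (Suc k) \<in> dom0" "norm (cd (W (Suc k)) - cd (W k)) \<le> L2 * norm (cd (c (Suc k)) - e0)"
        using K Ke by auto
      have "norm (cd (W (Suc k)) - e0) \<le> norm (cd (W (Suc k)) - cd (W k)) + norm (cd (W k) - e0)"
        using norm_triangle_ineq[of "cd (W (Suc k)) - cd (W k)" "cd (W k) - e0"] by simp
      also have "\<dots> \<le> L2 * \<beta> + real k * (L2 * \<beta>)"
        using K'(2) IH(2) mult_left_mono[OF cS(2) r2(2)] by linarith
      finally show ?case using K'(1) by (simp add: algebra_simps)
    qed
    have "cd (W n) \<in> cball e0 \<epsilon>0"
      using W[of n] nb \<epsilon>(3) by (simp add: dist_norm norm_minus_commute)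
    then have "ci (cd (W n)) \<otimes> \<gamma> u \<in> - T" using e0(2) by blast
    moreover have "ci (cd (W n)) \<otimes> \<gamma> u = p s [^] n"
      using W[of n] n(1) pc gD(1)[of u] by (simp add: W_def s_def m_assoc)
    ultimately show False using H_pow[OF del(2), of n] T by auto
  qed
  have gpow: "\<gamma> (real n * v) = \<gamma> v [^] n" for n v
    by (induction n) (simp_all add: gD distrib_right, metis gD(1) nat_pow_Suc nat_pow_Suc2)
  obtain n :: nat where n: "\<bar>u\<bar> / r1 < real n" using reals_Archimedean2 by blast
  then have n0: "real n > 0" using r1(1) by (smt (verit) divide_nonneg_pos abs_ge_zero)
  have "\<bar>u / real n\<bar> \<le> r1" using n n0 r1(1) by (simp add: abs_divide field_simps)
  from H_pow[OF small[OF this], of n] show ?thesis using gpow[of n "u / real n"] n0 by simp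
qed

text \<open>\<open>lie_algebra_of\<close> only admits one-parameter subgroups inside
  \<open>H\<close>. By the closedness argument every differentiable curve in \<open>H\<close> will
  do, after translation to the identity.\<close>

lemma tangent_in_lie_algebra:
  assumes v: "has_lvel \<sigma> t X" and H: "\<forall>\<^sub>F s in nhds t. \<sigma> s \<in> H"
  shows "X \<in> hh"
proof -
  obtain \<gamma> where g: "one_param_subgroup G \<gamma>" "has_lvel \<gamma> 0 X" by (rule one_param_subgroup_exists)
  have sH: "\<sigma> t \<in> H" using H by (rule eventually_nhds_x_imp_x)
  have "has_lvel (\<lambda>s. \<sigma> (t + s)) 0 (1 *\<^sub>R X)"
    by (rule has_lvel_reparam) (use v in \<open>auto intro!: derivative_eq_intros\<close>)
  from has_lvel_vel1[OF this] have 1: "vel1 (\<lambda>s. inv (\<sigma> t) \<otimes> \<sigma> (t + s)) 0 X" by simp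
  have "isCont (\<lambda>s. t + s) 0" by (intro continuous_intros)
  from isCont_eventually_nhds[OF this] H have "\<forall>\<^sub>F s in nhds 0. \<sigma> (t + s) \<in> H" by simp
  then have 2: "\<forall>\<^sub>F s in nhds 0. inv (\<sigma> t) \<otimes> \<sigma> (t + s) \<in> H"
    by eventually_elim (use sH in \<open>auto intro: H_mult H_inv\<close>)
  have "range \<gamma> \<subseteq> H" using one_param_subgroup_in_closed[OF g 1 2] by auto
  then show ?thesis unfolding lie_algebra_of_def using g has_lvel_left_vel by blast
qed

lemma lie_algebra_one_param:
  assumes "X \<in> hh"
  obtains \<gamma> where "one_param_subgroup G \<gamma>" "has_lvel \<gamma> 0 X" "\<And>t. \<gamma> t \<in> H"
proof -
  obtain \<gamma> where g: "one_param_subgroup G \<gamma>" "X = left_vel G \<gamma> 0" "range \<gamma> \<subseteq> H"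
    using assms unfolding lie_algebra_of_def by blast
  have "has_lvel \<gamma> 0 X"
    unfolding g(2) by (rule has_lvel_smooth[OF open_UNIV one_param_subgroupD(5)[OF g(1)] UNIV_I])
  then show ?thesis using that g by blast
qed

text \<open>A sum is the velocity of a product of two one-parameter subgroups. The product is a
  curve in \<open>H\<close> but need not be a one-parameter subgroup, which is where
  \<open>tangent_in_lie_algebra\<close> is needed.\<close>

lemma subspace_lie_algebra: "subspace hh"
  unfolding subspace_def
proof (intro conjI ballI allI)
  show "0 \<in> hh" by (rule tangent_in_lie_algebra[OF has_lvel_const]) (auto simp: H_one)
  fix X assume "X \<in> hh"
  then obtain \<gamma> where g: "one_param_subgroup G \<gamma>" "has_lvel \<gamma> 0 X" "\<And>t. \<gamma> t \<in> H"
    by (rule lie_algebra_one_param) (rule that)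
  { fix Y assume "Y \<in> hh"
    then obtain \<beta> where b: "one_param_subgroup G \<beta>" "has_lvel \<beta> 0 Y" "\<And>t. \<beta> t \<in> H"
      by (rule lie_algebra_one_param) (rule that)
    from has_lvel_mult[OF g(2) b(2)] have "has_lvel (\<lambda>s. \<gamma> s \<otimes> \<beta> s) 0 (X + Y)"
      using one_param_subgroupD(3)[OF b(1)] by (simp add: Ad_one)
    then show "X + Y \<in> hh" 
      by (rule tangent_in_lie_algebra) (intro always_eventually allI H_mult g b) }
  fix r :: real
  have "has_lvel (\<lambda>s. \<gamma> (r * s)) 0 (r *\<^sub>R X)"
    by (rule has_lvel_reparam) (use g(2) in \<open>auto intro!: derivative_eq_intros\<close>)
  then show "r *\<^sub>R X \<in> hh" 
    by (rule tangent_in_lie_algebra) (intro always_eventually allI g)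
qed

lemma Ad_lie_algebra:
  assumes "h \<in> H" "X \<in> hh"
  shows "Ad G h X \<in> hh"
proof -
  obtain \<gamma> where g: "one_param_subgroup G \<gamma>" "has_lvel \<gamma> 0 X" "\<And>t. \<gamma> t \<in> H"
    using assms(2) by (rule lie_algebra_one_param) (rule that)
  have "has_lvel (\<lambda>s. (h \<otimes> \<gamma> s) \<otimes> inv h) 0 (Ad G (inv (inv h)) X)"
    using assms(1) H_carrier by (intro has_lvel_mult_const has_lvel_cmult g(2)) auto
  then have "has_lvel (\<lambda>s. (h \<otimes> \<gamma> s) \<otimes> inv h) 0 (Ad G h X)" using H_carrier[OF assms(1)] by simp
  then show ?thesis 
    by (rule tangent_in_lie_algebra) (intro always_eventually allI H_mult H_inv g assms)
qed

end

section \<open>Curves tangent to the cosets\<close>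

lemma orthonormal_sum_inner:
  assumes "finite B" "pairwise orthogonal B" "\<And>b. b \<in> B \<Longrightarrow> norm b = 1" "c \<in> B"
  shows "(\<Sum>b\<in>B. f b *\<^sub>R b) \<bullet> c = f c"
proof -
  have "(\<Sum>b\<in>B. f b *\<^sub>R b) \<bullet> c = (\<Sum>b\<in>B. if b = c then f c else 0)"
    unfolding inner_sum_left
  proof (rule sum.cong[OF refl])
    fix b assume b: "b \<in> B"
    show "(f b *\<^sub>R b) \<bullet> c = (if b = c then f c else 0)"
    proof (cases "b = c")
      case True
      then show ?thesis using assms(3)[OF assms(4)] by (simp add: norm_eq_1)
    next
      case False
      then have "b \<bullet> c = 0" using assms(2,4) b by (auto simp: pairwise_def orthogonal_def)
      then show ?thesis using False by simp
    qed
  qed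
  then show ?thesis using assms(1,4) by simp
qed

context lie_closed_subgroup
begin

lemma l_coset_eq_iff:
  assumes "a \<in> carrier G" "b \<in> carrier G"
  shows "a <# H = b <# H \<longleftrightarrow> inv a \<otimes> b \<in> H"
proof
  assume "a <# H = b <# H"
  then have "b \<in> a <# H" using assms H_one unfolding l_coset_def by force
  then obtain h where "h \<in> H" "b = a \<otimes> h" unfolding l_coset_def by blast
  then show "inv a \<otimes> b \<in> H" using assms H_carrier by simp
next
  assume h: "inv a \<otimes> b \<in> H"
  have 1: "b \<otimes> k = a \<otimes> (inv a \<otimes> b \<otimes> k)" if "k \<in> H" for k
    using that assms H_carrier by (simp add: m_assoc)
  have h': "inv b \<otimes> a \<in> H" using H_inv[OF h] assms by (simp add: inv_mult_group)
  have 2: "a \<otimes> k = b \<otimes> (inv b \<otimes> a \<otimes> k)" if "k \<in> H" for k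
    using that assms H_carrier by (simp add: m_assoc)
  show "a <# H = b <# H"
    unfolding l_coset_def using 1 2 H_mult[OF h] H_mult[OF h'] by fastforce
qed

text \<open>The curve \<open>exp (t X)\<close>. Membership in \<open>H\<close> is built into the
  choice, so that no uniqueness argument is required to recover it.\<close>

definition expo :: "'e \<Rightarrow> real \<Rightarrow> 'a" where
  "expo X = (SOME \<gamma>. one_param_subgroup G \<gamma> \<and> has_lvel \<gamma> 0 X \<and> (X \<in> hh \<longrightarrow> (\<forall>t. \<gamma> t \<in> H)))"

lemma expo: "one_param_subgroup G (expo X)" "has_lvel (expo X) 0 X" "X \<in> hh \<Longrightarrow> expo X t \<in> H"
proof -
  have "\<exists>\<gamma>. one_param_subgroup G \<gamma> \<and> has_lvel \<gamma> 0 X \<and> (X \<in> hh \<longrightarrow> (\<forall>t. \<gamma> t \<in> H))"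
    using one_param_subgroup_exists[of X] lie_algebra_one_param[of X] by metis
  from someI_ex[OF this] show "one_param_subgroup G (expo X)" "has_lvel (expo X) 0 X"
    "X \<in> hh \<Longrightarrow> expo X t \<in> H"
    unfolding expo_def by auto
qed

lemmas expoD = one_param_subgroupD[OF expo(1)]

text \<open>Canonical coordinates of the second kind, when the list is an orthonormal basis; a
  sublist gives the factor that belongs to a subspace.\<close>

primrec prodexp :: "'e list \<Rightarrow> 'e \<Rightarrow> 'a" where
  "prodexp [] z = \<one>"
| "prodexp (b # l) z = expo b (z \<bullet> b) \<otimes> prodexp l z"

lemma prodexp_smooth: "smooth_into G UNIV (prodexp l)"
proof (induction l)
  case Nil
  then show ?case using smooth_into_const[OF open_UNIV one_closed] by simp
next
  case (Cons b l)
  have "smooth_on UNIV (\<lambda>z. z \<bullet> b)"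
    by (intro smooth_on_bounded_linear open_UNIV bounded_linear_inner_left)
  from smooth_into_compose[OF open_UNIV open_UNIV _ expoD(5) this]
  have "smooth_into G UNIV (\<lambda>z. expo b (z \<bullet> b))" by simp
  from smooth_into_mult[OF open_UNIV this Cons] show ?case by simp
qed

lemma prodexp_zero: "(\<And>b. b \<in> set l \<Longrightarrow> z \<bullet> b = 0) \<Longrightarrow> prodexp l z = \<one>"
  by (induction l) (simp_all add: expoD)

lemma prodexp_in_H: "set l \<subseteq> hh \<Longrightarrow> prodexp l z \<in> H"
  by (induction l) (simp_all add: H_one H_mult expo)

lemma prodexp_cong: "(\<And>b. b \<in> set l \<Longrightarrow> z \<bullet> b = w \<bullet> b) \<Longrightarrow> prodexp l z = prodexp l w"
  by (induction l) simp_all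

lemma prodexp_lvel: "has_lvel (\<lambda>s. prodexp l (s *\<^sub>R v)) 0 (\<Sum>b\<leftarrow>l. (v \<bullet> b) *\<^sub>R b)"
proof (induction l)
  case Nil
  then show ?case using has_lvel_const[OF one_closed] by simp
next
  case (Cons b l)
  have "has_lvel (\<lambda>s. expo b (s * (v \<bullet> b))) 0 ((v \<bullet> b) *\<^sub>R b)"
    by (rule has_lvel_reparam) (use expo(2) in \<open>auto intro!: derivative_eq_intros\<close>)
  from has_lvel_mult[OF this Cons] show ?case by (simp add: prodexp_zero Ad_one)
qed

lemma lder_prodexp: "lder (prodexp l) 0 v = (\<Sum>b\<leftarrow>l. (v \<bullet> b) *\<^sub>R b)"
proof -
  have "((\<lambda>s. s *\<^sub>R v) has_vector_derivative v) (at 0)" by (auto intro!: derivative_eq_intros)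
  from has_lvel_lder[OF open_UNIV prodexp_smooth UNIV_I this]
  have "has_lvel (\<lambda>s. prodexp l (s *\<^sub>R v)) 0 (lder (prodexp l) 0 v)" by simp
  then show ?thesis using prodexp_lvel has_lvel_unique by blast
qed

text \<open>In the coordinates \<open>z \<mapsto> \<Prod> exp(z\<^sub>i b\<^sub>i)\<close> of a basis adapted to \<open>hh\<close>, the part of a vertical
  curve transversal to \<open>hh\<close> has zero derivative.\<close>

lemma vertical_curve_in_coset:
  assumes I: "open I" "t0 \<in> I" and b: "\<And>t. t \<in> I \<Longrightarrow> has_lvel \<beta> t (u t)" "\<And>t. t \<in> I \<Longrightarrow> u t \<in> hh"
  shows "\<forall>\<^sub>F t in nhds t0. \<beta> t <# H = \<beta> t0 <# H"
proof -
  obtain Bh where Bh: "Bh \<subseteq> hh" "pairwise orthogonal Bh" "\<And>x. x \<in> Bh \<Longrightarrow> norm x = 1"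
    "independent Bh" "span Bh = hh"
    using orthonormal_basis_subspace[OF subspace_lie_algebra] by metis
  \<comment> \<open>No invariant inner product is fixed in this context, so the transversal to
    \<open>hh\<close> is its complement for the coordinate inner product.\<close>
  define V where "V = {x. \<forall>y\<in>hh. x \<bullet> y = 0}"
  have "subspace V" unfolding V_def subspace_def by (auto simp: inner_add_left)
  then obtain Bm where Bm: "Bm \<subseteq> V" "pairwise orthogonal Bm" "\<And>x. x \<in> Bm \<Longrightarrow> norm x = 1"
    "independent Bm" "span Bm = V"
    using orthonormal_basis_subspace by metis
  have fin: "finite Bh" "finite Bm" using Bh(4) Bm(4) independent_imp_finite by auto
  obtain lh where lh: "set lh = Bh" "distinct lh" using finite_distinct_list[OF fin(1)] by blast
  obtain lm where lm: "set lm = Bm" "distinct lm" using finite_distinct_list[OF fin(2)] by blast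
  define Ph where "Ph x = (\<Sum>b\<in>Bh. (x \<bullet> b) *\<^sub>R b)" for x :: 'e
  define Pm where "Pm x = (\<Sum>b\<in>Bm. (x \<bullet> b) *\<^sub>R b)" for x :: 'e
  have Ph_hh: "Ph x \<in> hh" and Pm_V: "Pm x \<in> V" for x
    unfolding Ph_def Pm_def Bh(5)[symmetric] Bm(5)[symmetric]
    by (rule span_sum, rule span_scale, erule span_base)+
  have Phb: "Ph x \<bullet> b = x \<bullet> b" if "b \<in> Bh" for x b
    unfolding Ph_def by (rule orthonormal_sum_inner[OF fin(1) Bh(2,3) that])
  have Pmb: "Pm x \<bullet> b = x \<bullet> b" if "b \<in> Bm" for x b
    unfolding Pm_def by (rule orthonormal_sum_inner[OF fin(2) Bm(2,3) that])
  have VB: "x = 0" if "x \<in> V" "\<And>b. b \<in> Bm \<Longrightarrow> x \<bullet> b = 0" for x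
  proof -
    have "orthogonal x x"
      by (rule orthogonal_to_span[of x Bm x]) (use that Bm(5) in \<open>auto simp: orthogonal_def\<close>)
    then show ?thesis by (simp add: orthogonal_self)
  qed
  have decomp: "Ph x + Pm x = x" for x
  proof -
    have 1: "(x - Ph x - Pm x) \<bullet> b = 0" if "b \<in> Bh" for b
    proof -
      have "Pm x \<bullet> b = 0" using Pm_V[of x] that Bh(1) unfolding V_def by blast
      then show ?thesis using Phb[OF that] by (simp add: inner_diff_left)
    qed
    have 2: "x - Ph x - Pm x \<in> V"
      unfolding V_def
    proof (intro CollectI ballI)
      fix y assume "y \<in> hh"
      then have "y \<in> span Bh" using Bh(5) by simp
      from orthogonal_to_span[OF this, of "x - Ph x - Pm x"] 1
      show "(x - Ph x - Pm x) \<bullet> y = 0" by (simp add: orthogonal_def)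
    qed
    have "Ph x \<bullet> b = 0" if "b \<in> Bm" for b
    proof -
      have "b \<bullet> Ph x = 0" using that Bm(1) Ph_hh[of x] unfolding V_def by blast
      then show ?thesis by (simp add: inner_commute)
    qed
    then have "x - Ph x - Pm x = 0"
      by (intro VB[OF 2]) (simp add: inner_diff_left Pmb)
    then show ?thesis by (simp add: algebra_simps)
  qed
  have Pm_idem: "Pm v = v" if "v \<in> V" for v
  proof -
    have "Ph v = 0" unfolding Ph_def using that Bh(1) by (intro sum.neutral) (auto simp: V_def)
    then show ?thesis using decomp[of v] by simp
  qed
  have linPm: "bounded_linear Pm"
    unfolding Pm_def linear_conv_bounded_linear[symmetric]
    by (rule linearI) (simp_all add: inner_add_left scaleR_add_left sum.distrib scaleR_sum_right)
  have sums: "(\<Sum>b\<leftarrow>lh. (v \<bullet> b) *\<^sub>R b) = Ph v" "(\<Sum>b\<leftarrow>lm. (v \<bullet> b) *\<^sub>R b) = Pm v" for v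
    unfolding Ph_def Pm_def using lh lm by (simp_all add: sum_list_distinct_conv_sum_set)
  \<comment> \<open>The transversal factor stands on the left: the right factor lies in
    \<open>H\<close> and does not change the coset, so the coset of \<open>\<Psi> z\<close> is
    determined by \<open>Pm z\<close>.\<close>
  define \<Psi> where "\<Psi> z = prodexp lm z \<otimes> prodexp lh z" for z
  have \<Psi>s: "smooth_into G UNIV \<Psi>"
    unfolding \<Psi>_def by (intro smooth_into_mult prodexp_smooth open_UNIV)
  have \<Psi>0: "\<Psi> 0 = \<one>" unfolding \<Psi>_def by (simp add: prodexp_zero)
  define U where "U = UNIV \<inter> \<Psi> -` dom0"
  note U = smooth_into_cd[OF open_UNIV \<Psi>s, folded U_def]
  have U0: "0 \<in> U" using \<Psi>0 one_dom0 by (simp add: U_def)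
  define f where "f z = cd (\<Psi> z)" for z
  have fs: "smooth_on U f" unfolding f_def by (rule U(2))
  note fd = smooth_on_has_derivative[OF U(1) fs]
  define f' where "f' z = Blinfun (frechet_derivative f (at z))" for z
  have f'_apply: "blinfun_apply (f' z) = frechet_derivative f (at z)" if "z \<in> U" for z
    unfolding f'_def by (rule bounded_linear_Blinfun_apply[OF has_derivative_bounded_linear[OF fd[OF that]]])
  \<comment> \<open>The two factors contribute \<open>Pm v\<close> and \<open>Ph v\<close>, so the
    differential at 0 is the identity and the inverse function theorem gives coordinates
    \<open>z\<close> on a neighbourhood.\<close>
  have f'0: "frechet_derivative f (at 0) v = v" for v
  proof -
    have c: "((\<lambda>s. s *\<^sub>R v) has_vector_derivative v) (at 0)" by (auto intro!: derivative_eq_intros)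
    have "(f has_derivative frechet_derivative f (at 0)) (at (0 *\<^sub>R v))" using fd[OF U0] by simp
    from has_vector_derivative_compose[OF c this]
    have 1: "((\<lambda>s. f (s *\<^sub>R v)) has_vector_derivative frechet_derivative f (at 0) v) (at 0)" .
    have "has_lvel (\<lambda>s. \<Psi> (s *\<^sub>R v)) 0 (Pm v + Ph v)"
      unfolding \<Psi>_def using has_lvel_mult[OF prodexp_lvel[of lm v] prodexp_lvel[of lh v]]
      by (simp add: sums prodexp_zero Ad_one)
    then have "has_lvel (\<lambda>s. \<Psi> (s *\<^sub>R v)) 0 v" using decomp[of v] by (simp add: add.commute)
    from has_lvel_vel1[OF this] have "vel1 (\<lambda>s. \<Psi> (s *\<^sub>R v)) 0 v"
      using smooth_intoD(1)[OF \<Psi>s] \<Psi>0 by simp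
    then have "((\<lambda>s. f (s *\<^sub>R v)) has_vector_derivative v) (at 0)" unfolding vel1_def f_def by simp
    from vector_derivative_unique_at[OF 1 this] show ?thesis .
  qed
  have derf: "(f has_derivative blinfun_apply (f' z)) (at z)" if "z \<in> U" for z
    unfolding f'_apply[OF that] by (rule fd[OF that])
  have contf: "continuous_on U f'"
  proof (rule continuous_on_blinfun_componentwise)
    fix i :: 'e
    have "continuous_on U (\<lambda>z. frechet_derivative f (at z) i)"
      by (rule smooth_on_continuous[OF smooth_on_frechet[OF fs]])
    then show "continuous_on U (\<lambda>z. blinfun_apply (f' z) i)" by (simp add: f'_apply cong: continuous_on_cong)
  qed
  have invf: "id_blinfun o\<^sub>L f' 0 = id_blinfun"
    by (rule blinfun_eqI) (simp add: f'_apply[OF U0] f'0)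
  obtain U' W g g' where UW: "open U'" "U' \<subseteq> U" "0 \<in> U'" "open W" "f 0 \<in> W" "homeomorphism U' W f g"
    and gd: "\<And>y. y \<in> W \<Longrightarrow> (g has_derivative (g' y)) (at y)"
    by (rule inverse_function_theorem[OF U(1) derf contf U0 invf]) (assumption, rule that)
  have fg: "f (g y) = y" "g y \<in> U'" if "y \<in> W" for y
    using UW(6) that unfolding homeomorphism_def by auto
  have g0: "g (f 0) = 0" using UW(3,6) unfolding homeomorphism_def by auto
  let ?\<rho> = "prodexp lm"
  \<comment> \<open>At 0 the map \<open>lder ?\<rho>\<close> is the identity on \<open>V\<close>,
    and \<open>V\<close> is orthogonal to \<open>hh\<close>. A perturbation of relative size below 1
    cannot move a nonzero \<open>v\<close> in \<open>V\<close> into \<open>hh\<close>; the bound 1/2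
    leaves room.\<close>
  obtain r where r: "r > 0" and inj: "\<And>y v. dist y 0 < r \<Longrightarrow> v \<in> V \<Longrightarrow> lder ?\<rho> y v \<in> hh \<Longrightarrow> v = 0"
  proof -
    define q where "q y = (\<Sum>b\<in>Basis. norm (lder ?\<rho> y b - lder ?\<rho> 0 b))" for y
    have "continuous_on UNIV q"
      unfolding q_def by (intro continuous_intros smooth_on_continuous[OF lder_lemma(2)[OF open_UNIV prodexp_smooth]])
    then have "isCont q 0" by (simp add: continuous_on_eq_continuous_at)
    then have "\<forall>\<^sub>F y in nhds 0. q y \<in> {..<1/2}"
      by (rule isCont_eventually_in_open) (simp_all add: q_def)
    then obtain r where r: "r > 0" "\<And>y. dist y 0 < r \<Longrightarrow> q y < 1/2"
      unfolding eventually_nhds_metric by auto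
    have "v = 0" if y: "dist y 0 < r" and v: "v \<in> V" and l: "lder ?\<rho> y v \<in> hh" for y v
    proof -
      have ex: "lder ?\<rho> x v = (\<Sum>b\<in>Basis. (v \<bullet> b) *\<^sub>R lder ?\<rho> x b)" for x
      proof -
        have "linear (lder ?\<rho> x)" by (rule linear_lder[OF open_UNIV prodexp_smooth UNIV_I])
        then have "lder ?\<rho> x (\<Sum>b\<in>Basis. (v \<bullet> b) *\<^sub>R b) = (\<Sum>b\<in>Basis. (v \<bullet> b) *\<^sub>R lder ?\<rho> x b)"
          by (simp add: linear_sum linear_scale)
        then show ?thesis by (simp add: euclidean_representation)
      qed
      have "norm (lder ?\<rho> y v - lder ?\<rho> 0 v) = norm (\<Sum>b\<in>Basis. (v \<bullet> b) *\<^sub>R (lder ?\<rho> y b - lder ?\<rho> 0 b))"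
        unfolding ex[of y] ex[of 0] by (simp add: sum_subtractf scaleR_diff_right)
      also have "\<dots> \<le> (\<Sum>b\<in>Basis. norm v * norm (lder ?\<rho> y b - lder ?\<rho> 0 b))"
        by (intro sum_norm_le) (simp add: Basis_le_norm mult_right_mono)
      also have "\<dots> = norm v * q y" by (simp add: q_def sum_distrib_left)
      finally have 1: "norm (lder ?\<rho> y v - v) \<le> norm v * q y"
        using Pm_idem[OF v] by (simp add: lder_prodexp sums)
      have "v \<bullet> lder ?\<rho> y v = 0" using v l unfolding V_def by blast
      then have "norm v * norm v = v \<bullet> (v - lder ?\<rho> y v)"
        by (simp add: inner_diff_right power2_norm_eq_inner flip: power2_eq_square)
      also have "\<dots> \<le> norm v * norm (v - lder ?\<rho> y v)" by (rule norm_cauchy_schwarz)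
      also have "\<dots> \<le> norm v * (norm v * q y)"
        using 1 by (intro mult_left_mono) (simp_all add: norm_minus_commute)
      finally have "norm v * (norm v * (1 - q y)) \<le> 0" by (simp add: algebra_simps)
      moreover have "1 - q y > 0" using r(2)[OF y] by simp
      ultimately show "v = 0" by (simp add: mult_le_0_iff zero_le_mult_iff)
    qed
    then show ?thesis using that r(1) by blast
  qed
  define p where "p t = inv (\<beta> t0) \<otimes> \<beta> t" for t
  have bt0: "\<beta> t0 \<in> carrier G" using b(1)[OF I(2)] by (rule has_lvel_carrier)
  have pl: "has_lvel p t (u t)" if "t \<in> I" for t
    unfolding p_def using bt0 b(1)[OF that] by (intro has_lvel_cmult) simp_all
  have p0: "p t0 = \<one>" using bt0 by (simp add: p_def)
  have pv: "vel1 p t0 (u t0)" unfolding p_def by (rule has_lvel_vel1[OF b(1)[OF I(2)]])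
  define z where "z t = g (cd (p t))" for t
  have f0: "f 0 = e0" by (simp add: f_def \<Psi>0)
  have cdp: "((\<lambda>s. cd (p s)) has_vector_derivative u t0) (at t0)" using pv unfolding vel1_def by blast
  have cz: "isCont z t0"
    unfolding z_def
    by (rule isCont_o2[OF has_vector_derivative_continuous[OF cdp]])
      (use gd[OF UW(5)] f0 p0 in \<open>simp add: has_derivative_continuous\<close>)
  have z0: "z t0 = 0" using g0 f0 p0 by (simp add: z_def)
  have "isCont (\<lambda>t. Pm (z t)) t0" using bounded_linear.isCont[OF linPm cz] .
  then have "\<forall>\<^sub>F t in nhds t0. Pm (z t) \<in> ball 0 r"
    by (rule isCont_eventually_in_open) (use z0 r linear_0[OF bounded_linear.linear[OF linPm]] in simp_all)
  moreover have "\<forall>\<^sub>F t in nhds t0. cd (p t) \<in> W"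
    by (rule isCont_eventually_in_open[OF has_vector_derivative_continuous[OF cdp] UW(4)]) (use f0 p0 UW(5) in simp)
  moreover have "\<forall>\<^sub>F t in nhds t0. p t \<in> dom0" using pv unfolding vel1_def by blast
  moreover have "\<forall>\<^sub>F t in nhds t0. t \<in> I" by (rule eventually_nhds_in_open[OF I])
  ultimately have "\<forall>\<^sub>F t in nhds t0. Pm (z t) \<in> ball 0 r \<and> cd (p t) \<in> W \<and> p t \<in> dom0 \<and> t \<in> I"
    by eventually_elim simp
  then obtain d where d: "d > 0" "\<And>t. dist t t0 < d \<Longrightarrow> dist (Pm (z t)) 0 < r \<and> cd (p t) \<in> W \<and> p t \<in> dom0 \<and> t \<in> I"
    unfolding eventually_nhds_metric by (auto simp: dist_commute)
  have \<Psi>z: "\<Psi> (z t) = p t" if "dist t t0 < d" for t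
  proof -
    have W: "cd (p t) \<in> W" "p t \<in> dom0" using d(2)[OF that] by auto
    have "\<Psi> (z t) \<in> dom0" using fg(2)[OF W(1)] UW(2) by (auto simp: z_def U_def)
    moreover have "cd (\<Psi> (z t)) = cd (p t)" using fg(1)[OF W(1)] by (simp add: z_def f_def)
    ultimately show ?thesis using W(2) ci_cd by metis
  qed
  have \<rho>P: "?\<rho> (Pm x) = ?\<rho> x" for x by (rule prodexp_cong) (simp add: Pmb lm)
  have cM: "?\<rho> x \<in> carrier G" "prodexp lh x \<in> carrier G" for x
    using smooth_intoD(1)[OF prodexp_smooth] by auto
  have \<rho>z: "?\<rho> (Pm (z t)) = p t \<otimes> inv (prodexp lh (z t))" if "dist t t0 < d" for t
    unfolding \<rho>P \<Psi>z[OF that, symmetric] \<Psi>_def using cM by (simp add: m_assoc)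
  have "((\<lambda>t. Pm (z t)) has_derivative (\<lambda>h. 0)) (at t within ball t0 d)" if "t \<in> ball t0 d" for t
  proof -
    have t: "dist t t0 < d" using that by (simp add: dist_commute)
    have tW: "dist (Pm (z t)) 0 < r" "cd (p t) \<in> W" "p t \<in> dom0" "t \<in> I" using d(2)[OF t] by auto
    define z' where "z' = g' (cd (p t)) (lf (cd (p t)) (u t))"
    have zd: "(z has_vector_derivative z') (at t)"
      unfolding z_def z'_def
      by (rule has_vector_derivative_compose[OF has_lvel_coord[OF pl[OF tW(4)] tW(3)] gd[OF tW(2)]])
    have Pzd: "((\<lambda>t. Pm (z t)) has_vector_derivative Pm z') (at t)"
      by (rule bounded_linear.has_vector_derivative[OF linPm zd])
    have 1: "has_lvel (\<lambda>t. ?\<rho> (Pm (z t))) t (lder ?\<rho> (Pm (z t)) (Pm z'))"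
      by (rule has_lvel_lder[OF open_UNIV prodexp_smooth UNIV_I Pzd])
    have Eh: "has_lvel (\<lambda>t. prodexp lh (z t)) t (lder (prodexp lh) (z t) z')"
      by (rule has_lvel_lder[OF open_UNIV prodexp_smooth UNIV_I zd])
    have EhH: "prodexp lh x \<in> H" for x by (rule prodexp_in_H) (use lh Bh in simp)
    have w: "lder (prodexp lh) (z t) z' \<in> hh"
      by (rule tangent_in_lie_algebra[OF Eh]) (intro always_eventually allI EhH)
    \<comment> \<open>The second computation of the velocity of \<open>?\<rho> (Pm (z t))\<close>.
      Here it lies in \<open>hh\<close>, since \<open>u t\<close> and the velocity of the factor in
      \<open>H\<close> do and \<open>Ad\<close> of \<open>H\<close> preserves \<open>hh\<close>; so
      \<open>inj\<close> forces \<open>Pm z' = 0\<close>.\<close>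
    have 2: "has_lvel (\<lambda>t. p t \<otimes> inv (prodexp lh (z t))) t
      (Ad G (inv (inv (prodexp lh (z t)))) (u t) + - Ad G (prodexp lh (z t)) (lder (prodexp lh) (z t) z'))"
      by (rule has_lvel_mult[OF pl[OF tW(4)] has_lvel_inv[OF Eh]])
    have "\<forall>\<^sub>F s in nhds t. s \<in> ball t0 d" by (rule eventually_nhds_in_open) (use that in auto)
    then have "\<forall>\<^sub>F s in nhds t. p s \<otimes> inv (prodexp lh (z s)) = ?\<rho> (Pm (z s))"
      by eventually_elim (use \<rho>z in \<open>simp add: dist_commute\<close>)
    from has_lvel_unique[OF 1 has_lvel_cong[OF 2 this]]
    have "lder ?\<rho> (Pm (z t)) (Pm z') =
      Ad G (prodexp lh (z t)) (u t) - Ad G (prodexp lh (z t)) (lder (prodexp lh) (z t) z')"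
      using cM by simp
    also have "\<dots> \<in> hh"
      by (intro subspace_diff subspace_lie_algebra Ad_lie_algebra EhH w b(2) tW(4))
    finally have "Pm z' = 0" by (rule inj[OF tW(1) Pm_V])
    then show ?thesis using Pzd unfolding has_vector_derivative_def by (simp add: has_derivative_at_withinI)
  qed
  from has_derivative_zero_constant[OF convex_ball this] obtain k
    where k: "\<And>t. t \<in> ball t0 d \<Longrightarrow> Pm (z t) = k" by blast
  have "Pm 0 = 0" by (rule linear_0[OF bounded_linear.linear[OF linPm]])
  then have k0: "k = 0" using k[of t0] z0 d(1) by simp
  have "\<beta> t <# H = \<beta> t0 <# H" if "t \<in> ball t0 d" for t
  proof -
    have t: "dist t t0 < d" using that by (simp add: dist_commute)
    have "?\<rho> (z t) = \<one>" using \<rho>P[of "z t"] k[OF that] k0 by (simp add: prodexp_zero)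
    then have "p t = prodexp lh (z t)" using \<Psi>z[OF t] cM by (simp add: \<Psi>_def)
    then have "p t \<in> H" using prodexp_in_H[of lh] lh Bh by simp
    then show ?thesis
      using l_coset_eq_iff[OF bt0, of "\<beta> t"] has_lvel_carrier[OF b(1)] d(2)[OF t] by (simp add: p_def)
  qed
  moreover have "\<forall>\<^sub>F t in nhds t0. t \<in> ball t0 d" by (rule eventually_nhds_in_open) (use d in auto)
  ultimately show ?thesis by (auto elim: eventually_mono)
qed

end

section \<open>Invariant metrics on homogeneous spaces\<close>

locale hom_space = lie_closed_subgroup G H for G :: "('a::t2_space, 'e::euclidean_space) lie_structure" (structure)
    and H :: "'a set" +
  fixes b :: "'e \<Rightarrow> 'e \<Rightarrow> real"
  assumes b_inv: "Ad_invariant_inner G b"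
begin

abbreviation mm :: "'e set" where "mm \<equiv> orth_complement b hh"

section \<open>The invariant inner product\<close>

lemma bilinear_b: "bilinear b" and b_sym: "b X Y = b Y X" and b_pos: "X \<noteq> 0 \<Longrightarrow> b X X > 0"
  and b_Ad: "g \<in> carrier G \<Longrightarrow> b (Ad G g X) (Ad G g Y) = b X Y"
  using b_inv unfolding Ad_invariant_inner_def by blast+

lemma bounded_bilinear_b: "bounded_bilinear b"
  using bilinear_b bilinear_conv_bounded_bilinear by blast

lemmas b_simps = bounded_bilinear.add_left[OF bounded_bilinear_b] bounded_bilinear.add_right[OF bounded_bilinear_b]
  bounded_bilinear.diff_left[OF bounded_bilinear_b] bounded_bilinear.diff_right[OF bounded_bilinear_b]
  bounded_bilinear.minus_left[OF bounded_bilinear_b] bounded_bilinear.minus_right[OF bounded_bilinear_b]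
  bounded_bilinear.zero_left[OF bounded_bilinear_b] bounded_bilinear.zero_right[OF bounded_bilinear_b]
  bounded_bilinear.scaleR_left[OF bounded_bilinear_b] bounded_bilinear.scaleR_right[OF bounded_bilinear_b]

lemma b_zero: "b X X = 0 \<Longrightarrow> X = 0" using b_pos[of X] by force

lemma b_Ad_left: "g \<in> carrier G \<Longrightarrow> b (Ad G g X) Y = b X (Ad G (inv g) Y)"
  using b_Ad[of "g" X "Ad G (inv g) Y"] by simp

lemma bounded_bilinear_bracket: "bounded_bilinear (bracket G)"
  using linear_bracket_left linear_bracket_right bilinear_conv_bounded_bilinear
  unfolding bilinear_def by blast

lemmas bracket_simps = bounded_bilinear.add_left[OF bounded_bilinear_bracket]
  bounded_bilinear.add_right[OF bounded_bilinear_bracket]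
  bounded_bilinear.diff_left[OF bounded_bilinear_bracket] bounded_bilinear.diff_right[OF bounded_bilinear_bracket]
  bounded_bilinear.minus_left[OF bounded_bilinear_bracket] bounded_bilinear.minus_right[OF bounded_bilinear_bracket]
  bounded_bilinear.zero_left[OF bounded_bilinear_bracket] bounded_bilinear.zero_right[OF bounded_bilinear_bracket]
  bounded_bilinear.scaleR_left[OF bounded_bilinear_bracket] bounded_bilinear.scaleR_right[OF bounded_bilinear_bracket]

lemma expo_Ad_deriv: "((\<lambda>s. Ad G (expo Z s) Y) has_vector_derivative bracket G Z Y) (at 0)"
  using Ad_deriv[OF expo(2)[of Z], of Y] by (simp add: expoD Ad_one)

text \<open>The derivative at 0 of invariance of \<open>b\<close> along the one-parameter subgroup
  of \<open>Z\<close>.\<close>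

lemma b_bracket: "b (bracket G Z X) Y = - b X (bracket G Z Y)"
proof -
  from bounded_bilinear.has_vector_derivative[OF bounded_bilinear_b expo_Ad_deriv[of Z X] expo_Ad_deriv[of Z Y]]
  have "((\<lambda>s. b X Y) has_vector_derivative b X (bracket G Z Y) + b (bracket G Z X) Y) (at 0)"
    by (simp add: b_Ad expoD Ad_one)
  from vector_derivative_unique_at[OF this has_vector_derivative_const] show ?thesis by simp
qed

lemma subspace_orth: "subspace (orth_complement b S)"
  unfolding orth_complement_def subspace_def by (auto simp: b_simps)

text \<open>\<open>L\<close> represents the functional \<open>b X\<close> on \<open>S\<close>
  through the coordinate inner product. Positivity of \<open>b\<close> makes \<open>L\<close>
  injective on \<open>S\<close>, hence onto \<open>S\<close> by dimension, and a vector
  \<open>P\<close> of \<open>S\<close> with \<open>L P = L X\<close> is the projection.\<close>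

lemma orth_decomp_exists:
  assumes S: "subspace S"
  shows "\<exists>P\<in>S. X - P \<in> orth_complement b S"
proof -
  obtain C where C: "C \<subseteq> S" "pairwise orthogonal C" "\<And>x. x \<in> C \<Longrightarrow> norm x = 1"
    "independent C" "span C = S"
    using orthonormal_basis_subspace[OF S] by metis
  have fin: "finite C" using C(4) independent_imp_finite by blast
  define L where "L X = (\<Sum>c\<in>C. b X c *\<^sub>R c)" for X
  have LC: "L X \<bullet> c = b X c" if "c \<in> C" for X c
    unfolding L_def by (rule orthonormal_sum_inner[OF fin C(2,3) that])
  have linL: "linear L"
    unfolding L_def by (rule linearI) (simp_all add: b_simps scaleR_add_left sum.distrib scaleR_sum_right)
  have LS: "L X \<in> S" for X
    unfolding L_def C(5)[symmetric] by (rule span_sum, rule span_scale, erule span_base)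
  have orth: "X \<in> orth_complement b S" if "\<And>c. c \<in> C \<Longrightarrow> b X c = 0" for X
  proof -
    have "subspace {Y. b X Y = 0}" unfolding subspace_def by (simp add: b_simps)
    from span_minimal[of C, OF _ this] that have "S \<subseteq> {Y. b X Y = 0}" using C(5) by auto
    then show ?thesis unfolding orth_complement_def by blast
  qed
  have inj: "inj_on L S"
    unfolding linear_injective_on_subspace_0[OF linL S]
  proof (intro ballI impI)
    fix X assume X: "X \<in> S" "L X = 0"
    have "b X c = 0" if "c \<in> C" for c using LC[OF that, of X] X(2) by simp
    then have "X \<in> orth_complement b S" by (rule orth)
    then show "X = 0" using X(1) b_zero unfolding orth_complement_def by blast
  qed
  have "dim (L ` S) = dim S"
    by (rule dim_image_eq[OF linL]) (use inj S in \<open>simp add: span_eq_iff[THEN iffD2]\<close>)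
  then have "L ` S = S"
    using subspace_dim_equal[OF linear_subspace_image[OF linL S] S] LS by auto
  then obtain P where P: "P \<in> S" "L P = L X" using LS[of X] by (metis imageE)
  have "X - P \<in> orth_complement b S"
  proof (rule orth)
    fix c assume "c \<in> C"
    then show "b (X - P) c = 0" using LC[of c X] LC[of c P] P(2) by (simp add: b_simps)
  qed
  then show ?thesis using P(1) by blast
qed

section \<open>The reductive decomposition and the projection along the isotropy algebra\<close>

lemma hh_mm: "X \<in> hh \<Longrightarrow> Y \<in> mm \<Longrightarrow> b X Y = 0" "X \<in> hh \<Longrightarrow> Y \<in> mm \<Longrightarrow> b Y X = 0"
  unfolding orth_complement_def using b_sym by auto

lemma hh_mm_zero: "X \<in> hh \<Longrightarrow> X \<in> mm \<Longrightarrow> X = 0"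
  using hh_mm b_zero by blast

definition pm :: "'e \<Rightarrow> 'e" where "pm = proj_m hh mm"

lemma pm: "pm X \<in> mm" "X - pm X \<in> hh" and pm_unique: "Y \<in> mm \<Longrightarrow> X - Y \<in> hh \<Longrightarrow> pm X = Y"
proof -
  have ex: "\<exists>Y. Y \<in> mm \<and> X - Y \<in> hh"
  proof -
    obtain P where "P \<in> hh" "X - P \<in> mm" using orth_decomp_exists[OF subspace_lie_algebra, of X] by blast
    then show ?thesis by (intro exI[of _ "X - P"]) simp
  qed
  have un: "Y = Z" if "Y \<in> mm" "X - Y \<in> hh" "Z \<in> mm" "X - Z \<in> hh" for Y Z
  proof -
    have "Y - Z \<in> mm" using that subspace_diff[OF subspace_orth] by blast
    moreover have "(X - Z) - (X - Y) \<in> hh" using that subspace_diff[OF subspace_lie_algebra] by blast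
    ultimately have "Y - Z = 0" using hh_mm_zero[of "Y - Z"] by simp
    then show ?thesis by simp
  qed
  from ex obtain Y0 where Y0: "Y0 \<in> mm" "X - Y0 \<in> hh" by blast
  have "pm X = Y0" unfolding pm_def proj_m_def using Y0 un by (intro the_equality) auto
  then show "pm X \<in> mm" "X - pm X \<in> hh" "Y \<in> mm \<Longrightarrow> X - Y \<in> hh \<Longrightarrow> pm X = Y"
    using Y0 un by auto
qed

lemma pm_mm [simp]: "X \<in> mm \<Longrightarrow> pm X = X"
  by (rule pm_unique) (simp_all add: subspace_0 subspace_lie_algebra)

lemma pm_hh [simp]: "X \<in> hh \<Longrightarrow> pm X = 0"
  by (rule pm_unique) (simp_all add: subspace_0 subspace_orth)

lemma linear_pm: "linear pm"
proof (rule linearI)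
  fix X Y :: 'e and r :: real
  have "(X - pm X) + (Y - pm Y) \<in> hh" by (intro subspace_add subspace_lie_algebra pm)
  then show "pm (X + Y) = pm X + pm Y"
    by (intro pm_unique subspace_add subspace_orth pm) (simp add: algebra_simps)
  have "r *\<^sub>R (X - pm X) \<in> hh" by (intro subspace_scale subspace_lie_algebra pm)
  then show "pm (r *\<^sub>R X) = r *\<^sub>R pm X"
    by (intro pm_unique subspace_scale subspace_orth pm) (simp add: algebra_simps)
qed

lemma Ad_mm:
  assumes "h \<in> H" "X \<in> mm"
  shows "Ad G h X \<in> mm"
  unfolding orth_complement_def
proof (intro CollectI ballI)
  fix Y assume "Y \<in> hh"
  then have "Ad G (inv h) Y \<in> hh" by (intro Ad_lie_algebra H_inv assms)
  then show "b (Ad G h X) Y = 0" using assms H_carrier by (simp add: b_Ad_left hh_mm)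
qed

lemma pm_Ad: "h \<in> H \<Longrightarrow> pm (Ad G h X) = Ad G h (pm X)"
proof (rule pm_unique)
  assume h: "h \<in> H"
  then show "Ad G h (pm X) \<in> mm" by (intro Ad_mm pm)
  have "Ad G h (X - pm X) \<in> hh" by (intro Ad_lie_algebra h pm)
  then show "Ad G h X - Ad G h (pm X) \<in> hh" using linear_diff[OF linear_Ad[OF H_carrier[OF h]]] by simp
qed

lemma b_pm: "Y \<in> mm \<Longrightarrow> b (pm X) Y = b X Y" "Y \<in> mm \<Longrightarrow> b Y (pm X) = b Y X"
proof -
  assume Y: "Y \<in> mm"
  have "b (X - pm X) Y = 0" by (rule hh_mm(1)[OF pm(2) Y])
  then show "b (pm X) Y = b X Y" by (simp add: b_simps)
  then show "b Y (pm X) = b Y X" by (simp add: b_sym)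
qed

text \<open>Two lifts differ by the curve \<open>inv (\<alpha> s) \<otimes> \<alpha>' s\<close> in
  \<open>H\<close>, whose velocity lies in \<open>hh\<close>. The product rule then gives
  \<open>X'\<close> as \<open>Ad G (inv h) X\<close> plus an element of \<open>hh\<close>, which the
  projection removes.\<close>

lemma lift_change:
  assumes a: "has_lvel \<alpha> t X" and a': "has_lvel \<alpha>' t X'"
    and c: "\<forall>\<^sub>F s in nhds t. \<alpha> s <# H = \<alpha>' s <# H"
  defines "h \<equiv> inv (\<alpha> t) \<otimes> \<alpha>' t"
  shows "h \<in> H" "X' - Ad G (inv h) X \<in> hh" "pm X' = Ad G (inv h) (pm X)"
proof -
  note ca = has_lvel_carrier[OF a] has_lvel_carrier[OF a']
  have ev: "\<forall>\<^sub>F s in nhds t. inv (\<alpha> s) \<otimes> \<alpha>' s \<in> H \<and> \<alpha> s \<otimes> (inv (\<alpha> s) \<otimes> \<alpha>' s) = \<alpha>' s"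
    using c has_lvel_ev_carrier[OF a] has_lvel_ev_carrier[OF a'] by eventually_elim (simp add: l_coset_eq_iff)
  show h: "h \<in> H" unfolding h_def using eventually_nhds_x_imp_x[OF ev] by blast
  define w where "w = Ad G (inv (\<alpha>' t)) (- Ad G (\<alpha> t) X) + X'"
  have hl: "has_lvel (\<lambda>s. inv (\<alpha> s) \<otimes> \<alpha>' s) t w"
    unfolding w_def by (rule has_lvel_mult[OF has_lvel_inv[OF a] a'])
  have "w \<in> hh" by (rule tangent_in_lie_algebra[OF hl]) (use ev in \<open>eventually_elim; simp\<close>)
  moreover have "has_lvel (\<lambda>s. \<alpha> s \<otimes> (inv (\<alpha> s) \<otimes> \<alpha>' s)) t (Ad G (inv h) X + w)"
    unfolding h_def by (rule has_lvel_mult[OF a hl])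
  then have "has_lvel \<alpha>' t (Ad G (inv h) X + w)"
    by (rule has_lvel_cong) (use ev in \<open>eventually_elim; simp\<close>)
  then have X': "X' = Ad G (inv h) X + w" using a' has_lvel_unique by blast
  ultimately show "X' - Ad G (inv h) X \<in> hh" by simp
  show "pm X' = Ad G (inv h) (pm X)"
    unfolding X' using \<open>w \<in> hh\<close> h by (simp add: linear_add[OF linear_pm] pm_Ad H_inv)
qed

end

locale invariant_metric = hom_space G H b for G :: "('a::t2_space, 'e::euclidean_space) lie_structure" (structure)
    and H :: "'a set" and b :: "'e \<Rightarrow> 'e \<Rightarrow> real" +
  fixes A :: "'e \<Rightarrow> 'e"
  assumes A: "metric_endomorphism G H b (orth_complement b (lie_algebra_of G H)) A"
begin

text \<open>The extension of \<open>A\<close> by 0 on \<open>hh\<close>. Being total and linear, it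
  can be applied to left velocities before projection; it remains symmetric for \<open>b\<close> and
  commutes with \<open>Ad\<close> of \<open>H\<close>.\<close>

definition Abar :: "'e \<Rightarrow> 'e" where "Abar X = A (pm X)"

section \<open>The metric endomorphism and the momentum of a lift\<close>

lemma A_mm: "X \<in> mm \<Longrightarrow> A X \<in> mm" and A_lin: "linear_on mm A"
  and A_sym: "X \<in> mm \<Longrightarrow> Y \<in> mm \<Longrightarrow> b (A X) Y = b X (A Y)"
  and A_pos: "X \<in> mm \<Longrightarrow> X \<noteq> 0 \<Longrightarrow> b (A X) X > 0"
  and A_Ad: "h \<in> H \<Longrightarrow> X \<in> mm \<Longrightarrow> A (Ad G h X) = Ad G h (A X)"
  using A unfolding metric_endomorphism_def by auto

lemma Abar_mm: "Abar X \<in> mm" unfolding Abar_def by (intro A_mm pm)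

lemma linear_Abar: "linear Abar"
proof (rule linearI)
  fix X Y :: 'e and r :: real
  show "Abar (X + Y) = Abar X + Abar Y"
    using A_lin pm(1) unfolding Abar_def linear_on_def by (simp add: linear_add[OF linear_pm])
  show "Abar (r *\<^sub>R X) = r *\<^sub>R Abar X"
    using A_lin pm(1) unfolding Abar_def linear_on_def by (simp add: linear_scale[OF linear_pm])
qed

lemma Abar_Ad: "h \<in> H \<Longrightarrow> Abar (Ad G h X) = Ad G h (Abar X)"
  unfolding Abar_def by (simp add: pm_Ad A_Ad pm)

lemma Abar_sym: "b (Abar X) Y = b X (Abar Y)"
  using A_sym[OF pm(1) pm(1), of X Y] b_pm Abar_mm unfolding Abar_def by (metis Abar_def)

lemma Abar_bracket: "Z \<in> hh \<Longrightarrow> Abar (bracket G Z X) = bracket G Z (Abar X)"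
proof -
  assume Z: "Z \<in> hh"
  have "bounded_linear Abar" using linear_Abar linear_conv_bounded_linear by blast
  from bounded_linear.has_vector_derivative[OF this expo_Ad_deriv[of Z X]]
  have "((\<lambda>s. Ad G (expo Z s) (Abar X)) has_vector_derivative Abar (bracket G Z X)) (at 0)"
    by (simp add: Abar_Ad[OF expo(3)[OF Z]])
  from vector_derivative_unique_at[OF this expo_Ad_deriv] show ?thesis .
qed

abbreviation gA :: "'e \<Rightarrow> 'e \<Rightarrow> real" where "gA \<equiv> endo_metric b A"

text \<open>Passing to another lift multiplies the group element by \<open>h\<close> on the right
  and applies \<open>Ad G (inv h)\<close> to \<open>Abar X\<close>; the two changes cancel. In the
  speed they cancel by invariance of \<open>b\<close>.\<close>

lemma momentum_lift:
  assumes a: "has_lvel \<alpha> t X" and a': "has_lvel \<alpha>' t X'"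
    and c: "\<forall>\<^sub>F s in nhds t. \<alpha> s <# H = \<alpha>' s <# H"
  shows "Ad G (\<alpha>' t) (Abar X') = Ad G (\<alpha> t) (Abar X)" "b (Abar X') X' = b (Abar X) X"
proof -
  note lc = lift_change[OF assms]
  let ?h = "inv (\<alpha> t) \<otimes> \<alpha>' t"
  note ca = has_lvel_carrier[OF a] has_lvel_carrier[OF a']
  have A': "Abar X' = Ad G (inv ?h) (Abar X)"
    unfolding Abar_def lc(3) by (rule A_Ad[OF H_inv[OF lc(1)] pm(1)])
  have "Ad G (\<alpha>' t) (Abar X') = Ad G (\<alpha>' t \<otimes> inv ?h) (Abar X)"
    unfolding A' using ca by (simp add: Ad_mult)
  also have "\<alpha>' t \<otimes> inv ?h = \<alpha> t" using ca by (simp add: inv_mult_group)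
  finally show "Ad G (\<alpha>' t) (Abar X') = Ad G (\<alpha> t) (Abar X)" .
  have "b (Abar X') X' = b (Abar X') (pm X')" by (rule b_pm(2)[OF Abar_mm, symmetric])
  also have "\<dots> = b (Abar X) (pm X)" unfolding A' lc(3) using ca by (intro b_Ad) simp
  also have "\<dots> = b (Abar X) X" by (rule b_pm(2)[OF Abar_mm])
  finally show "b (Abar X') X' = b (Abar X) X" .
qed

text \<open>Lift independence of the speed is what makes the definite description in
  \<open>speed_sq\<close> denote.\<close>

lemma speed_sq_eq:
  assumes W: "open W" "t \<in> W" "smooth_into G W \<alpha>" "\<And>s. s \<in> W \<Longrightarrow> c s = \<alpha> s <# H"
  shows "speed_sq G H mm gA c t = b (Abar (left_vel G \<alpha> t)) (left_vel G \<alpha> t)"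
proof -
  have g: "gA (pm X) (pm X) = b (Abar X) X" for X
    unfolding endo_metric_def Abar_def[symmetric] by (rule b_pm(2)[OF Abar_mm])
  have "speed_sq G H mm gA c t = (THE r. \<exists>W \<alpha>. open W \<and> t \<in> W \<and> smooth_into G W \<alpha> \<and>
      (\<forall>s\<in>W. c s = \<alpha> s <# H) \<and> r = b (Abar (left_vel G \<alpha> t)) (left_vel G \<alpha> t))"
    unfolding speed_sq_def Let_def pm_def[symmetric] g ..
  also have "\<dots> = b (Abar (left_vel G \<alpha> t)) (left_vel G \<alpha> t)"
  proof (rule the_equality)
    show "\<exists>W \<alpha>'. open W \<and> t \<in> W \<and> smooth_into G W \<alpha>' \<and> (\<forall>s\<in>W. c s = \<alpha>' s <# H) \<and>
        b (Abar (left_vel G \<alpha> t)) (left_vel G \<alpha> t) = b (Abar (left_vel G \<alpha>' t)) (left_vel G \<alpha>' t)"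
      using W by blast
    fix r assume "\<exists>W \<alpha>. open W \<and> t \<in> W \<and> smooth_into G W \<alpha> \<and>
      (\<forall>s\<in>W. c s = \<alpha> s <# H) \<and> r = b (Abar (left_vel G \<alpha> t)) (left_vel G \<alpha> t)"
    then obtain W' \<alpha>' where W': "open W'" "t \<in> W'" "smooth_into G W' \<alpha>'" "\<forall>s\<in>W'. c s = \<alpha>' s <# H"
      "r = b (Abar (left_vel G \<alpha>' t)) (left_vel G \<alpha>' t)" by blast
    have "\<forall>\<^sub>F s in nhds t. s \<in> W \<inter> W'" by (rule eventually_nhds_in_open) (use W W' in auto)
    then have "\<forall>\<^sub>F s in nhds t. \<alpha> s <# H = \<alpha>' s <# H"
      by eventually_elim (use W(4) W'(4) in auto)
    from momentum_lift(2)[OF has_lvel_smooth[OF W(1,3,2)] has_lvel_smooth[OF W'(1,3,2)] this] W'(5)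
    show "r = b (Abar (left_vel G \<alpha> t)) (left_vel G \<alpha> t)" by simp
  qed
  finally show ?thesis .
qed

end

context lie_grp
begin

section \<open>Group-valued maps of two variables and the Maurer-Cartan equation\<close>

lemma smooth_on_Ad_apply:
  fixes f :: "'d::euclidean_space \<Rightarrow> 'a"
  assumes D: "open D" and f: "smooth_into G D f" and Y: "smooth_on D Y"
  shows "smooth_on D (\<lambda>x. Ad G (f x) (Y x))"
proof -
  have "smooth_on D (\<lambda>x. \<Sum>b\<in>Basis. (Y x \<bullet> b) *\<^sub>R Ad G (f x) b)"
    by (intro smooth_on_sum D smooth_on_bilinear[OF bounded_bilinear_scaleR D _ Ad_smooth[OF D f]]
        smooth_on_bilinear[OF bounded_bilinear_inner D Y smooth_on_const])
  moreover have "(\<Sum>b\<in>Basis. (Y x \<bullet> b) *\<^sub>R Ad G (f x) b) = Ad G (f x) (Y x)" if "x \<in> D" for x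
  proof -
    have "linear (Ad G (f x))" by (rule linear_Ad[OF smooth_intoD(1)[OF f that]])
    then have "Ad G (f x) (\<Sum>b\<in>Basis. (Y x \<bullet> b) *\<^sub>R b) = (\<Sum>b\<in>Basis. (Y x \<bullet> b) *\<^sub>R Ad G (f x) b)"
      by (simp add: linear_sum linear_scale)
    then show ?thesis by (simp add: euclidean_representation)
  qed
  ultimately show ?thesis
    using smooth_on_cong[OF D, of "\<lambda>x. \<Sum>b\<in>Basis. (Y x \<bullet> b) *\<^sub>R Ad G (f x) b" "\<lambda>x. Ad G (f x) (Y x)"] by blast
qed

lemma has_lvel_slices:
  assumes D: "open D" and f: "smooth_into G D \<alpha>" and "(s, t) \<in> D"
  shows "has_lvel (\<lambda>t. \<alpha> (s, t)) t (lder \<alpha> (s, t) (0, 1))" "has_lvel (\<lambda>s. \<alpha> (s, t)) s (lder \<alpha> (s, t) (1, 0))"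
  by (rule has_lvel_lder[OF D f]; use assms in \<open>auto intro!: derivative_eq_intros has_vector_derivative_Pair\<close>)+

lemma has_lvel_one_vel1:
  assumes "has_lvel p t X" "p t = \<one>"
  shows "vel1 p t X"
proof (rule vel1_cong[OF has_lvel_vel1[OF assms(1)]])
  show "\<forall>\<^sub>F s in nhds t. inv (p t) \<otimes> p s = p s"
    using has_lvel_ev_carrier[OF assms(1)] by eventually_elim (simp add: assms(2))
qed

text \<open>The Maurer-Cartan equation in the form \<open>\<partial>\<^sub>s \<xi> = Ad(\<alpha>\<inverse>) \<partial>\<^sub>t \<zeta>\<close>, where \<open>\<xi> = \<alpha>\<inverse> \<partial>\<^sub>t \<alpha>\<close> and
  \<open>\<zeta> = \<partial>\<^sub>s \<alpha> \<alpha>\<inverse>\<close>: both sides are mixed second derivatives, at \<open>(s0, t0)\<close>, of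
  \<open>\<alpha>(s,t0)\<inverse> \<alpha>(s,t) \<alpha>(s0,t)\<inverse> \<alpha>(s0,t0)\<close>.\<close>

lemma maurer_cartan:
  assumes D: "open D" and \<alpha>: "smooth_into G D \<alpha>" and p: "(s0, t0) \<in> D"
    and x: "((\<lambda>s. lder \<alpha> (s, t0) (0, 1)) has_vector_derivative X) (at s0)"
    and z: "((\<lambda>t. Ad G (\<alpha> (s0, t)) (lder \<alpha> (s0, t) (1, 0))) has_vector_derivative Z) (at t0)"
  shows "Ad G (\<alpha> (s0, t0)) X = Z"
proof -
  let ?a = "\<alpha> (s0, t0)"
  define S where "S = D \<inter> (\<lambda>p. (fst p, t0)) -` D \<inter> (\<lambda>p. (s0, snd p)) -` D"
  have oS: "open S"
    unfolding S_def by (intro open_Int D open_vimage continuous_intros)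
  \<comment> \<open>\<open>w\<close> is \<one> on both lines \<open>t = t0\<close> and
    \<open>s = s0\<close>, so its velocities across these lines can be read in the base chart.
    \<open>S\<close> consists of the points for which all three values of \<alpha> are
    defined.\<close>
  define w where "w p = ((inv \<alpha> (fst p, t0) \<otimes> \<alpha> p) \<otimes> inv \<alpha> (s0, snd p)) \<otimes> ?a" for p
  have ac: "\<alpha> q \<in> carrier G" if "q \<in> D" for q using smooth_intoD(1)[OF \<alpha> that] .
  have sf: "smooth_on S (\<lambda>p. (fst p, t0))" "smooth_on S (\<lambda>p. (s0, snd p))" "smooth_on S (\<lambda>p. p)"
    by (intro smooth_on_Pair smooth_on_const smooth_on_id smooth_on_bounded_linear oS
        bounded_linear_fst bounded_linear_snd)+
  have ws: "smooth_into G S w"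
    unfolding w_def
    by (intro smooth_into_mult smooth_into_inv oS smooth_into_const ac p
        smooth_into_compose[OF oS D _ \<alpha> sf(1)] smooth_into_compose[OF oS D _ \<alpha> sf(2)]
        smooth_into_compose[OF oS D _ \<alpha> sf(3)]) (auto simp: S_def)
  define N where "N = S \<inter> w -` dom0"
  note N = smooth_into_cd[OF oS ws, folded N_def]
  have pN: "(s0, t0) \<in> N" using p ac[OF p] one_dom0 by (simp add: N_def S_def w_def)
  define \<xi> where "\<xi> s = lder \<alpha> (s, t0) (0, 1)" for s
  define \<zeta> where "\<zeta> t = Ad G (\<alpha> (s0, t)) (lder \<alpha> (s0, t) (1, 0))" for t
  have 1: "((\<lambda>t. cd (w (s, t))) has_vector_derivative \<xi> s - \<xi> s0) (at t0)" if "(s, t0) \<in> N" for s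
  proof -
    have sD: "(s, t0) \<in> D" using that by (auto simp: N_def S_def)
    have v1: "has_lvel (\<lambda>t. inv \<alpha> (s, t0) \<otimes> \<alpha> (s, t)) t0 (\<xi> s)"
      unfolding \<xi>_def by (intro has_lvel_cmult has_lvel_slices[OF D \<alpha> sD]) (use ac[OF sD] in simp)
    have v2: "has_lvel (\<lambda>t. inv \<alpha> (s0, t)) t0 (- Ad G ?a (\<xi> s0))"
      unfolding \<xi>_def by (rule has_lvel_inv[OF has_lvel_slices(1)[OF D \<alpha> p]])
    from has_lvel_mult_const[OF ac[OF p] has_lvel_mult[OF v1 v2]]
    have "has_lvel (\<lambda>t. w (s, t)) t0 (Ad G (inv ?a) (Ad G (inv (inv ?a)) (\<xi> s) + - Ad G ?a (\<xi> s0)))"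
      by (simp add: w_def)
    moreover have "w (s, t0) = \<one>" using ac[OF sD] ac[OF p] by (simp add: w_def)
    ultimately have "vel1 (\<lambda>t. w (s, t)) t0 (Ad G (inv ?a) (Ad G (inv (inv ?a)) (\<xi> s) + - Ad G ?a (\<xi> s0)))"
      by (rule has_lvel_one_vel1)
    moreover have "Ad G (inv ?a) (Ad G (inv (inv ?a)) (\<xi> s) + - Ad G ?a (\<xi> s0)) = \<xi> s - \<xi> s0"
      using ac[OF p] linear_diff[OF linear_Ad[of "inv ?a"]] by simp
    ultimately show ?thesis unfolding vel1_def by simp
  qed
  have 2: "((\<lambda>s. cd (w (s, t))) has_vector_derivative Ad G (inv ?a) (\<zeta> t - \<zeta> t0)) (at s0)" if "(s0, t) \<in> N" for t
  proof -
    have tD: "(s0, t) \<in> D" using that by (auto simp: N_def S_def)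
    have v1: "has_lvel (\<lambda>s. inv \<alpha> (s, t0)) s0 (- \<zeta> t0)"
      unfolding \<zeta>_def by (rule has_lvel_inv[OF has_lvel_slices(2)[OF D \<alpha> p]])
    note v2 = has_lvel_slices(2)[OF D \<alpha> tD]
    have i: "inv \<alpha> (s0, t) \<in> carrier G" using ac[OF tD] by simp
    from has_lvel_mult_const[OF ac[OF p] has_lvel_mult_const[OF i has_lvel_mult[OF v1 v2]]]
    have "has_lvel (\<lambda>s. w (s, t)) s0
      (Ad G (inv ?a) (Ad G (inv (inv \<alpha> (s0, t))) (Ad G (inv \<alpha> (s0, t)) (- \<zeta> t0) + lder \<alpha> (s0, t) (1, 0))))"
      by (simp add: w_def)
    moreover have "w (s0, t) = \<one>" using ac[OF tD] ac[OF p] by (simp add: w_def m_assoc)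
    ultimately have "vel1 (\<lambda>s. w (s, t)) s0
      (Ad G (inv ?a) (Ad G (inv (inv \<alpha> (s0, t))) (Ad G (inv \<alpha> (s0, t)) (- \<zeta> t0) + lder \<alpha> (s0, t) (1, 0))))"
      by (rule has_lvel_one_vel1)
    moreover have "Ad G (inv (inv \<alpha> (s0, t))) (Ad G (inv \<alpha> (s0, t)) (- \<zeta> t0) + lder \<alpha> (s0, t) (1, 0)) = \<zeta> t - \<zeta> t0"
      using ac[OF tD] by (simp add: linear_add[OF linear_Ad] \<zeta>_def[of t])
    ultimately show ?thesis unfolding vel1_def by simp
  qed
  have 3: "((\<lambda>s. \<xi> s - \<xi> s0) has_vector_derivative X - 0) (at s0)"
    by (intro has_vector_derivative_diff has_vector_derivative_const x[folded \<xi>_def])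
  have "bounded_linear (Ad G (inv ?a))"
    using linear_Ad[of "inv ?a"] ac[OF p] linear_conv_bounded_linear by blast
  from bounded_linear.has_vector_derivative[OF this has_vector_derivative_diff[OF z[folded \<zeta>_def] has_vector_derivative_const]]
  have 4: "((\<lambda>t. Ad G (inv ?a) (\<zeta> t - \<zeta> t0)) has_vector_derivative Ad G (inv ?a) (Z - 0)) (at t0)" .
  from mixed_partials[OF N pN 1 3 2 4] have "X = Ad G (inv ?a) Z" by simp
  then show ?thesis using ac[OF p] by simp
qed

end

section \<open>The first variation of the energy\<close>

lemma integral_smooth_derivative:
  fixes q :: "real \<times> real \<Rightarrow> real"
  assumes I: "open I" and q: "smooth_on ({-\<epsilon><..<\<epsilon>} \<times> I) q" and \<epsilon>: "\<epsilon> > 0" and t: "{t0..t1} \<subseteq> I"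
  shows "((\<lambda>s. integral {t0..t1} (\<lambda>t. q (s, t))) has_real_derivative
      integral {t0..t1} (\<lambda>t. frechet_derivative q (at (0, t)) (1, 0))) (at 0)"
proof -
  let ?D = "{-\<epsilon><..<\<epsilon>} \<times> I" and ?U = "{-\<epsilon>/2..\<epsilon>/2}"
  have oD: "open ?D" by (intro open_Times I open_greaterThanLessThan)
  have sub: "?U \<times> {t0..t1} \<subseteq> ?D" using t \<epsilon> by auto
  define K where "K s t = frechet_derivative q (at (s, t)) (1, 0)" for s t
  have "((\<lambda>s. integral (cbox t0 t1) (\<lambda>t. q (s, t))) has_field_derivative integral (cbox t0 t1) (K 0)) (at 0 within ?U)"
  proof (rule leibniz_rule_field_derivative)
    fix s t assume st: "s \<in> ?U" "t \<in> cbox t0 t1"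
    have "(s, t) \<in> ?D" using subsetD[OF sub, of "(s, t)"] st by simp
    from smooth_on_slices(1)[OF oD q this]
    show "((\<lambda>s. q (s, t)) has_field_derivative K s t) (at s within ?U)"
      unfolding K_def by (simp add: has_real_derivative_iff_has_vector_derivative has_vector_derivative_at_within)
  next
    fix s assume s: "s \<in> ?U"
    have "continuous_on {t0..t1} (\<lambda>t. q (s, t))"
      by (rule continuous_on_compose2[OF smooth_on_continuous[OF q]])
        (intro continuous_intros, use s in \<open>intro image_subsetI subsetD[OF sub]; simp\<close>)
    then show "(\<lambda>t. q (s, t)) integrable_on cbox t0 t1" by (simp add: integrable_continuous_interval)
  next
    have "continuous_on (?U \<times> {t0..t1}) (\<lambda>p. frechet_derivative q (at p) (1, 0))"
      by (rule continuous_on_subset[OF smooth_on_continuous[OF smooth_on_frechet[OF q]] sub])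
    then show "continuous_on (?U \<times> cbox t0 t1) (\<lambda>(s, t). K s t)" by (simp add: K_def split_def)
  qed (use \<epsilon> in auto)
  moreover have "at 0 within ?U = at (0 :: real)"
    by (rule at_within_interior) (use \<epsilon> in \<open>simp add: interior_atLeastAtMost_real\<close>)
  ultimately show ?thesis by (simp add: K_def[abs_def])
qed

lemma zero_derivative_of_quadratic_tests:
  fixes f :: "real \<Rightarrow> real"
  assumes I: "open I" and f: "smooth_on I f" and t: "t \<in> I"
    and test: "\<And>t0 t1. t0 < t1 \<Longrightarrow> {t0..t1} \<subseteq> I \<Longrightarrow> integral {t0..t1} (\<lambda>t. (t0 + t1 - 2 * t) * f t) = 0"
  shows "vector_derivative f (at t) = 0"
proof (rule ccontr)
  define f' where "f' t = vector_derivative f (at t)" for t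
  assume "vector_derivative f (at t) \<noteq> 0"
  then have nz: "f' t \<noteq> 0" by (simp add: f'_def)
  define \<sigma> where "\<sigma> = sgn (f' t)"
  have cf': "continuous_on I f'" unfolding f'_def by (rule smooth_on_continuous[OF smooth_on_vector_derivative(1)[OF I f]])
  then have "isCont (\<lambda>t. \<sigma> * f' t) t" using I t by (auto simp: continuous_on_eq_continuous_at intro!: continuous_intros)
  moreover have "\<sigma> * f' t > 0" using nz by (simp add: \<sigma>_def sgn_mult_self_eq[symmetric] abs_sgn[symmetric] mult.commute)
  ultimately have "\<forall>\<^sub>F s in nhds t. \<sigma> * f' s \<in> {0<..}"
    by (intro isCont_eventually_in_open) auto
  then have "\<forall>\<^sub>F s in nhds t. \<sigma> * f' s > 0 \<and> s \<in> I"
    using eventually_nhds_in_open[OF I t] by (auto elim: eventually_elim2)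
  then obtain d where d: "d > 0" "\<And>s. dist s t < d \<Longrightarrow> \<sigma> * f' s > 0 \<and> s \<in> I"
    unfolding eventually_nhds_metric by blast
  define r where "r = d / 2"
  have r: "r > 0" "\<And>s. s \<in> {t - r..t + r} \<Longrightarrow> \<sigma> * f' s > 0 \<and> s \<in> I"
    using d by (auto simp: r_def dist_real_def)
  define \<phi> where "\<phi> s = (s - (t - r)) * (t + r - s)" for s
  have sub: "{t - r..t + r} \<subseteq> I" using r(2) by blast
  have cf: "continuous_on {t - r..t + r} f" "continuous_on {t - r..t + r} f'"
    using continuous_on_subset[OF smooth_on_continuous[OF f] sub] continuous_on_subset[OF cf' sub] .
  have "((\<lambda>s. \<phi> s * f' s + ((t - r) + (t + r) - 2 * s) * f s) has_integral
      \<phi> (t + r) * f (t + r) - \<phi> (t - r) * f (t - r)) {t - r..t + r}"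
  proof (rule fundamental_theorem_of_calculus)
    fix s assume s: "s \<in> {t - r..t + r}"
    have "(f has_real_derivative f' s) (at s)"
      using smooth_on_vector_derivative(2)[OF I f] s r(2)
      by (simp add: f'_def has_real_derivative_iff_has_vector_derivative)
    moreover have "(\<phi> has_real_derivative ((t - r) + (t + r) - 2 * s)) (at s)"
      unfolding \<phi>_def by (auto intro!: derivative_eq_intros)
    ultimately have "((\<lambda>s. \<phi> s * f s) has_real_derivative (\<phi> s * f' s + ((t - r) + (t + r) - 2 * s) * f s)) (at s)"
      by (auto intro!: derivative_eq_intros simp: mult.commute)
    then show "((\<lambda>s. \<phi> s * f s) has_vector_derivative (\<phi> s * f' s + ((t - r) + (t + r) - 2 * s) * f s))
        (at s within {t - r..t + r})"
      by (simp add: has_real_derivative_iff_has_vector_derivative has_vector_derivative_at_within)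
  qed (use r in simp)
  then have 1: "((\<lambda>s. \<phi> s * f' s + ((t - r) + (t + r) - 2 * s) * f s) has_integral 0) {t - r..t + r}"
    by (simp add: \<phi>_def)
  have "(\<lambda>s. ((t - r) + (t + r) - 2 * s) * f s) integrable_on {t - r..t + r}"
    by (intro integrable_continuous_interval continuous_intros cf)
  then have 2: "((\<lambda>s. ((t - r) + (t + r) - 2 * s) * f s) has_integral 0) {t - r..t + r}"
    using test[OF _ sub] r(1) by (simp add: has_integral_integrable_integral)
  have "((\<lambda>s. \<sigma> * (\<phi> s * f' s)) has_integral \<sigma> * (0 - 0)) {t - r..t + r}"
    using has_integral_mult_right[OF has_integral_diff[OF 1 2], of \<sigma>] by simp
  then have h: "((\<lambda>s. \<phi> s * (\<sigma> * f' s)) has_integral 0) (cbox (t - r) (t + r))"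
    by (simp add: mult.left_commute)
  have c1: "continuous_on (cbox (t - r) (t + r)) (\<lambda>s. \<phi> s * (\<sigma> * f' s))"
    unfolding \<phi>_def cbox_interval by (intro continuous_intros cf)
  have c2: "0 \<le> \<phi> s * (\<sigma> * f' s)" if "s \<in> cbox (t - r) (t + r)" for s
    using that r(2)[of s] by (simp add: \<phi>_def less_imp_le)
  have "\<phi> t * (\<sigma> * f' t) = 0"
    using has_integral_0_cbox_imp_0[OF c1 c2 h, of t] r(1) by simp
  moreover have "\<phi> t > 0" using r(1) by (simp add: \<phi>_def)
  moreover have "\<sigma> * f' t > 0" using r by simp
  ultimately show False by (metis mult_pos_pos less_irrefl)
qed

context invariant_metric
begin

section \<open>Speed and energy along a variation\<close>

lemma bounded_linear_Abar: "bounded_linear Abar"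
  using linear_Abar linear_conv_bounded_linear by blast

lemma left_coset_mult:
  "g \<in> carrier G \<Longrightarrow> h \<in> carrier G \<Longrightarrow> g <# (h <# H) = (g \<otimes> h) <# H"
  using lcos_m_assoc subgroup.subset[OF subH] by blast

lemma quot_lift:
  assumes "smooth_into_quot G H D F" "x \<in> D"
  obtains W f where "open W" "x \<in> W" "W \<subseteq> D" "smooth_into G W f" "\<And>y. y \<in> W \<Longrightarrow> F y = f y <# H"
proof -
  from bspec[OF assms(1)[unfolded smooth_into_quot_def] assms(2)] obtain W f
    where *: "open W \<and> x \<in> W \<and> W \<subseteq> D \<and> smooth_into G W f \<and> (\<forall>y\<in>W. F y = f y <# H)"
    by (elim exE)
  show ?thesis
    by (rule that[of W f]) (use * in simp_all)
qed

lemma speed_2d: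
  fixes V :: "real \<times> real \<Rightarrow> 'a set"
  assumes W: "open W" "smooth_into G W \<alpha>" "\<And>y. y \<in> W \<Longrightarrow> V y = \<alpha> y <# H" and p: "(s, t) \<in> W"
  shows "speed_sq G H mm gA (\<lambda>\<tau>. V (s, \<tau>)) t = b (Abar (lder \<alpha> (s, t) (0, 1))) (lder \<alpha> (s, t) (0, 1))"
proof -
  let ?W = "(\<lambda>\<tau>. (s, \<tau>)) -` W"
  have o: "open ?W" by (intro open_vimage W continuous_intros)
  have sm: "smooth_into G ?W (\<lambda>\<tau>. \<alpha> (s, \<tau>))"
    by (rule smooth_into_compose[OF o W(1) _ W(2)])
      (auto intro!: smooth_on_Pair smooth_on_const smooth_on_id o)
  have "left_vel G (\<lambda>\<tau>. \<alpha> (s, \<tau>)) t = lder \<alpha> (s, t) (0, 1)"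
    by (rule has_lvel_left_vel[OF has_lvel_slices(1)[OF W(1,2) p]])
  then show ?thesis using speed_sq_eq[OF o _ sm, of t "\<lambda>\<tau>. V (s, \<tau>)"] p W(3) by simp
qed

abbreviation sp :: "(real \<times> real \<Rightarrow> 'a set) \<Rightarrow> real \<times> real \<Rightarrow> real" where
  "sp V p \<equiv> speed_sq G H mm gA (\<lambda>\<tau>. V (fst p, \<tau>)) (snd p)"

lemma sp_local:
  assumes W: "open W" "smooth_into G W \<alpha>" "\<And>y. y \<in> W \<Longrightarrow> V y = \<alpha> y <# H"
  shows "smooth_on W (sp V)" "p \<in> W \<Longrightarrow> sp V p = b (Abar (lder \<alpha> p (0, 1))) (lder \<alpha> p (0, 1))"
proof -
  show *: "sp V p = b (Abar (lder \<alpha> p (0, 1))) (lder \<alpha> p (0, 1))" if "p \<in> W" for p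
    using speed_2d[where V=V, OF W, of "fst p" "snd p"] that by simp
  have l: "smooth_on W (\<lambda>p. lder \<alpha> p (0, 1))" by (rule lder_lemma(2)[OF W(1,2)])
  have "smooth_on W (\<lambda>p. b (Abar (lder \<alpha> p (0, 1))) (lder \<alpha> p (0, 1)))"
    by (rule smooth_on_bilinear[OF bounded_bilinear_b W(1) smooth_on_linear_compose[OF W(1) linear_Abar l] l])
  then show "smooth_on W (sp V)"
    using smooth_on_cong[OF W(1), of "sp V" "\<lambda>p. b (Abar (lder \<alpha> p (0, 1))) (lder \<alpha> p (0, 1))"] * by blast
qed

lemma sp_smooth:
  assumes D: "open D" and V: "smooth_into_quot G H D V"
  shows "smooth_on D (sp V)"
proof (rule smooth_on_local[OF D])
  fix x assume "x \<in> D"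
  with V obtain W f where W: "open W" "x \<in> W" "W \<subseteq> D" "smooth_into G W f" "\<And>y. y \<in> W \<Longrightarrow> V y = f y <# H"
    by (rule quot_lift) (rule that)
  have "smooth_on W (sp V)" by (rule sp_local(1)[OF W(1,4,5)])
  then show "\<exists>T. open T \<and> x \<in> T \<and> smooth_on (D \<inter> T) (sp V)"
    by (intro exI[of _ W] conjI W smooth_on_subset[OF _ Int_lower2])
qed

text \<open>By symmetry of \<open>Abar\<close>, the speed changes at twice the pairing of
  \<open>Abar\<close> of the left velocity with its derivative in \<open>s\<close>. The
  Maurer-Cartan equation expresses that derivative by \<open>Z\<close>, and invariance of
  \<open>b\<close> moves \<open>Ad\<close> to the other side, which produces the momentum.\<close>

lemma first_variation:
  fixes V :: "real \<times> real \<Rightarrow> 'a set"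
  assumes W: "open W" "smooth_into G W \<alpha>" "\<And>y. y \<in> W \<Longrightarrow> V y = \<alpha> y <# H" and p: "(0, t) \<in> W"
    and Z: "((\<lambda>\<tau>. Ad G (\<alpha> (0, \<tau>)) (lder \<alpha> (0, \<tau>) (1, 0))) has_vector_derivative Z) (at t)"
  shows "frechet_derivative (sp V) (at (0, t)) (1, 0) =
    2 * b (Ad G (\<alpha> (0, t)) (Abar (lder \<alpha> (0, t) (0, 1)))) Z"
proof -
  define \<xi> where "\<xi> s = lder \<alpha> (s, t) (0, 1)" for s
  obtain X where X: "(\<xi> has_vector_derivative X) (at 0)"
    using smooth_on_slices(1)[OF W(1) lder_lemma(2)[OF W(1,2)] p] unfolding \<xi>_def by blast
  have AX: "Ad G (\<alpha> (0, t)) X = Z" by (rule maurer_cartan[OF W(1,2) p X[unfolded \<xi>_def] Z])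
  from bounded_bilinear.has_vector_derivative[OF bounded_bilinear_b
      bounded_linear.has_vector_derivative[OF bounded_linear_Abar X] X]
  have 1: "((\<lambda>s. b (Abar (\<xi> s)) (\<xi> s)) has_vector_derivative b (Abar (\<xi> 0)) X + b (Abar X) (\<xi> 0)) (at 0)" .
  have ac: "\<alpha> (0, t) \<in> carrier G" using smooth_intoD(1)[OF W(2) p] .
  have "b (Abar X) (\<xi> 0) = b (Abar (\<xi> 0)) X" using Abar_sym b_sym by metis
  moreover have "b (Abar (\<xi> 0)) X = b (Ad G (\<alpha> (0, t)) (Abar (\<xi> 0))) Z"
    unfolding AX[symmetric] by (rule b_Ad[OF ac, symmetric])
  ultimately have 2: "((\<lambda>s. b (Abar (\<xi> s)) (\<xi> s)) has_vector_derivative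
      2 * b (Ad G (\<alpha> (0, t)) (Abar (\<xi> 0))) Z) (at 0)" using 1 by simp
  have "isCont (\<lambda>s. (s, t)) 0" by (intro continuous_intros)
  then have "\<forall>\<^sub>F s in nhds 0. (s, t) \<in> W" by (rule isCont_eventually_in_open) (rule W(1), rule p)
  then have "\<forall>\<^sub>F s in nhds 0. b (Abar (\<xi> s)) (\<xi> s) = sp V (s, t)"
    by eventually_elim (simp only: sp_local(2)[where V=V, OF W] \<xi>_def)
  from has_vector_derivative_ev_cong[OF 2 this]
  have "((\<lambda>s. sp V (s, t)) has_vector_derivative 2 * b (Ad G (\<alpha> (0, t)) (Abar (\<xi> 0))) Z) (at 0)" .
  from vector_derivative_unique_at[OF smooth_on_slices(1)[OF W(1) sp_local(1)[where V=V, OF W] p] this]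
  show ?thesis unfolding \<xi>_def .
qed

lemma energy_variation:
  assumes I: "open I" and V: "smooth_into_quot G H ({-\<epsilon><..<\<epsilon>} \<times> I) V" and \<epsilon>: "\<epsilon> > 0" and t: "{t0..t1} \<subseteq> I"
  shows "((\<lambda>s. energy G H mm gA t0 t1 (\<lambda>t. V (s, t))) has_real_derivative
      integral {t0..t1} (\<lambda>t. frechet_derivative (sp V) (at (0, t)) (1, 0)) / 2) (at 0)"
proof -
  have "smooth_on ({-\<epsilon><..<\<epsilon>} \<times> I) (sp V)"
    by (rule sp_smooth[OF _ V]) (intro open_Times I open_greaterThanLessThan)
  from DERIV_cdivide[OF integral_smooth_derivative[OF I this \<epsilon> t], of 2]
  show ?thesis unfolding energy_def by simp
qed

text \<open>The moment map of the action of \<open>G\<close> along the curve, with the dual of the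
  Lie algebra identified with the Lie algebra by \<open>b\<close>. The choice of a lift is harmless
  by \<open>momentum_lift\<close>.\<close>

definition mom :: "(real \<Rightarrow> 'a set) \<Rightarrow> real \<Rightarrow> 'e" where
  "mom c t = (SOME m. \<exists>W \<alpha>. open W \<and> t \<in> W \<and> smooth_into G W \<alpha> \<and> (\<forall>s\<in>W. c s = \<alpha> s <# H) \<and>
     m = Ad G (\<alpha> t) (Abar (left_vel G \<alpha> t)))"

lemma mom_eq:
  assumes W: "open W" "t \<in> W" "smooth_into G W \<alpha>" "\<And>s. s \<in> W \<Longrightarrow> c s = \<alpha> s <# H"
  shows "mom c t = Ad G (\<alpha> t) (Abar (left_vel G \<alpha> t))"
  unfolding mom_def
proof (rule some_equality)
  show "\<exists>W \<alpha>'. open W \<and> t \<in> W \<and> smooth_into G W \<alpha>' \<and> (\<forall>s\<in>W. c s = \<alpha>' s <# H) \<and>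
     Ad G (\<alpha> t) (Abar (left_vel G \<alpha> t)) = Ad G (\<alpha>' t) (Abar (left_vel G \<alpha>' t))"
    using W by blast
  fix m assume "\<exists>W \<alpha>. open W \<and> t \<in> W \<and> smooth_into G W \<alpha> \<and> (\<forall>s\<in>W. c s = \<alpha> s <# H) \<and>
     m = Ad G (\<alpha> t) (Abar (left_vel G \<alpha> t))"
  then obtain W' \<alpha>' where W': "open W'" "t \<in> W'" "smooth_into G W' \<alpha>'" "\<forall>s\<in>W'. c s = \<alpha>' s <# H"
    "m = Ad G (\<alpha>' t) (Abar (left_vel G \<alpha>' t))" by blast
  have "\<forall>\<^sub>F s in nhds t. s \<in> W \<inter> W'" by (rule eventually_nhds_in_open) (use W W' in auto)
  then have "\<forall>\<^sub>F s in nhds t. \<alpha> s <# H = \<alpha>' s <# H"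
    by eventually_elim (use W(4) W'(4) in auto)
  from momentum_lift(1)[OF has_lvel_smooth[OF W(1,3,2)] has_lvel_smooth[OF W'(1,3,2)] this] W'(5)
  show "m = Ad G (\<alpha> t) (Abar (left_vel G \<alpha> t))" by simp
qed

lemma left_vel_smooth:
  assumes "open W" "smooth_into G W \<alpha>"
  shows "smooth_on W (left_vel G \<alpha>)"
proof -
  have "left_vel G \<alpha> t = lder \<alpha> t 1" if "t \<in> W" for t
  proof -
    have "has_lvel (\<lambda>s. \<alpha> s) t (lder \<alpha> t 1)"
      by (rule has_lvel_lder[OF assms]) (use that in \<open>auto intro!: derivative_eq_intros\<close>)
    then show ?thesis by (rule has_lvel_left_vel)
  qed
  then show ?thesis
    using smooth_on_cong[OF assms(1), of "left_vel G \<alpha>" "\<lambda>t. lder \<alpha> t 1"] lder_lemma(2)[OF assms] by blast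
qed

lemma mom_smooth:
  assumes I: "open I" and c: "smooth_into_quot G H I c"
  shows "smooth_on I (mom c)"
proof (rule smooth_on_local[OF I])
  fix x assume "x \<in> I"
  with c obtain W f where W: "open W" "x \<in> W" "W \<subseteq> I" "smooth_into G W f" "\<And>y. y \<in> W \<Longrightarrow> c y = f y <# H"
    by (rule quot_lift) (rule that)
  have "smooth_on W (\<lambda>t. Ad G (f t) (Abar (left_vel G f t)))"
    by (intro smooth_on_Ad_apply W smooth_on_linear_compose[OF W(1) linear_Abar] left_vel_smooth)
  moreover have "mom c t = Ad G (f t) (Abar (left_vel G f t))" if "t \<in> W" for t
    by (rule mom_eq[OF W(1) that W(4,5)])
  ultimately have "smooth_on W (mom c)"
    using smooth_on_cong[OF W(1), of "mom c" "\<lambda>t. Ad G (f t) (Abar (left_vel G f t))"] by blast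
  then show "\<exists>T. open T \<and> x \<in> T \<and> smooth_on (I \<inter> T) (mom c)"
    by (intro exI[of _ W] conjI W smooth_on_subset[OF _ Int_lower2])
qed

text \<open>Varying a geodesic by the left action of \<open>exp(s \<phi>(t) Y)\<close>, with \<open>\<phi>\<close> quadratic and zero at the
  end points, tests the derivative of its momentum.\<close>

lemma geodesic_momentum_test:
  assumes geo: "geodesic G H mm gA I c" and t: "t0 < t1" "{t0..t1} \<subseteq> I"
  shows "integral {t0..t1} (\<lambda>t. (t0 + t1 - 2 * t) * b (mom c t) Y) = 0"
proof -
  have I: "open I" and c: "smooth_into_quot G H I c" using geo unfolding geodesic_def by blast+
  define \<phi> where "\<phi> t = (t - t0) * (t1 - t)" for t
  define V where "V p = expo Y (fst p * \<phi> (snd p)) <# c (snd p)" for p :: "real \<times> real"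
  let ?D = "{-1<..<1::real} \<times> I"
  have lift: "\<exists>W f. open W \<and> (s, t) \<in> W \<and> W \<subseteq> ?D \<and> smooth_into G W f \<and> (\<forall>y\<in>W. V y = f y <# H) \<and>
      (s = 0 \<longrightarrow> frechet_derivative (sp V) (at (0, t)) (1, 0) = 2 * ((t0 + t1 - 2 * t) * b (mom c t) Y))"
    if st: "(s, t) \<in> ?D" for s t
  proof -
    have "t \<in> I" using st by simp
    with c obtain W \<alpha> where W: "open W" "t \<in> W" "W \<subseteq> I" "smooth_into G W \<alpha>" "\<And>y. y \<in> W \<Longrightarrow> c y = \<alpha> y <# H"
      by (rule quot_lift) (rule that)
    let ?W = "{-1<..<1::real} \<times> W"
    define f where "f p = expo Y (fst p * \<phi> (snd p)) \<otimes> \<alpha> (snd p)" for p :: "real \<times> real"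
    have oW: "open ?W" by (intro open_Times W open_greaterThanLessThan)
    have "smooth_on ?W (\<lambda>p. fst p * ((snd p + (- t0)) * (t1 + (- snd p))))"
      by (intro smooth_on_bilinear[OF bounded_bilinear_mult] smooth_on_add oW smooth_on_const
          smooth_on_bounded_linear[of _ fst] smooth_on_bounded_linear[of _ snd]
          smooth_on_bounded_linear[of _ "\<lambda>p. - snd p"] bounded_linear_fst bounded_linear_snd
          bounded_linear_minus)
    then have "smooth_on ?W (\<lambda>p. fst p * \<phi> (snd p))" by (simp add: \<phi>_def)
    from smooth_into_compose[OF oW open_UNIV _ expoD(5) this]
    have s1: "smooth_into G ?W (\<lambda>p. expo Y (fst p * \<phi> (snd p)))" by simp
    have s2: "smooth_into G ?W (\<lambda>p. \<alpha> (snd p))"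
      by (rule smooth_into_compose[OF oW W(1) _ W(4)])
        (auto intro!: smooth_on_bounded_linear oW bounded_linear_snd)
    have fs: "smooth_into G ?W f" unfolding f_def by (rule smooth_into_mult[OF oW s1 s2])
    have ac: "\<alpha> t \<in> carrier G" if "t \<in> W" for t by (rule smooth_intoD(1)[OF W(4) that])
    have Vf: "V y = f y <# H" if "y \<in> ?W" for y
      using that W(5) ac by (auto simp: V_def f_def left_coset_mult expoD)
    \<comment> \<open>Multiplying the lift on the left by \<open>expo Y (s * \<phi> \<tau>)\<close>
      gives the right velocity \<open>\<phi> \<tau> *\<^sub>R Y\<close>, in which the lift no longer
      occurs.\<close>
    have \<zeta>: "Ad G (f (0, \<tau>)) (lder f (0, \<tau>) (1, 0)) = \<phi> \<tau> *\<^sub>R Y" if "\<tau> \<in> W" for \<tau>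
    proof -
      have p: "(0, \<tau>) \<in> ?W" using that by simp
      have "has_lvel (\<lambda>s. expo Y (s * \<phi> \<tau>)) 0 (\<phi> \<tau> *\<^sub>R Y)"
        by (rule has_lvel_reparam) (use expo(2) in \<open>auto intro!: derivative_eq_intros\<close>)
      from has_lvel_mult_const[OF ac[OF that] this]
      have "has_lvel (\<lambda>s. f (s, \<tau>)) 0 (Ad G (inv (\<alpha> \<tau>)) (\<phi> \<tau> *\<^sub>R Y))" by (simp add: f_def)
      from has_lvel_unique[OF has_lvel_slices(2)[OF oW fs p] this]
      show ?thesis using ac[OF that] by (simp add: f_def expoD)
    qed
    have "((\<lambda>\<tau>. \<phi> \<tau> *\<^sub>R Y) has_vector_derivative (t0 + t1 - 2 * t) *\<^sub>R Y) (at t)"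
      unfolding \<phi>_def by (auto intro!: derivative_eq_intros simp: algebra_simps)
    moreover have "\<forall>\<^sub>F \<tau> in nhds t. \<tau> \<in> W" by (rule eventually_nhds_in_open[OF W(1,2)])
    then have "\<forall>\<^sub>F \<tau> in nhds t. \<phi> \<tau> *\<^sub>R Y = Ad G (f (0, \<tau>)) (lder f (0, \<tau>) (1, 0))"
      by eventually_elim (simp add: \<zeta>)
    ultimately have Z: "((\<lambda>\<tau>. Ad G (f (0, \<tau>)) (lder f (0, \<tau>) (1, 0))) has_vector_derivative (t0 + t1 - 2 * t) *\<^sub>R Y) (at t)"
      by (rule has_vector_derivative_ev_cong)
    have p: "(0, t) \<in> ?W" using W(2) by simp
    have ev: "\<forall>\<^sub>F \<tau> in nhds t. f (0, \<tau>) = \<alpha> \<tau>"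
      using eventually_nhds_in_open[OF W(1,2)] by eventually_elim (simp add: f_def expoD ac)
    from has_lvel_unique[OF has_lvel_cong[OF has_lvel_slices(1)[OF oW fs p] ev] has_lvel_smooth[OF W(1,4,2)]]
    have "lder f (0, t) (0, 1) = left_vel G \<alpha> t" .
    moreover have "f (0, t) = \<alpha> t" using ac[OF W(2)] by (simp add: f_def expoD)
    moreover have "mom c t = Ad G (\<alpha> t) (Abar (left_vel G \<alpha> t))"
      by (rule mom_eq[OF W(1,2,4,5)])
    ultimately have "frechet_derivative (sp V) (at (0, t)) (1, 0) = 2 * b (mom c t) ((t0 + t1 - 2 * t) *\<^sub>R Y)"
      using first_variation[where V=V, OF oW fs Vf p Z] by (simp only:)
    then have "frechet_derivative (sp V) (at (0, t)) (1, 0) = 2 * ((t0 + t1 - 2 * t) * b (mom c t) Y)"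
      by (simp add: b_simps)
    then show ?thesis using oW W(2,3) st fs Vf by (intro exI[of _ ?W] exI[of _ f]) auto
  qed
  have Vs: "smooth_into_quot G H ?D V"
    unfolding smooth_into_quot_def
  proof
    fix x assume "x \<in> ?D"
    then show "\<exists>W f. open W \<and> x \<in> W \<and> W \<subseteq> ?D \<and> smooth_into G W f \<and> (\<forall>y\<in>W. V y = f y <# H)"
      using lift[of "fst x" "snd x"] by auto
  qed
  have V0: "V (s, t) = c t" if "s * \<phi> t = 0" "t \<in> I" for s t
  proof -
    note tI = that(2)
    obtain W f where W: "open W" "t \<in> W" "W \<subseteq> I" "smooth_into G W f" "\<And>y. y \<in> W \<Longrightarrow> c y = f y <# H"
      by (rule quot_lift[OF c tI]) (rule that)
    then obtain a where a: "a \<in> carrier G" "c t = a <# H" using smooth_intoD(1)[OF W(4,2)] by blast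
    have "V (s, t) = expo Y (s * \<phi> t) <# (a <# H)" by (simp add: V_def a)
    also have "expo Y (s * \<phi> t) = \<one>" by (simp only: that(1) expoD)
    finally show ?thesis using a left_coset_mult[of \<one> a] by simp
  qed
  have "((\<lambda>s. energy G H mm gA t0 t1 (\<lambda>t. V (s, t))) has_real_derivative 0) (at 0)"
  proof -
    have 1: "\<forall>t\<in>I. V (0, t) = c t" using V0 by simp
    have 2: "\<forall>s\<in>{-1<..<1}. V (s, t0) = c t0 \<and> V (s, t1) = c t1" 
      using t by (intro ballI conjI V0) (auto simp: \<phi>_def)
    from geo have *: "\<forall>t0 t1 \<epsilon> V. t0 < t1 \<and> {t0..t1} \<subseteq> I \<and> \<epsilon> > 0 \<and>
        smooth_into_quot G H ({-\<epsilon><..<\<epsilon>} \<times> I) V \<and> (\<forall>t\<in>I. V (0, t) = c t) \<and>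
        (\<forall>s\<in>{-\<epsilon><..<\<epsilon>}. V (s, t0) = c t0 \<and> V (s, t1) = c t1) \<longrightarrow>
        ((\<lambda>s. energy G H mm gA t0 t1 (\<lambda>t. V (s, t))) has_real_derivative 0) (at 0)"
      unfolding geodesic_def by (elim conjE)
    show ?thesis by (rule *[rule_format, of t0 t1 1 V]) (intro conjI t Vs 1 2 zero_less_one)
  qed
  from DERIV_unique[OF energy_variation[OF I Vs zero_less_one t(2)] this]
  have "integral {t0..t1} (\<lambda>t. frechet_derivative (sp V) (at (0, t)) (1, 0)) = 0" by simp
  also have "integral {t0..t1} (\<lambda>t. frechet_derivative (sp V) (at (0, t)) (1, 0)) =
      integral {t0..t1} (\<lambda>t. 2 * ((t0 + t1 - 2 * t) * b (mom c t) Y))"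
  proof (rule integral_cong)
    fix t assume "t \<in> {t0..t1}"
    then have "(0, t) \<in> ?D" using t(2) by auto
    from lift[OF this] show "frechet_derivative (sp V) (at (0, t)) (1, 0) = 2 * ((t0 + t1 - 2 * t) * b (mom c t) Y)"
      by blast
  qed
  finally show ?thesis by simp
qed

text \<open>Each component \<open>b (mom c t) Y\<close> passes the quadratic tests, so its
  derivative vanishes; nondegeneracy of \<open>b\<close> gives the vector statement.\<close>

lemma geodesic_momentum_const:
  assumes geo: "geodesic G H mm gA I c"
  obtains P where "\<And>t. t \<in> I \<Longrightarrow> mom c t = P"
proof -
  have I: "open I" "convex I" and c: "smooth_into_quot G H I c"
    using geo is_interval_convex unfolding geodesic_def by blast+
  have ms: "smooth_on I (mom c)" by (rule mom_smooth[OF I(1) c])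
  have "(mom c has_derivative (\<lambda>h. 0)) (at t within I)" if t: "t \<in> I" for t
  proof -
    let ?m = "vector_derivative (mom c) (at t)"
    have m: "(mom c has_vector_derivative ?m) (at t)" by (rule smooth_on_vector_derivative(2)[OF I(1) ms t])
    have "b ?m Y = 0" for Y
    proof -
      have bl: "bounded_linear (\<lambda>X. b X Y)" by (rule bounded_bilinear.bounded_linear_left[OF bounded_bilinear_b])
      have fs: "smooth_on I (\<lambda>t. b (mom c t) Y)"
        by (rule smooth_on_bilinear[OF bounded_bilinear_b I(1) ms smooth_on_const[OF I(1)]])
      have "vector_derivative (\<lambda>t. b (mom c t) Y) (at t) = 0"
        by (rule zero_derivative_of_quadratic_tests[OF I(1) fs t geodesic_momentum_test[OF geo]])
      moreover have "((\<lambda>t. b (mom c t) Y) has_vector_derivative b ?m Y) (at t)"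
        by (rule bounded_linear.has_vector_derivative[OF bl m])
      ultimately show ?thesis using vector_derivative_at by metis
    qed
    then have "?m = 0" using b_zero by blast
    then show ?thesis using m unfolding has_vector_derivative_def by (simp add: has_derivative_at_withinI)
  qed
  from has_derivative_zero_constant[OF I(2) this] show ?thesis using that by blast
qed

end

section \<open>Geodesic orbit metrics\<close>

context invariant_metric
begin

section \<open>Scalar metric endomorphisms: geodesics as orbits\<close>

lemma normal_metric_GO:
  assumes sc: "scalar_on mm A"
  shows "GO_metric G H mm gA"
  unfolding GO_metric_def
proof (intro allI impI)
  fix I c assume geo: "geodesic G H mm gA I c"
  have I: "open I" "connected I" and c: "smooth_into_quot G H I c"
    using geo is_interval_connected unfolding geodesic_def by blast+
  \<comment> \<open>Positivity of \<open>A\<close> excludes the scalar 0 unless \<open>mm\<close> is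
    zero; there every scalar represents \<open>A\<close>, and 1 is taken.\<close>
  obtain \<kappa> where \<kappa>: "\<kappa> \<noteq> 0" "\<And>X. X \<in> mm \<Longrightarrow> A X = \<kappa> *\<^sub>R X"
  proof -
    obtain k where k: "\<And>X. X \<in> mm \<Longrightarrow> A X = k *\<^sub>R X" using sc unfolding scalar_on_def by blast
    show ?thesis
    proof (cases "mm = {0}")
      case True
      then show ?thesis using k[of 0] by (intro that[of 1]) auto
    next
      case False
      then obtain X where X: "X \<in> mm" "X \<noteq> 0" using subspace_0[OF subspace_orth] by blast
      have "b (k *\<^sub>R X) X > 0" using A_pos[OF X] k[OF X(1)] by simp
      then have "k \<noteq> 0" by (auto simp: b_simps)
      then show ?thesis using k by (rule that)
    qed
  qed
  have Abar: "Abar X = \<kappa> *\<^sub>R pm X" for X unfolding Abar_def by (rule \<kappa>(2)[OF pm(1)])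
  obtain P where P: "\<And>t. t \<in> I \<Longrightarrow> mom c t = P" by (rule geodesic_momentum_const[OF geo]) (rule that)
  define Q where "Q = (1 / \<kappa>) *\<^sub>R P"
  define \<gamma> where "\<gamma> = expo Q"
  have gD: "one_param_subgroup G \<gamma>" "has_lvel \<gamma> t Q" "\<gamma> t \<in> carrier G" "\<gamma> (- t) = inv (\<gamma> t)" for t
    unfolding \<gamma>_def using expo(1) one_param_subgroup_lvel[OF expo(1,2)] expoD by auto
  have loc: "\<forall>\<^sub>F t in nhds t0. \<gamma> (- t) <# c t = \<gamma> (- t0) <# c t0" if t0: "t0 \<in> I" for t0
  proof -
    obtain W \<alpha> where W: "open W" "t0 \<in> W" "W \<subseteq> I" "smooth_into G W \<alpha>" "\<And>y. y \<in> W \<Longrightarrow> c y = \<alpha> y <# H"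
      by (rule quot_lift[OF c t0]) (rule that)
    have ac: "\<alpha> t \<in> carrier G" if "t \<in> W" for t by (rule smooth_intoD(1)[OF W(4) that])
    \<comment> \<open>The left velocity of \<open>\<gamma> (- t) \<otimes> \<alpha> t\<close> loses
      exactly its \<open>mm\<close> part, because constancy of the momentum says that
      \<open>Ad G (inv (\<alpha> t)) Q\<close> is that part.\<close>
    have l: "has_lvel (\<lambda>t. \<gamma> (- t) \<otimes> \<alpha> t) t (left_vel G \<alpha> t - pm (left_vel G \<alpha> t))" if t: "t \<in> W" for t
    proof -
      have "has_lvel (\<lambda>t. \<gamma> (- t)) t ((- 1) *\<^sub>R Q)"
        by (rule has_lvel_reparam) (use gD(2) in \<open>auto intro!: derivative_eq_intros\<close>)
      from has_lvel_mult[OF this has_lvel_smooth[OF W(1,4) t]]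
      have "has_lvel (\<lambda>t. \<gamma> (- t) \<otimes> \<alpha> t) t (Ad G (inv (\<alpha> t)) (- Q) + left_vel G \<alpha> t)" by simp
      moreover have "Ad G (inv (\<alpha> t)) Q = pm (left_vel G \<alpha> t)"
      proof -
        have "P = Ad G (\<alpha> t) (\<kappa> *\<^sub>R pm (left_vel G \<alpha> t))"
          using P[of t] mom_eq[OF W(1) t W(4,5)] t W(3) Abar by auto
        then have "P = \<kappa> *\<^sub>R Ad G (\<alpha> t) (pm (left_vel G \<alpha> t))"
          by (simp add: linear_scale[OF linear_Ad[OF ac[OF t]]])
        then have "Q = Ad G (\<alpha> t) (pm (left_vel G \<alpha> t))" using \<kappa>(1) by (simp add: Q_def)
        then show ?thesis using ac[OF t] by simp
      qed
      ultimately show ?thesis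
        using ac[OF t] by (simp add: linear_neg[OF linear_Ad])
    qed
    have "\<forall>\<^sub>F t in nhds t0. (\<gamma> (- t) \<otimes> \<alpha> t) <# H = (\<gamma> (- t0) \<otimes> \<alpha> t0) <# H"
      by (rule vertical_curve_in_coset[OF W(1,2) l pm(2)])
    moreover have "\<forall>\<^sub>F t in nhds t0. t \<in> W" by (rule eventually_nhds_in_open[OF W(1,2)])
    ultimately show ?thesis
      by eventually_elim (use W(2,5) ac gD(3) in \<open>simp add: left_coset_mult\<close>)
  qed
  have cc: "\<exists>a\<in>carrier G. c t = a <# H" if "t \<in> I" for t
    using c that
  proof (rule quot_lift)
    fix W f assume "t \<in> W" "smooth_into G W f" "\<And>y. y \<in> W \<Longrightarrow> c y = f y <# H"
    then show ?thesis using smooth_intoD(1) by blast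
  qed
  show "\<exists>\<gamma> x. one_param_subgroup G \<gamma> \<and> x \<in> lcosets\<^bsub>G\<^esub> H \<and> (\<forall>t\<in>I. c t = \<gamma> t <# x)"
  proof (cases "I = {}")
    case True
    \<comment> \<open>An empty interval satisfies the definition of a geodesic, but a coset must
      still be provided.\<close>
    have "\<one> <# H \<in> lcosets H" unfolding LCOSETS_def by (intro UN_I[of \<one>]) simp_all
    with gD(1) show ?thesis by (intro exI[of _ \<gamma>] exI[of _ "\<one> <# H"]) (simp add: True)
  next
    case False
    then obtain t0 where t0: "t0 \<in> I" by blast
    define x where "x = \<gamma> (- t0) <# c t0"
    obtain a0 where "a0 \<in> carrier G" "c t0 = a0 <# H" using cc[OF t0] by blast
    then have "x \<in> lcosets H"
      unfolding x_def LCOSETS_def using left_coset_mult[OF gD(3)] gD(3)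
      by (intro UN_I[of "\<gamma> (- t0) \<otimes> a0"]) simp_all
    moreover have "c t = \<gamma> t <# x" if t: "t \<in> I" for t
    proof -
      have "\<gamma> (- t0) <# c t0 = \<gamma> (- t) <# c t"
      proof (rule connected_local_const[OF I(2) t0 t], rule ballI)
        fix s assume "s \<in> I"
        from loc[OF this] have "\<forall>\<^sub>F r in nhds s. \<gamma> (- s) <# c s = \<gamma> (- r) <# c r"
          by eventually_elim simp
        then show "\<forall>\<^sub>F r in at s within I. \<gamma> (- s) <# c s = \<gamma> (- r) <# c r"
          by (simp add: eventually_at_filter eventually_mono)
      qed
      moreover obtain a where a: "a \<in> carrier G" "c t = a <# H" using cc[OF t] by blast
      ultimately show ?thesis
        using gD(3,4)[of t] left_coset_mult[OF gD(3)[of "- t"] a(1)]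
          left_coset_mult[OF gD(3)[of t], of "\<gamma> (- t) \<otimes> a"] gD(3)[of "- t"]
        by (simp add: x_def)
    qed
    ultimately show ?thesis using gD(1) by (intro exI[of _ \<gamma>] exI[of _ x]) simp
  qed
qed

text \<open>If the momentum is a constant \<open>P\<close>, the first variation of the energy is the integral of the
  derivative of \<open>\<langle>P, \<zeta>\<rangle>\<close>, where \<open>\<zeta>\<close> is the right velocity of the variation. This function does not
  depend on the lift and vanishes where the variation is trivial.\<close>

lemma geodesic_of_const_momentum:
  assumes I: "open I" "is_interval I" and \<alpha>: "smooth_into G I \<alpha>"
    and P: "\<And>t. t \<in> I \<Longrightarrow> Ad G (\<alpha> t) (Abar (left_vel G \<alpha> t)) = P"
  shows "geodesic G H mm gA I (\<lambda>t. \<alpha> t <# H)"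
  unfolding geodesic_def
proof (intro conjI allI impI I)
  show "smooth_into_quot G H I (\<lambda>t. \<alpha> t <# H)"
    unfolding smooth_into_quot_def using I(1) \<alpha> by blast
  fix t0 t1 \<epsilon> :: real and V :: "real \<times> real \<Rightarrow> 'a set"
  assume *: "t0 < t1 \<and> {t0..t1} \<subseteq> I \<and> \<epsilon> > 0 \<and> smooth_into_quot G H ({-\<epsilon><..<\<epsilon>} \<times> I) V \<and>
        (\<forall>t\<in>I. V (0, t) = \<alpha> t <# H) \<and>
        (\<forall>s\<in>{-\<epsilon><..<\<epsilon>}. V (s, t0) = \<alpha> t0 <# H \<and> V (s, t1) = \<alpha> t1 <# H)"
  then have t: "t0 < t1" "{t0..t1} \<subseteq> I" and \<epsilon>: "\<epsilon> > 0"
    and V: "smooth_into_quot G H ({-\<epsilon><..<\<epsilon>} \<times> I) V"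
    and V0: "\<And>t. t \<in> I \<Longrightarrow> V (0, t) = \<alpha> t <# H"
    and Ve: "\<And>s. s \<in> {-\<epsilon><..<\<epsilon>} \<Longrightarrow> V (s, t0) = \<alpha> t0 <# H \<and> V (s, t1) = \<alpha> t1 <# H" by auto
  let ?D = "{-\<epsilon><..<\<epsilon>} \<times> I"
  define lft where "lft W f \<longleftrightarrow> open W \<and> W \<subseteq> ?D \<and> smooth_into G W f \<and> (\<forall>y\<in>W. V y = f y <# H)"
    for W :: "(real \<times> real) set" and f
  have lftD: "open W" "W \<subseteq> ?D" "smooth_into G W f" "\<And>y. y \<in> W \<Longrightarrow> V y = f y <# H" if "lft W f" for W f
    using that unfolding lft_def by auto
  define \<zeta> where "\<zeta> f t = Ad G (f (0, t)) (lder f (0, t) (1, 0))" for f :: "real \<times> real \<Rightarrow> 'a" and t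
  have ev1: "\<forall>\<^sub>F s in nhds 0. (s, t) \<in> W" and ev2: "\<forall>\<^sub>F \<tau> in nhds t. (0, \<tau>) \<in> W"
    if "open W" "(0, t) \<in> W" for W :: "(real \<times> real) set" and t
  proof -
    have "isCont (\<lambda>s. (s, t)) 0" "isCont (\<lambda>\<tau>. (0 :: real, \<tau>)) t" by (intro continuous_intros)+
    then show "\<forall>\<^sub>F s in nhds 0. (s, t) \<in> W" "\<forall>\<^sub>F \<tau> in nhds t. (0, \<tau>) \<in> W"
      using isCont_eventually_in_open[of 0 "\<lambda>s. (s, t)" W] isCont_eventually_in_open[of t "\<lambda>\<tau>. (0 :: real, \<tau>)" W] that
      by blast+
  qed
  \<comment> \<open>On the line \<open>s = 0\<close> the map \<open>f\<close> is a second lift of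
    the curve, so its momentum is again \<open>P\<close>.\<close>
  have PW: "Ad G (f (0, t)) (Abar (lder f (0, t) (0, 1))) = P" if f: "lft W f" and p: "(0, t) \<in> W" for W f t
  proof -
    note W = lftD[OF f]
    have tI: "t \<in> I" using W(2) p by blast
    have "\<forall>\<^sub>F \<tau> in nhds t. \<alpha> \<tau> <# H = f (0, \<tau>) <# H"
      using ev2[OF W(1) p]
    proof eventually_elim
      case (elim \<tau>)
      have "\<tau> \<in> I" using W(2) elim by blast
      from V0[OF this] W(4)[OF elim] show ?case by simp
    qed
    from momentum_lift(1)[OF has_lvel_smooth[OF I(1) \<alpha> tI] has_lvel_slices(1)[OF W(1,3) p] this]
    show ?thesis using P[OF tI] by simp
  qed
  \<comment> \<open>\<open>P\<close> is the image under \<open>Ad G (f (0, t))\<close> of an element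
    of \<open>mm\<close>, and \<open>Ad\<close> preserves \<open>b\<close>. Lift independence of
    \<open>J\<close> and its vanishing at the ends both rest on this orthogonality.\<close>
  have Pperp: "b P (Ad G (f (0, t)) Z) = 0" if f: "lft W f" "(0, t) \<in> W" and Z: "Z \<in> hh" for W f t Z
    unfolding PW[OF f, symmetric]
    using b_Ad[OF smooth_intoD(1)[OF lftD(3)[OF f(1)] f(2)]] hh_mm(2)[OF Z Abar_mm] by simp
  have indep: "b P (\<zeta> f t) = b P (\<zeta> f' t)" if f: "lft W f" "(0, t) \<in> W" and f': "lft W' f'" "(0, t) \<in> W'" for W f W' f' t
  proof -
    note W = lftD[OF f(1)] and W' = lftD[OF f'(1)]
    note ac = smooth_intoD(1)[OF W(3) f(2)] smooth_intoD(1)[OF W'(3) f'(2)]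
    have "\<forall>\<^sub>F s in nhds 0. f (s, t) <# H = f' (s, t) <# H"
      using ev1[OF W(1) f(2)] ev1[OF W'(1) f'(2)] 
    proof eventually_elim
      case (elim s)
      from W(4)[OF elim(1)] W'(4)[OF elim(2)] show ?case by simp
    qed
    from lift_change(2)[OF has_lvel_slices(2)[OF W(1,3) f(2)] has_lvel_slices(2)[OF W'(1,3) f'(2)] this]
    have "lder f' (0, t) (1, 0) - Ad G (inv (inv f (0, t) \<otimes> f' (0, t))) (lder f (0, t) (1, 0)) \<in> hh" .
    from Pperp[OF f' this]
    have "b P (\<zeta> f' t - Ad G (f' (0, t)) (Ad G (inv (inv f (0, t) \<otimes> f' (0, t))) (lder f (0, t) (1, 0)))) = 0"
      unfolding \<zeta>_def using ac by (simp add: linear_diff[OF linear_Ad])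
    moreover have "Ad G (f' (0, t)) (Ad G (inv (inv f (0, t) \<otimes> f' (0, t))) (lder f (0, t) (1, 0))) = \<zeta> f t"
      unfolding \<zeta>_def using ac by (simp add: inv_mult_group flip: Ad_mult)
    ultimately show ?thesis by (simp add: b_simps)
  qed
  \<comment> \<open>The choice patches the local functions \<open>b P (\<zeta> f t)\<close> into one
    primitive, on all of \<open>I\<close>, of half the first variation of the squared speed.\<close>
  define J where "J t = (SOME j. \<exists>W f. lft W f \<and> (0, t) \<in> W \<and> j = b P (\<zeta> f t))" for t
  have J: "J t = b P (\<zeta> f t)" if "lft W f" "(0, t) \<in> W" for W f t
    unfolding J_def
  proof (rule some_equality)
    show "\<exists>W f'. lft W f' \<and> (0, t) \<in> W \<and> b P (\<zeta> f t) = b P (\<zeta> f' t)" using that by blast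
    fix j assume "\<exists>W f. lft W f \<and> (0, t) \<in> W \<and> j = b P (\<zeta> f t)"
    then obtain W' f' where "lft W' f'" "(0, t) \<in> W'" "j = b P (\<zeta> f' t)" by blast
    then show "j = b P (\<zeta> f t)" using indep[OF _ _ that] by simp
  qed
  have lft_ex: "\<exists>W f. lft W f \<and> (0, t) \<in> W" if "t \<in> I" for t
  proof -
    have "(0, t) \<in> ?D" using that \<epsilon> by simp
    with V show ?thesis
    proof (rule quot_lift)
      fix W f assume "open W" "(0, t) \<in> W" "W \<subseteq> ?D" "smooth_into G W f" "\<And>y. y \<in> W \<Longrightarrow> V y = f y <# H"
      then show ?thesis unfolding lft_def by blast
    qed
  qed
  have J': "(J has_vector_derivative frechet_derivative (sp V) (at (0, t)) (1, 0) / 2) (at t)" if tI: "t \<in> I" for t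
  proof -
    obtain W f where f: "lft W f" "(0, t) \<in> W" using lft_ex[OF tI] by blast
    note W = lftD[OF f(1)]
    have "smooth_on W (\<lambda>p. Ad G (f p) (lder f p (1, 0)))"
      by (rule smooth_on_Ad_apply[OF W(1,3) lder_lemma(2)[OF W(1,3)]])
    from smooth_on_slices(2)[OF W(1) this f(2)] obtain Z where
      Z: "((\<lambda>\<tau>. Ad G (f (0, \<tau>)) (lder f (0, \<tau>) (1, 0))) has_vector_derivative Z) (at t)" by blast
    have bl: "bounded_linear (b P)" by (rule bounded_bilinear.bounded_linear_right[OF bounded_bilinear_b])
    from bounded_linear.has_vector_derivative[OF bl Z]
    have "((\<lambda>\<tau>. b P (\<zeta> f \<tau>)) has_vector_derivative b P Z) (at t)" unfolding \<zeta>_def .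
    moreover have "\<forall>\<^sub>F \<tau> in nhds t. b P (\<zeta> f \<tau>) = J \<tau>"
      using ev2[OF W(1) f(2)] by eventually_elim (simp add: J[OF f(1)])
    ultimately have "(J has_vector_derivative b P Z) (at t)" by (rule has_vector_derivative_ev_cong)
    moreover have "frechet_derivative (sp V) (at (0, t)) (1, 0) = 2 * b P Z"
      using first_variation[where V=V, OF W(1,3,4) f(2) Z] PW[OF f] by (simp only:)
    ultimately show ?thesis by simp
  qed
  \<comment> \<open>Where the variation is constant in \<open>s\<close>, the lift moves within one
    coset, so its velocity in direction \<open>s\<close> lies in \<open>hh\<close> and is invisible
    to \<open>P\<close>.\<close>
  have J0: "J t = 0" if tI: "t \<in> I" and e: "\<And>s. s \<in> {-\<epsilon><..<\<epsilon>} \<Longrightarrow> V (s, t) = \<alpha> t <# H" for t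
  proof -
    obtain W f where f: "lft W f" "(0, t) \<in> W" using lft_ex[OF tI] by blast
    note W = lftD[OF f(1)]
    have ac: "f p \<in> carrier G" if "p \<in> W" for p using smooth_intoD(1)[OF W(3) that] .
    have "\<forall>\<^sub>F s in nhds 0. inv f (0, t) \<otimes> f (s, t) \<in> H"
      using ev1[OF W(1) f(2)]
    proof eventually_elim
      case (elim s)
      have "f (0, t) <# H = f (s, t) <# H"
      proof -
        have "s \<in> {-\<epsilon><..<\<epsilon>}" "0 \<in> {-\<epsilon><..<\<epsilon>}" using W(2) elim f(2) by blast+
        from e[OF this(1)] e[OF this(2)] show ?thesis using W(4)[OF elim] W(4)[OF f(2)] by simp
      qed
      then show ?case using l_coset_eq_iff[OF ac[OF f(2)] ac[OF elim]] by blast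
    qed
    moreover have "has_lvel (\<lambda>s. inv f (0, t) \<otimes> f (s, t)) 0 (lder f (0, t) (1, 0))"
      by (intro has_lvel_cmult has_lvel_slices[OF W(1,3) f(2)]) (use ac[OF f(2)] in simp)
    ultimately have "lder f (0, t) (1, 0) \<in> hh" by (intro tangent_in_lie_algebra)
    from Pperp[OF f this] show ?thesis using J[OF f] by (simp add: \<zeta>_def)
  qed
  have "((\<lambda>t. frechet_derivative (sp V) (at (0, t)) (1, 0) / 2) has_integral J t1 - J t0) {t0..t1}"
  proof (rule fundamental_theorem_of_calculus)
    fix \<tau> assume "\<tau> \<in> {t0..t1}"
    then have "\<tau> \<in> I" using t(2) by blast
    from has_vector_derivative_at_within[OF J'[OF this]]
    show "(J has_vector_derivative frechet_derivative (sp V) (at (0, \<tau>)) (1, 0) / 2) (at \<tau> within {t0..t1})" .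
  qed (use t in simp)
  moreover have "J t0 = 0" "J t1 = 0" using t Ve by (auto intro!: J0)
  ultimately have "((\<lambda>t. frechet_derivative (sp V) (at (0, t)) (1, 0) / 2) has_integral 0) {t0..t1}" by simp
  then have "integral {t0..t1} (\<lambda>t. frechet_derivative (sp V) (at (0, t)) (1, 0) / 2) = 0"
    by (rule integral_unique)
  then have "integral {t0..t1} (\<lambda>t. frechet_derivative (sp V) (at (0, t)) (1, 0)) / 2 = 0"
    by simp
  with energy_variation[OF I(1) V \<epsilon> t(2)]
  show "((\<lambda>s. energy G H mm gA t0 t1 (\<lambda>t. V (s, t))) has_real_derivative 0) (at 0)" by simp
qed

text \<open>For \<open>Z\<close> in \<open>hh\<close>, \<open>ad Z\<close> is skew and commutes with
  the symmetric \<open>A\<close>, so \<open>b X (bracket G Z (A X))\<close> equals its own negative.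
  Consequently the Euler equation for the momentum preserves \<open>mm\<close>.\<close>

lemma bracket_Abar_mm:
  assumes "X \<in> mm"
  shows "bracket G (A X) X \<in> mm"
  unfolding orth_complement_def
proof (intro CollectI ballI)
  fix Z assume Z: "Z \<in> hh"
  have AX: "Abar X = A X" using assms by (simp add: Abar_def)
  have "b (bracket G (A X) X) Z = b X (bracket G Z (A X))"
    using b_bracket[of "A X" X Z] bracket_skew[of "A X" Z] by (simp add: b_simps)
  also have "\<dots> = b (A X) (bracket G Z X)"
    using Abar_bracket[OF Z, of X] Abar_sym[of X "bracket G Z X"] AX by simp
  also have "\<dots> = - b X (bracket G Z (A X))"
    using b_bracket[of Z "A X" X] b_sym by simp
  finally show "b (bracket G (A X) X) Z = 0"
    using b_bracket[of "A X" X Z] bracket_skew[of "A X" Z] by (simp add: b_simps)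
qed

text \<open>The geodesic with initial velocity \<open>X\<close> solves \<open>\<alpha>\<inverse> \<alpha>' = A\<inverse> N\<close>, \<open>N' = [N, A\<inverse> N]\<close>, \<open>N(0) = A X\<close>;
  the momentum \<open>Ad(\<alpha>) N\<close> is then constant.\<close>

lemma geodesic_curve_exists:
  assumes X: "X \<in> mm"
  obtains e \<alpha> u where "e > 0" "smooth_into G {-e<..<e} \<alpha>" "\<alpha> 0 = \<one>" "u 0 = X"
    "\<And>t. t \<in> {-e<..<e} \<Longrightarrow> has_lvel \<alpha> t (u t) \<and> u t \<in> mm \<and> Ad G (\<alpha> t) (A (u t)) = A X"
proof -
  \<comment> \<open>\<open>A\<close> acts on \<open>mm\<close> alone; completing it by the identity
    on \<open>hh\<close> gives an invertible map of the whole algebra, whose inverse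
    \<open>B\<close> restricts to the inverse of \<open>A\<close> on \<open>mm\<close>.\<close>
  define T where "T Y = Abar Y + (Y - pm Y)" for Y
  have linT: "linear T"
    unfolding T_def by (intro linear_compose_add linear_compose_sub linear_Abar linear_pm linear_ident)
  have TA: "T Y = A Y" if "Y \<in> mm" for Y using that by (simp add: T_def Abar_def)
  have Tmm: "Y \<in> mm" if "T Y \<in> mm" for Y
  proof -
    have "Y - pm Y = T Y - Abar Y" by (simp add: T_def)
    then have "Y - pm Y \<in> mm" using subspace_diff[OF subspace_orth that Abar_mm] by simp
    then have "Y - pm Y = 0" using hh_mm_zero pm(2) by blast
    then have "pm Y = Y" by (rule right_minus_eq[THEN iffD1, THEN sym])
    then show ?thesis using pm(1)[of Y] by simp
  qed
  have "inj T"
    unfolding linear_injective_0[OF linT]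
  proof (intro allI impI)
    fix Y assume Y: "T Y = 0"
    have "Y \<in> mm" by (rule Tmm) (simp add: Y subspace_0 subspace_orth)
    then show "Y = 0" using A_pos[of Y] TA[of Y] Y by (auto simp: b_simps)
  qed
  from linear_injective_isomorphism[OF linT this] obtain B where B: "linear B" "\<And>Y. T (B Y) = Y" "\<And>Y. B (T Y) = Y"
    by blast
  \<comment> \<open>The outer projection makes \<open>N - pm N\<close> constant, so that
    \<open>N\<close> stays in \<open>mm\<close>. Once this is known, \<open>bracket_Abar_mm\<close>
    shows that the projections change nothing and \<open>Q N\<close> is the bracket of
    \<open>N\<close> and \<open>B N\<close>.\<close>
  define Q where "Q N = pm (bracket G (pm N) (B N))" for N
  have Qs: "smooth_on UNIV Q"
    unfolding Q_def
    by (rule smooth_on_linear_compose[OF open_UNIV linear_pm smooth_on_bilinear[OF bounded_bilinear_bracket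
        open_UNIV smooth_on_linear[OF open_UNIV linear_pm] smooth_on_linear[OF open_UNIV B(1)]]])
  obtain e \<alpha> N where e: "e > 0" "smooth_into G {-e<..<e} \<alpha>" "\<alpha> 0 = \<one>" "N 0 = A X"
    and a: "\<And>t. t \<in> {-e<..<e} \<Longrightarrow> has_lvel \<alpha> t (B (N t))"
    and N: "\<And>t. t \<in> {-e<..<e} \<Longrightarrow> (N has_vector_derivative Q (N t)) (at t)"
    by (rule lie_ODE[OF B(1) Qs, of "A X"]) (rule that)
  have conv: "convex {-e<..<e}" and z: "0 \<in> {-e<..<e}" using e(1) by auto
  have blpm: "bounded_linear pm" using linear_pm linear_conv_bounded_linear by blast
  have Nmm: "N t \<in> mm" if t: "t \<in> {-e<..<e}" for t
  proof -
    have "((\<lambda>t. N t - pm (N t)) has_derivative (\<lambda>h. 0)) (at t within {-e<..<e})" if "t \<in> {-e<..<e}" for t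
    proof -
      have "((\<lambda>t. N t - pm (N t)) has_vector_derivative Q (N t) - pm (Q (N t))) (at t)"
        by (intro has_vector_derivative_diff bounded_linear.has_vector_derivative[OF blpm] N that)
      moreover have "Q (N t) - pm (Q (N t)) = 0" unfolding Q_def using pm(1) by simp
      ultimately show ?thesis unfolding has_vector_derivative_def by (simp add: has_derivative_at_withinI)
    qed
    from has_derivative_zero_constant[OF conv this] obtain k
      where k: "\<And>t. t \<in> {-e<..<e} \<Longrightarrow> N t - pm (N t) = k" by blast
    have "k = 0" using k[OF z] e(4) A_mm[OF X] by simp
    with k[OF t] have "pm (N t) = N t" by (metis right_minus_eq)
    then show ?thesis using pm(1)[of "N t"] by simp
  qed
  have Bmm: "B (N t) \<in> mm" "A (B (N t)) = N t" if "t \<in> {-e<..<e}" for t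
  proof -
    show "B (N t) \<in> mm" by (rule Tmm) (simp only: B(2) Nmm[OF that])
    then show "A (B (N t)) = N t" using TA[of "B (N t)"] B(2) by simp
  qed
  have QN: "Q (N t) = bracket G (N t) (B (N t))" if "t \<in> {-e<..<e}" for t
    using bracket_Abar_mm[OF Bmm(1)[OF that]] Bmm(2)[OF that] Nmm[OF that] by (simp add: Q_def)
  have mc: "Ad G (\<alpha> t) (N t) = A X" if t: "t \<in> {-e<..<e}" for t
  proof -
    have "((\<lambda>t. Ad G (\<alpha> t) (N t)) has_derivative (\<lambda>h. 0)) (at t within {-e<..<e})" if t: "t \<in> {-e<..<e}" for t
    proof -
      have ac: "\<alpha> t \<in> carrier G" by (rule has_lvel_carrier[OF a[OF t]])
      \<comment> \<open>\<open>Ad_deriv\<close> treats a fixed vector; expanding in the basis gives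
        the product rule for the moving vector \<open>N s\<close>.\<close>
      have ex: "(\<Sum>c\<in>Basis. (Y \<bullet> c) *\<^sub>R Ad G (\<alpha> s) c) = Ad G (\<alpha> s) Y" if "\<alpha> s \<in> carrier G" for s Y
        using linear_sum[OF linear_Ad[OF that], of "\<lambda>c. (Y \<bullet> c) *\<^sub>R c" Basis]
        by (simp add: linear_scale[OF linear_Ad[OF that]] euclidean_representation)
      have ex': "(\<Sum>c\<in>Basis. (Y \<bullet> c) *\<^sub>R Ad G (\<alpha> t) (bracket G Z c)) = Ad G (\<alpha> t) (bracket G Z Y)" for Y Z
        using linear_sum[OF linear_compose[OF linear_bracket_right linear_Ad[OF ac]], of Z "\<lambda>c. (Y \<bullet> c) *\<^sub>R c" Basis]
        by (simp add: linear_scale[OF linear_Ad[OF ac]] bracket_simps euclidean_representation)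
      have "((\<lambda>s. \<Sum>c\<in>Basis. (N s \<bullet> c) *\<^sub>R Ad G (\<alpha> s) c) has_vector_derivative
          (\<Sum>c\<in>Basis. (N t \<bullet> c) *\<^sub>R Ad G (\<alpha> t) (bracket G (B (N t)) c) + (Q (N t) \<bullet> c) *\<^sub>R Ad G (\<alpha> t) c)) (at t)"
        by (intro has_vector_derivative_sum bounded_bilinear.has_vector_derivative[OF bounded_bilinear_scaleR]
            Ad_deriv[OF a[OF t]] bounded_linear.has_vector_derivative[OF bounded_linear_inner_left N[OF t]])
      also have "(\<Sum>c\<in>Basis. (N t \<bullet> c) *\<^sub>R Ad G (\<alpha> t) (bracket G (B (N t)) c) + (Q (N t) \<bullet> c) *\<^sub>R Ad G (\<alpha> t) c)
          = Ad G (\<alpha> t) (bracket G (B (N t)) (N t)) + Ad G (\<alpha> t) (bracket G (N t) (B (N t)))"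
        by (simp add: sum.distrib ex ex' ac QN[OF t])
      also have "\<dots> = 0"
        unfolding bracket_skew[of "B (N t)" "N t"] by (simp add: linear_neg[OF linear_Ad[OF ac]])
      finally have "((\<lambda>s. \<Sum>c\<in>Basis. (N s \<bullet> c) *\<^sub>R Ad G (\<alpha> s) c) has_vector_derivative 0) (at t)" .
      then have "((\<lambda>s. Ad G (\<alpha> s) (N s)) has_vector_derivative 0) (at t)"
        by (rule has_vector_derivative_ev_cong)
          (use has_lvel_ev_carrier[OF a[OF t]] in \<open>eventually_elim; simp add: ex\<close>)
      then show ?thesis unfolding has_vector_derivative_def by (simp add: has_derivative_at_withinI)
    qed
    from has_derivative_zero_constant[OF conv this] obtain k
      where "\<And>t. t \<in> {-e<..<e} \<Longrightarrow> Ad G (\<alpha> t) (N t) = k" by blast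
    from this[OF t] this[OF z] show ?thesis using e(3,4) by (simp add: Ad_one)
  qed
  show ?thesis
  proof (rule that[of e \<alpha> "\<lambda>t. B (N t)"])
    show "B (N 0) = X" using B(3)[of X] TA[OF X] e(4) by simp
    show "has_lvel \<alpha> t (B (N t)) \<and> B (N t) \<in> mm \<and> Ad G (\<alpha> t) (A (B (N t))) = A X" if "t \<in> {-e<..<e}" for t
      using a[OF that] Bmm[OF that] mc[OF that] by simp
  qed (rule e)+
qed

text \<open>The geodesic with initial velocity \<open>X\<close> starts at the coset
  \<open>H\<close>, so it is \<open>\<gamma> t <# H\<close> for a one-parameter subgroup \<gamma>.
  Thus \<gamma> is another lift, with constant left velocity \<open>W\<close> and
  \<open>pm W = X\<close>. Its constant momentum is \<open>Ad G (\<gamma> t) (A X)\<close>, whose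
  derivative at 0 is the bracket of \<open>W\<close> and \<open>A X\<close>.\<close>

lemma GO_geodesic_lemma:
  assumes GO: "GO_metric G H mm gA" and X: "X \<in> mm"
  shows "\<exists>Z\<in>hh. bracket G (X + Z) (A X) = 0"
proof -
  obtain e \<alpha> u where e: "e > 0" "smooth_into G {-e<..<e} \<alpha>" "\<alpha> 0 = \<one>" "u 0 = X"
    and u: "\<And>t. t \<in> {-e<..<e} \<Longrightarrow> has_lvel \<alpha> t (u t) \<and> u t \<in> mm \<and> Ad G (\<alpha> t) (A (u t)) = A X"
    by (rule geodesic_curve_exists[OF X]) (rule that)
  let ?I = "{-e<..<e}"
  have Au: "Ad G (\<alpha> t) (Abar (u t)) = A X" if "t \<in> ?I" for t using u[OF that] by (simp add: Abar_def)
  have "geodesic G H mm gA ?I (\<lambda>t. \<alpha> t <# H)"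
  proof (rule geodesic_of_const_momentum[OF _ _ e(2)])
    show "open ?I" "is_interval ?I" by auto
    fix t assume t: "t \<in> ?I"
    have "left_vel G \<alpha> t = u t" by (rule has_lvel_left_vel[OF conjunct1[OF u[OF t]]])
    then show "Ad G (\<alpha> t) (Abar (left_vel G \<alpha> t)) = A X" using Au[OF t] by simp
  qed
  then obtain \<gamma> x where g: "one_param_subgroup G \<gamma>" "x \<in> lcosets H" "\<And>t. t \<in> ?I \<Longrightarrow> \<alpha> t <# H = \<gamma> t <# x"
    using GO unfolding GO_metric_def by blast
  note gD = one_param_subgroupD[OF g(1)]
  have z: "0 \<in> ?I" using e(1) by simp
  obtain a where a: "a \<in> carrier G" "x = a <# H" using g(2) unfolding LCOSETS_def by blast
  have "x = H"
    using g(3)[OF z] a gD(3) e(3) left_coset_mult[of \<one> a] lcos_mult_one[OF subgroup.subset[OF subH]] by simp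
  then have co: "\<alpha> t <# H = \<gamma> t <# H" if "t \<in> ?I" for t using g(3)[OF that] by simp
  obtain W where W0: "has_lvel \<gamma> 0 W" using has_lvel_smooth[OF open_UNIV gD(5) UNIV_I] by blast
  have W: "has_lvel \<gamma> t W" for t by (rule one_param_subgroup_lvel[OF g(1) W0])
  have ev: "\<forall>\<^sub>F s in nhds t. \<alpha> s <# H = \<gamma> s <# H" if "t \<in> ?I" for t
  proof -
    have "\<forall>\<^sub>F s in nhds t. s \<in> ?I" by (rule eventually_nhds_in_open[OF open_greaterThanLessThan that])
    then show ?thesis by eventually_elim (rule co)
  qed
  have "pm W = X"
    using lift_change(3)[OF conjunct1[OF u[OF z]] W ev[OF z]] e(3,4) gD(3) X by (simp add: Ad_one)
  then have AW: "Abar W = A X" by (simp add: Abar_def)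
  have const: "Ad G (\<gamma> t) (A X) = A X" if "t \<in> ?I" for t
    using momentum_lift(1)[OF conjunct1[OF u[OF that]] W ev[OF that]] AW Au[OF that] by simp
  have "\<forall>\<^sub>F s in nhds 0. s \<in> ?I" by (rule eventually_nhds_in_open[OF open_greaterThanLessThan z])
  then have "\<forall>\<^sub>F s in nhds 0. Ad G (\<gamma> s) (A X) = A X" by eventually_elim (rule const)
  from has_vector_derivative_ev_cong[OF Ad_deriv[OF W0, of "A X"] this]
  have "((\<lambda>s. A X) has_vector_derivative bracket G W (A X)) (at 0)" by (simp add: gD(3) Ad_one)
  from vector_derivative_unique_at[OF this has_vector_derivative_const]
  have "bracket G W (A X) = 0" .
  moreover have "W = X + (W - pm W)" using \<open>pm W = X\<close> by simp
  ultimately show ?thesis using pm(2)[of W] by metis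
qed

end

section \<open>Two generating subalgebras\<close>

context hom_space
begin

lemma b_bracket_cyclic: "b (bracket G X Y) Z = b X (bracket G Y Z)"
  using b_bracket[of Y X Z] bracket_skew[of X Y] by (simp add: b_simps)

lemma orth_decompE:
  assumes "subspace S"
  obtains P where "P \<in> S" "X - P \<in> orth_complement b S"
  using orth_decomp_exists[OF assms] by blast

lemma orth_complementD: "X \<in> orth_complement b S \<Longrightarrow> Y \<in> S \<Longrightarrow> b X Y = 0"
  unfolding orth_complement_def by blast

lemma orth_zero: "X \<in> S \<Longrightarrow> X \<in> orth_complement b S \<Longrightarrow> X = 0"
  using orth_complementD b_zero by blast

end

context invariant_metric
begin

text \<open>A maximum of the Rayleigh quotient of \<open>Abar\<close> with respect to
  \<open>b\<close>. The unit sphere of the coordinate norm serves as the compact set, since the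
  quotient does not change under scaling.\<close>

lemma eigenvector_exists:
  assumes S: "subspace S" "S \<noteq> {0}" and inv: "\<And>X. X \<in> S \<Longrightarrow> Abar X \<in> S"
  shows "\<exists>X c. X \<in> S \<and> X \<noteq> 0 \<and> Abar X = c *\<^sub>R X"
proof -
  define K where "K = S \<inter> sphere 0 1"
  have "compact K"
    unfolding K_def by (intro closed_Int_compact closed_subspace S compact_sphere)
  obtain Y where Y: "Y \<in> S" "Y \<noteq> 0" using S subspace_0[OF S(1)] by blast
  have nrm: "(1 / norm X) *\<^sub>R X \<in> K" if "X \<in> S" "X \<noteq> 0" for X
    unfolding K_def using that subspace_scale[OF S(1)] by simp
  have "K \<noteq> {}" using nrm[OF Y] by blast
  define R where "R X = b (Abar X) X / b X X" for X
  have pos: "b X X > 0" if "X \<in> K" for X using that by (intro b_pos) (auto simp: K_def)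
  have c1: "continuous_on K (\<lambda>X. b (Abar X) X)"
    by (intro bounded_bilinear.continuous_on[OF bounded_bilinear_b] linear_continuous_on bounded_linear_Abar continuous_on_id)
  have c2: "continuous_on K (\<lambda>X. b X X)"
    by (intro bounded_bilinear.continuous_on[OF bounded_bilinear_b] continuous_on_id)
  have "continuous_on K R"
    unfolding R_def by (rule continuous_on_divide[OF c1 c2]) (use pos in force)
  from continuous_attains_sup[OF \<open>compact K\<close> \<open>K \<noteq> {}\<close> this]
  obtain X0 where X0: "X0 \<in> K" "\<And>X. X \<in> K \<Longrightarrow> R X \<le> R X0" by blast
  define c where "c = R X0"
  define L where "L X = c *\<^sub>R X - Abar X" for X
  have linL: "L (X + Y) = L X + L Y" "L (r *\<^sub>R X) = r *\<^sub>R L X" for X Y r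
    unfolding L_def by (simp_all add: linear_add[OF linear_Abar] linear_scale[OF linear_Abar] algebra_simps)
  have symL: "b (L X) Y = b X (L Y)" for X Y
    unfolding L_def by (simp add: b_simps Abar_sym)
  have nonneg: "b (L X) X \<ge> 0" if "X \<in> S" for X
  proof (cases "X = 0")
    case False
    let ?r = "1 / norm X"
    have "R (?r *\<^sub>R X) \<le> c" unfolding c_def by (rule X0(2)[OF nrm[OF that False]])
    moreover have "R (?r *\<^sub>R X) = R X"
      unfolding R_def using False by (simp add: linear_scale[OF linear_Abar] b_simps)
    ultimately have "R X \<le> c" by (simp only:)
    then have "b (Abar X) X \<le> c * b X X"
      using b_pos[OF False] by (simp add: R_def divide_le_eq)
    then show ?thesis by (simp add: L_def b_simps)
  qed (simp add: b_simps)
  have S0: "X0 \<in> S" "X0 \<noteq> 0" using X0(1) by (auto simp: K_def)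
  have z: "b (L X0) X0 = 0"
    using b_pos[OF S0(2)] by (simp add: L_def b_simps c_def R_def)
  have LS: "L X0 \<in> S" unfolding L_def by (intro subspace_diff subspace_scale S inv S0)
  define v where "v = b (L X0) (L X0)"
  define w where "w = b (L (L X0)) (L X0)"
  have w: "w \<ge> 0" unfolding w_def by (rule nonneg[OF LS])
  \<comment> \<open>\<open>L\<close> is nonnegative on \<open>S\<close> with value 0 at
    \<open>X0\<close>. Moving from \<open>X0\<close> in direction \<open>L X0\<close> gives a
    nonnegative quadratic polynomial in \<open>t\<close> without constant term, so its linear
    coefficient \<open>2 * v\<close> must vanish.\<close>
  have q: "2 * t * v + t * t * w \<ge> 0" for t
  proof -
    have "0 \<le> b (L (X0 + t *\<^sub>R L X0)) (X0 + t *\<^sub>R L X0)"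
      by (intro nonneg subspace_add subspace_scale S S0 LS)
    also have "\<dots> = b (L X0) X0 + t * b (L X0) (L X0) + t * b (L (L X0)) X0 + t * t * w"
      by (simp add: linL b_simps w_def algebra_simps)
    also have "b (L (L X0)) X0 = v" unfolding v_def by (rule symL)
    finally show ?thesis using z by (simp add: v_def)
  qed
  have "v = 0"
  proof (rule ccontr)
    assume "v \<noteq> 0"
    then have "v > 0" using b_pos[of "L X0"] unfolding v_def by (cases "L X0 = 0") (auto simp: b_simps)
    \<comment> \<open>At \<open>- t\<close> the linear term outweighs the quadratic one; the divisor
      is \<open>w + 1\<close> because \<open>w\<close> may be 0.\<close>
    define t where "t = v / (w + 1)"
    have t: "t > 0" "t * (w + 1) = v" using \<open>v > 0\<close> w by (auto simp: t_def)
    have "0 \<le> t * (t * w - 2 * v)" using q[of "- t"] by (simp add: algebra_simps)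
    then have "2 * v \<le> t * w" using t(1) by (simp add: zero_le_mult_iff)
    moreover have "t * w \<le> t * (w + 1)" using t(1) by simp
    ultimately show False using t(2) \<open>v > 0\<close> by linarith
  qed
  then have "L X0 = 0" unfolding v_def by (rule b_zero)
  then have "Abar X0 = c *\<^sub>R X0" by (simp add: L_def)
  then show ?thesis using S0 by blast
qed

text \<open>The orthogonal complement, in \<open>S\<close>, of the span of the eigenvectors is
  invariant by symmetry; were it nonzero, it would contain an eigenvector, which is then orthogonal
  to itself.\<close>

lemma spectral_span:
  assumes S: "subspace S" and inv: "\<And>X. X \<in> S \<Longrightarrow> Abar X \<in> S"
  shows "S \<subseteq> span {X \<in> S. \<exists>c. Abar X = c *\<^sub>R X}"
proof
  fix X assume X: "X \<in> S"
  let ?E = "{X \<in> S. \<exists>c. Abar X = c *\<^sub>R X}"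
  have ES: "span ?E \<subseteq> S" by (rule span_minimal[OF _ S]) blast
  obtain P where P: "P \<in> span ?E" "X - P \<in> orth_complement b (span ?E)"
    by (rule orth_decompE[OF subspace_span]) (rule that)
  define T where "T = S \<inter> orth_complement b (span ?E)"
  have AE: "Abar Y \<in> span ?E" if "Y \<in> span ?E" for Y
  proof -
    have "subspace {Y. Abar Y \<in> span ?E}"
      unfolding subspace_def
      by (simp add: linear_0[OF linear_Abar] linear_add[OF linear_Abar] linear_scale[OF linear_Abar]
          span_0 span_add span_scale)
    moreover have "?E \<subseteq> {Y. Abar Y \<in> span ?E}"
    proof
      fix Y assume Y: "Y \<in> ?E"
      then obtain c where "Abar Y = c *\<^sub>R Y" by blast
      then show "Y \<in> {Y. Abar Y \<in> span ?E}" using span_scale[OF span_base[OF Y]] by simp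
    qed
    ultimately have "span ?E \<subseteq> {Y. Abar Y \<in> span ?E}" by (intro span_minimal)
    then show ?thesis using that by blast
  qed
  have "subspace T" unfolding T_def by (intro subspace_inter S subspace_orth)
  moreover have "Abar Y \<in> T" if "Y \<in> T" for Y
  proof -
    have "b (Abar Y) Z = 0" if "Z \<in> span ?E" for Z
      unfolding Abar_sym using orth_complementD[OF _ AE[OF that]] \<open>Y \<in> T\<close> by (simp add: T_def)
    then show ?thesis using that inv by (simp add: T_def orth_complement_def)
  qed
  moreover have "Y = 0" if "Y \<in> T" "Abar Y = c *\<^sub>R Y" for Y c
  proof -
    have "Y \<in> span ?E" using that by (intro span_base) (auto simp: T_def)
    then show ?thesis using orth_zero that(1) by (auto simp: T_def)
  qed
  ultimately have "T = {0}" using eigenvector_exists[of T] by blast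
  moreover have "X - P \<in> T" unfolding T_def using P ES X subspace_diff[OF S] by blast
  ultimately have "X = P" by simp
  then show "X \<in> span ?E" using P(1) by simp
qed

lemma scalar_of_eigenvectors:
  assumes S: "subspace S" and inv: "\<And>X. X \<in> S \<Longrightarrow> Abar X \<in> S"
    and ev: "\<And>X c. X \<in> S \<Longrightarrow> X \<noteq> 0 \<Longrightarrow> Abar X = c *\<^sub>R X \<Longrightarrow> c = k" and X: "X \<in> S"
  shows "Abar X = k *\<^sub>R X"
proof -
  have "subspace {X. Abar X = k *\<^sub>R X}"
    unfolding subspace_def
    by (simp add: linear_0[OF linear_Abar] linear_add[OF linear_Abar] linear_scale[OF linear_Abar] scaleR_add_right)
  moreover have "{X \<in> S. \<exists>c. Abar X = c *\<^sub>R X} \<subseteq> {X. Abar X = k *\<^sub>R X}"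
  proof
    fix Y assume "Y \<in> {X \<in> S. \<exists>c. Abar X = c *\<^sub>R X}"
    then obtain c where Y: "Y \<in> S" "Abar Y = c *\<^sub>R Y" by blast
    show "Y \<in> {X. Abar X = k *\<^sub>R X}"
      using ev[OF Y(1) _ Y(2)] Y(2) by (cases "Y = 0") auto
  qed
  ultimately have "span {X \<in> S. \<exists>c. Abar X = c *\<^sub>R X} \<subseteq> {X. Abar X = k *\<^sub>R X}" by (intro span_minimal)
  then show ?thesis using spectral_span[OF S inv] X by blast
qed

text \<open>For \<open>X + Y\<close> the geodesic condition reads
  \<open>[X + Y + Z, l X + k Y] = 0\<close>. Skew-symmetry collects the mixed terms into
  \<open>(k - l) [X, Y]\<close>, and \<open>l \<noteq> k\<close> allows division.\<close>

lemma GO_eigen_bracket: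
  assumes GO: "GO_metric G H mm gA" and X: "X \<in> mm" "Abar X = l *\<^sub>R X" and Y: "Y \<in> mm" "Abar Y = k *\<^sub>R Y"
    and "l \<noteq> k"
  shows "\<exists>Z\<in>hh. \<exists>Z'\<in>hh. bracket G X Y = bracket G Z X + bracket G Z' Y"
proof -
  have XY: "X + Y \<in> mm" by (intro subspace_add subspace_orth X Y)
  have "A (X + Y) = l *\<^sub>R X + k *\<^sub>R Y"
    using X Y XY linear_add[OF linear_Abar, of X Y] by (simp add: Abar_def)
  with GO_geodesic_lemma[OF GO XY] obtain Z where Z: "Z \<in> hh" "bracket G (X + Y + Z) (l *\<^sub>R X + k *\<^sub>R Y) = 0"
    by auto
  have "(l - k) *\<^sub>R bracket G X Y = l *\<^sub>R bracket G Z X + k *\<^sub>R bracket G Z Y"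
    using Z(2) bracket_skew[of Y X] by (simp add: bracket_simps bracket_self algebra_simps)
  then have "bracket G X Y = (1 / (l - k)) *\<^sub>R (l *\<^sub>R bracket G Z X + k *\<^sub>R bracket G Z Y)"
    using assms(6) by (metis (no_types, lifting) eq_iff_diff_eq_0 nonzero_divide_eq_eq scaleR_one scaleR_scaleR)
  then have "bracket G X Y = bracket G ((l / (l - k)) *\<^sub>R Z) X + bracket G ((k / (l - k)) *\<^sub>R Z) Y"
    by (simp add: bracket_simps scaleR_add_right)
  then show ?thesis using subspace_scale[OF subspace_lie_algebra Z(1)] by blast
qed

end

locale splitting = hom_space G H b for G :: "('a::t2_space, 'e::euclidean_space) lie_structure" (structure)
    and H :: "'a set" and b :: "'e \<Rightarrow> 'e \<Rightarrow> real" +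
  fixes kk kk' qq p1 p2 nn :: "'e set"
  assumes kk: "lie_subalgebra G kk" "lie_subalgebra G kk'" "kk \<noteq> UNIV" "kk' \<noteq> UNIV"
    and hh_kk: "lie_algebra_of G H \<subseteq> kk" "lie_algebra_of G H \<subseteq> kk'"
    and gen: "generate_lie_algebra G (kk \<union> kk')"
    and qq: "qq = (kk \<inter> orth_complement b (lie_algebra_of G H)) \<inter> (kk' \<inter> orth_complement b (lie_algebra_of G H))"
    and od1: "orth_decomposition b (kk \<inter> orth_complement b (lie_algebra_of G H)) [qq, p1]"
    and od2: "orth_decomposition b (kk' \<inter> orth_complement b (lie_algebra_of G H)) [qq, p2]"
    and nn: "nn = orth_complement b (lie_algebra_of G H) \<inter>
      orth_complement b ((kk \<inter> orth_complement b (lie_algebra_of G H)) \<union> (kk' \<inter> orth_complement b (lie_algebra_of G H)))"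
    and od: "orth_decomposition b (orth_complement b (lie_algebra_of G H)) [qq, p1, p2, nn]"
    and nocomm: "\<not> (\<exists>P1 P2. P1 \<subseteq> p1 \<and> P2 \<subseteq> p2 \<and> P1 \<noteq> {0} \<and> P2 \<noteq> {0} \<and>
            ad_submodule G (span (lie_algebra_of G H \<union> qq)) P1 \<and> ad_submodule G (span (lie_algebra_of G H \<union> qq)) P2 \<and>
            (\<forall>X\<in>P1. \<forall>Y\<in>P2. bracket G X Y = 0))"
begin

section \<open>The orthogonal pieces and their behaviour under brackets\<close>

lemma sub: "subspace kk" "subspace kk'" "subspace qq" "subspace p1" "subspace p2" "subspace nn"
  using kk(1,2) od unfolding lie_subalgebra_def orth_decomposition_def by auto

lemma bracket_kk: "X \<in> kk \<Longrightarrow> Y \<in> kk \<Longrightarrow> bracket G X Y \<in> kk"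
  "X \<in> kk' \<Longrightarrow> Y \<in> kk' \<Longrightarrow> bracket G X Y \<in> kk'"
  using kk(1,2) unfolding lie_subalgebra_def by auto

lemma orth: "X \<in> qq \<Longrightarrow> Y \<in> p1 \<Longrightarrow> b X Y = 0" "X \<in> qq \<Longrightarrow> Y \<in> p2 \<Longrightarrow> b X Y = 0"
  "X \<in> qq \<Longrightarrow> Y \<in> nn \<Longrightarrow> b X Y = 0" "X \<in> p1 \<Longrightarrow> Y \<in> p2 \<Longrightarrow> b X Y = 0"
  "X \<in> p1 \<Longrightarrow> Y \<in> nn \<Longrightarrow> b X Y = 0" "X \<in> p2 \<Longrightarrow> Y \<in> nn \<Longrightarrow> b X Y = 0"
proof -
  have *: "\<forall>X\<in>[qq, p1, p2, nn] ! i. \<forall>Y\<in>[qq, p1, p2, nn] ! j. b X Y = 0"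
    if "i < length [qq, p1, p2, nn]" "j < length [qq, p1, p2, nn]" "i \<noteq> j" for i j
    using od that unfolding orth_decomposition_def by blast
  show "X \<in> qq \<Longrightarrow> Y \<in> p1 \<Longrightarrow> b X Y = 0" using *[of 0 1] by simp
  show "X \<in> qq \<Longrightarrow> Y \<in> p2 \<Longrightarrow> b X Y = 0" using *[of 0 2] by simp
  show "X \<in> qq \<Longrightarrow> Y \<in> nn \<Longrightarrow> b X Y = 0" using *[of 0 3] by simp
  show "X \<in> p1 \<Longrightarrow> Y \<in> p2 \<Longrightarrow> b X Y = 0" using *[of 1 2] by simp
  show "X \<in> p1 \<Longrightarrow> Y \<in> nn \<Longrightarrow> b X Y = 0" using *[of 1 3] by simp
  show "X \<in> p2 \<Longrightarrow> Y \<in> nn \<Longrightarrow> b X Y = 0" using *[of 2 3] by simp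
qed

lemma span_kk: "kk \<inter> mm = span (qq \<union> p1)" "kk' \<inter> mm = span (qq \<union> p2)"
  and span_mm: "mm = span (qq \<union> (p1 \<union> (p2 \<union> nn)))"
  using od1 od2 od unfolding orth_decomposition_def by (simp_all add: Un_assoc)

lemma kkE: "X \<in> kk \<inter> mm \<Longrightarrow> \<exists>Q\<in>qq. \<exists>Y\<in>p1. X = Q + Y" "X \<in> kk' \<inter> mm \<Longrightarrow> \<exists>Q\<in>qq. \<exists>Y\<in>p2. X = Q + Y"
proof -
  have *: "\<exists>Q\<in>S. \<exists>Y\<in>T. X = Q + Y" if "X \<in> span (S \<union> T)" "subspace S" "subspace T" for S T :: "'e set"
    using that(1) unfolding span_Un span_eq_iff[THEN iffD2, OF that(2)] span_eq_iff[THEN iffD2, OF that(3)] by blast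
  show "X \<in> kk \<inter> mm \<Longrightarrow> \<exists>Q\<in>qq. \<exists>Y\<in>p1. X = Q + Y" "X \<in> kk' \<inter> mm \<Longrightarrow> \<exists>Q\<in>qq. \<exists>Y\<in>p2. X = Q + Y"
    unfolding span_kk by (rule *; use sub in simp)+
qed

lemma mmE: "X \<in> mm \<Longrightarrow> \<exists>Q\<in>qq. \<exists>X1\<in>p1. \<exists>X2\<in>p2. \<exists>N\<in>nn. X = Q + (X1 + (X2 + N))"
proof -
  assume "X \<in> mm"
  then have "X \<in> span (qq \<union> (p1 \<union> (p2 \<union> nn)))" by (simp only: span_mm)
  then show ?thesis
    unfolding span_Un sub(3-6)[THEN span_eq_iff[THEN iffD2]] by blast
qed

lemma pieces: "qq \<subseteq> kk" "qq \<subseteq> kk'" "p1 \<subseteq> kk" "p2 \<subseteq> kk'" "qq \<subseteq> mm" "p1 \<subseteq> mm" "p2 \<subseteq> mm" "nn \<subseteq> mm"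
proof -
  show "qq \<subseteq> kk" "qq \<subseteq> kk'" "qq \<subseteq> mm" using qq by auto
  have "p1 \<subseteq> kk \<inter> mm" "p2 \<subseteq> kk' \<inter> mm" unfolding span_kk by (auto intro: span_base)
  then show "p1 \<subseteq> kk" "p2 \<subseteq> kk'" "p1 \<subseteq> mm" "p2 \<subseteq> mm" by auto
  show "nn \<subseteq> mm" using nn by auto
qed

text \<open>The algebra \<open>\<hh> + \<qq>\<close>, written as an intersection so that closure
  under brackets is immediate; \<open>LL_span\<close> is the link to the submodules in the
  hypothesis.\<close>

abbreviation LL :: "'e set" where "LL \<equiv> kk \<inter> kk'"

lemma pm_kk: "X \<in> kk \<Longrightarrow> pm X \<in> kk \<inter> mm" "X \<in> kk' \<Longrightarrow> pm X \<in> kk' \<inter> mm"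
proof -
  have "X - (X - pm X) \<in> S" if "X \<in> S" "subspace S" "hh \<subseteq> S" for S
    using subspace_diff[OF that(2,1), of "X - pm X"] that(3) pm(2)[of X] by blast
  then show "X \<in> kk \<Longrightarrow> pm X \<in> kk \<inter> mm" "X \<in> kk' \<Longrightarrow> pm X \<in> kk' \<inter> mm"
    using sub(1,2) hh_kk pm(1) by auto
qed

lemma b_split: "X \<in> mm \<Longrightarrow> b X V = b X (pm V)"
  by (rule b_pm(2)[symmetric])

text \<open>Each piece lies in \<open>mm\<close>, so only the projection of the second argument
  matters, and that projection splits into pieces orthogonal to the first argument.\<close>

lemma perp: "X \<in> p1 \<Longrightarrow> V \<in> kk' \<Longrightarrow> b X V = 0" "Y \<in> p2 \<Longrightarrow> V' \<in> kk \<Longrightarrow> b Y V' = 0"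
  "N \<in> nn \<Longrightarrow> V' \<in> kk \<Longrightarrow> b N V' = 0" "N \<in> nn \<Longrightarrow> V \<in> kk' \<Longrightarrow> b N V = 0"
proof -
  show "b X V = 0" if X: "X \<in> p1" and V: "V \<in> kk'"
  proof -
    have Xm: "X \<in> mm" using X pieces by blast
    obtain Q Y where "Q \<in> qq" "Y \<in> p2" "pm V = Q + Y" using kkE(2)[OF pm_kk(2)[OF V]] by blast
    then show ?thesis using b_split[OF Xm, of V] orth(4)[OF X] orth(1)[OF _ X] by (simp add: b_simps b_sym[of X])
  qed
  show "b Y V' = 0" if X: "Y \<in> p2" and V: "V' \<in> kk"
  proof -
    have Xm: "Y \<in> mm" using X pieces by blast
    obtain Q Z where "Q \<in> qq" "Z \<in> p1" "pm V' = Q + Z" using kkE(1)[OF pm_kk(1)[OF V]] by blast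
    then show ?thesis using b_split[OF Xm, of V'] orth(4)[OF _ X] orth(2)[OF _ X] by (simp add: b_simps b_sym[of Y])
  qed
  have *: "b N V = 0" if N: "N \<in> nn" and V: "pm V \<in> kk \<inter> mm \<union> kk' \<inter> mm" for V
  proof -
    have "N \<in> mm" "N \<in> orth_complement b (kk \<inter> mm \<union> kk' \<inter> mm)" using N unfolding nn by simp_all
    from b_split[OF this(1), of V] orth_complementD[OF this(2) V] show ?thesis by simp
  qed
  show "b N V' = 0" if "N \<in> nn" "V' \<in> kk" using *[OF that(1)] pm_kk(1)[OF that(2)] by blast
  show "b N V = 0" if "N \<in> nn" "V \<in> kk'" using *[OF that(1)] pm_kk(2)[OF that(2)] by blast
qed

lemma perp_LL: "X \<in> p1 \<or> X \<in> p2 \<or> X \<in> nn \<Longrightarrow> V \<in> LL \<Longrightarrow> b X V = 0"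
  using perp by blast

text \<open>Recognises \<open>p1\<close> as the complement of \<open>LL\<close> in
  \<open>kk\<close>, a description that skewness of \<open>ad\<close> can transport.\<close>

lemma p1I: "X \<in> kk \<Longrightarrow> (\<And>V. V \<in> LL \<Longrightarrow> b X V = 0) \<Longrightarrow> X \<in> p1"
proof -
  assume X: "X \<in> kk" "\<And>V. V \<in> LL \<Longrightarrow> b X V = 0"
  then have "X \<in> mm" using hh_kk unfolding orth_complement_def by blast
  then obtain Q Y where QY: "Q \<in> qq" "Y \<in> p1" "X = Q + Y" using kkE(1) X(1) by blast
  have "b Q Q = 0" using X(2)[of Q] QY orth(1)[OF QY(1,2)] pieces by (auto simp: b_simps b_sym[of Y])
  then have "Q = 0" by (rule b_zero)
  then show "X \<in> p1" using QY by simp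
qed

lemma p2I: "X \<in> kk' \<Longrightarrow> (\<And>V. V \<in> LL \<Longrightarrow> b X V = 0) \<Longrightarrow> X \<in> p2"
proof -
  assume X: "X \<in> kk'" "\<And>V. V \<in> LL \<Longrightarrow> b X V = 0"
  then have "X \<in> mm" using hh_kk unfolding orth_complement_def by blast
  then obtain Q Y where QY: "Q \<in> qq" "Y \<in> p2" "X = Q + Y" using kkE(2) X(1) by blast
  have "b Q Q = 0" using X(2)[of Q] QY orth(2)[OF QY(1,2)] pieces by (auto simp: b_simps b_sym[of Y])
  then have "Q = 0" by (rule b_zero)
  then show "X \<in> p2" using QY by simp
qed

lemma nnI: "(\<And>V. V \<in> kk \<Longrightarrow> b X V = 0) \<Longrightarrow> (\<And>V. V \<in> kk' \<Longrightarrow> b X V = 0) \<Longrightarrow> X \<in> nn"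
  unfolding nn orth_complement_def using hh_kk by blast

text \<open>\<open>ad W\<close> preserves \<open>kk\<close>, \<open>kk'\<close> and
  \<open>LL\<close>, and being skew it preserves the orthogonal complements that define the
  pieces.\<close>

lemma LL_ad:
  assumes W: "W \<in> LL"
  shows "X \<in> p1 \<Longrightarrow> bracket G W X \<in> p1" "X \<in> p2 \<Longrightarrow> bracket G W X \<in> p2" "X \<in> nn \<Longrightarrow> bracket G W X \<in> nn"
proof -
  show "bracket G W X \<in> p1" if X: "X \<in> p1"
  proof (rule p1I)
    show "bracket G W X \<in> kk" using W X pieces by (intro bracket_kk) auto
    show "b (bracket G W X) V = 0" if "V \<in> LL" for V
      using W X that by (simp add: b_bracket perp_LL bracket_kk)
  qed
  show "bracket G W X \<in> p2" if X: "X \<in> p2"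
  proof (rule p2I)
    show "bracket G W X \<in> kk'" using W X pieces by (intro bracket_kk) auto
    show "b (bracket G W X) V = 0" if "V \<in> LL" for V
      using W X that by (simp add: b_bracket perp_LL bracket_kk)
  qed
  show "bracket G W X \<in> nn" if X: "X \<in> nn"
    by (rule nnI) (use W X in \<open>simp_all add: b_bracket perp bracket_kk\<close>)
qed

lemma LL_span: "span (hh \<union> qq) \<subseteq> LL"
  using hh_kk pieces by (intro span_minimal subspace_inter sub) auto

text \<open>If one of the pieces vanished, one subalgebra would contain the other and so, as they
  generate, be everything. Nonzero pieces supply the eigenvectors with which all eigenvalues are
  compared.\<close>

lemma p1_nonzero: "p1 \<noteq> {0}" and p2_nonzero: "p2 \<noteq> {0}"
proof -
  have split: "X = (X - pm X) + pm X" for X by simp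
  show "p1 \<noteq> {0}"
  proof
    assume z: "p1 = {0}"
    have "kk \<subseteq> kk'"
    proof
      fix X assume X: "X \<in> kk"
      obtain Q where "Q \<in> qq" "pm X = Q" using kkE(1)[OF pm_kk(1)[OF X]] z by auto
      then have "pm X \<in> kk'" using pieces by blast
      then show "X \<in> kk'" using split[of X] subspace_add[OF sub(2)] hh_kk(2) pm(2)[of X] by (metis subsetD)
    qed
    then show False using gen kk(2,4) unfolding generate_lie_algebra_def by blast
  qed
  show "p2 \<noteq> {0}"
  proof
    assume z: "p2 = {0}"
    have "kk' \<subseteq> kk"
    proof
      fix X assume X: "X \<in> kk'"
      obtain Q where "Q \<in> qq" "pm X = Q" using kkE(2)[OF pm_kk(2)[OF X]] z by auto
      then have "pm X \<in> kk" using pieces by blast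
      then show "X \<in> kk" using split[of X] subspace_add[OF sub(1)] hh_kk(1) pm(2)[of X] by (metis subsetD)
    qed
    then show False using gen kk(1,3) unfolding generate_lie_algebra_def by blast
  qed
qed

lemma generated: "lie_subalgebra G S \<Longrightarrow> kk \<subseteq> S \<Longrightarrow> kk' \<subseteq> S \<Longrightarrow> S = UNIV"
  using gen unfolding generate_lie_algebra_def by blast

end

locale splitting_metric = splitting G H b kk kk' qq p1 p2 nn + invariant_metric G H b A
  for G :: "('a::t2_space, 'e::euclidean_space) lie_structure" (structure)
    and H :: "'a set" and b :: "'e \<Rightarrow> 'e \<Rightarrow> real" and kk kk' qq p1 p2 nn A
begin

section \<open>Eigenspaces of a geodesic orbit metric\<close>

context
  assumes GO: "GO_metric G H mm gA"
begin

text \<open>The defect \<open>D\<close> of \<open>bracket G W X\<close> from being an eigenvector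
  lies in \<open>S\<close>, so it suffices to pair it with eigenvectors \<open>Y\<close> of
  \<open>S\<close>, which span. Equal eigenvalues give 0 by symmetry; for different ones the pairing
  is a multiple of \<open>b W (bracket G X Y)\<close>, and \<open>bracket G X Y\<close> lies in
  \<open>S\<close> by the geodesic condition.\<close>

lemma eigenspace_LL_submodule:
  assumes S: "subspace S" "S \<subseteq> mm" and inv: "\<And>X. X \<in> S \<Longrightarrow> Abar X \<in> S"
    and ad: "\<And>W X. W \<in> LL \<Longrightarrow> X \<in> S \<Longrightarrow> bracket G W X \<in> S"
    and pp: "\<And>V X. V \<in> LL \<Longrightarrow> X \<in> S \<Longrightarrow> b X V = 0"
    and W: "W \<in> LL" and X: "X \<in> S" "Abar X = l *\<^sub>R X"
  shows "Abar (bracket G W X) = l *\<^sub>R bracket G W X"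
proof -
  let ?V = "bracket G W X"
  define D where "D = Abar ?V - l *\<^sub>R ?V"
  have VS: "?V \<in> S" by (rule ad[OF W X(1)])
  have DS: "D \<in> S" unfolding D_def by (intro subspace_diff subspace_scale S inv VS)
  have D0: "b D Y = 0" if Y: "Y \<in> S" "Abar Y = k *\<^sub>R Y" for Y k
  proof -
    have DY: "b D Y = (k - l) * b ?V Y" unfolding D_def by (simp add: b_simps Abar_sym Y algebra_simps)
    show ?thesis
    proof (cases "l = k")
      case False
      obtain Z Z' where Z: "Z \<in> hh" "Z' \<in> hh" "bracket G X Y = bracket G Z X + bracket G Z' Y"
        using GO_eigen_bracket[OF GO _ X(2) _ Y(2) False] S(2) X(1) Y(1) by blast
      have "bracket G X Y \<in> S"
        unfolding Z(3) using Z hh_kk by (intro subspace_add S ad X Y) auto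
      then have "b (bracket G X Y) W = 0" by (rule pp[OF W])
      then have "b ?V Y = 0" using b_bracket_cyclic[of W X Y] b_sym[of W "bracket G X Y"] by (simp only:)
      then show ?thesis using DY by simp
    qed (use DY in simp)
  qed
  have "subspace {Y. b D Y = 0}" unfolding subspace_def by (simp add: b_simps)
  then have "span {X \<in> S. \<exists>c. Abar X = c *\<^sub>R X} \<subseteq> {Y. b D Y = 0}"
    by (rule span_minimal[rotated]) (use D0 in blast)
  then have "b D D = 0" using spectral_span[OF S(1) inv] DS by blast
  then have "D = 0" by (rule b_zero)
  then show ?thesis by (simp add: D_def)
qed

context
  assumes pres: "A ` p1 \<subseteq> p1" "A ` p2 \<subseteq> p2" "A ` nn \<subseteq> nn"
begin

lemma Abar_pres: "X \<in> p1 \<Longrightarrow> Abar X \<in> p1" "X \<in> p2 \<Longrightarrow> Abar X \<in> p2" "X \<in> nn \<Longrightarrow> Abar X \<in> nn"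
proof -
  have "X \<in> S \<Longrightarrow> Abar X \<in> S" if "A ` S \<subseteq> S" "S \<subseteq> mm" for S
    using that by (auto simp: Abar_def subset_iff)
  then show "X \<in> p1 \<Longrightarrow> Abar X \<in> p1" "X \<in> p2 \<Longrightarrow> Abar X \<in> p2" "X \<in> nn \<Longrightarrow> Abar X \<in> nn"
    using pres pieces by blast+
qed

lemma eigen_submodules:
  assumes W: "W \<in> LL"
  shows "X \<in> p1 \<Longrightarrow> Abar X = l *\<^sub>R X \<Longrightarrow> Abar (bracket G W X) = l *\<^sub>R bracket G W X"
    "X \<in> p2 \<Longrightarrow> Abar X = l *\<^sub>R X \<Longrightarrow> Abar (bracket G W X) = l *\<^sub>R bracket G W X"
    "X \<in> nn \<Longrightarrow> Abar X = l *\<^sub>R X \<Longrightarrow> Abar (bracket G W X) = l *\<^sub>R bracket G W X"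
  using eigenspace_LL_submodule[OF sub(4) pieces(6) Abar_pres(1) LL_ad(1) perp_LL W]
    eigenspace_LL_submodule[OF sub(5) pieces(7) Abar_pres(2) LL_ad(2) perp_LL W]
    eigenspace_LL_submodule[OF sub(6) pieces(8) Abar_pres(3) LL_ad(3) perp_LL W]
  by blast+

text \<open>The geodesic condition puts \<open>bracket G X Y\<close> into \<open>p1 + p2\<close>.
  Its product with the \<open>p1\<close> part pairs \<open>Y\<close> with an element of
  \<open>kk\<close>, and its product with the \<open>p2\<close> part pairs \<open>X\<close> with an
  element of \<open>kk'\<close>; both vanish, so the bracket is orthogonal to itself.\<close>

lemma commuting_eigenvectors:
  assumes X: "X \<in> p1" "Abar X = l *\<^sub>R X" and Y: "Y \<in> p2" "Abar Y = k *\<^sub>R Y" and "l \<noteq> k"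
  shows "bracket G X Y = 0"
proof -
  obtain Z Z' where Z: "Z \<in> hh" "Z' \<in> hh" "bracket G X Y = bracket G Z X + bracket G Z' Y"
    using GO_eigen_bracket[OF GO _ X(2) _ Y(2) assms(5)] X(1) Y(1) pieces by blast
  have ZL: "Z \<in> LL" "Z' \<in> LL" using Z hh_kk by auto
  have U1: "bracket G Z X \<in> p1" and U2: "bracket G Z' Y \<in> p2" using LL_ad ZL X Y by auto
  have "b (bracket G X Y) (bracket G Z X) = 0"
    unfolding b_bracket using perp(2)[OF Y(1) bracket_kk(1)] U1 X(1) pieces by (simp add: subset_iff)
  moreover have "b (bracket G X Y) (bracket G Z' Y) = 0"
    unfolding b_bracket_cyclic using perp(1)[OF X(1) bracket_kk(2)] U2 Y(1) pieces by (simp add: subset_iff)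
  ultimately have "b (bracket G X Y) (bracket G X Y) = 0"
    using Z(3) by (metis b_simps(2) add_0)
  then show ?thesis by (rule b_zero)
qed

lemma equal_eigenvalues:
  assumes X: "X \<in> p1" "X \<noteq> 0" "Abar X = l *\<^sub>R X" and Y: "Y \<in> p2" "Y \<noteq> 0" "Abar Y = k *\<^sub>R Y"
  shows "l = k"
proof (rule ccontr)
  assume ne: "l \<noteq> k"
  define P1 where "P1 = {X \<in> p1. Abar X = l *\<^sub>R X}"
  define P2 where "P2 = {X \<in> p2. Abar X = k *\<^sub>R X}"
  have s: "subspace P1" "subspace P2"
    using sub(4,5) unfolding P1_def P2_def subspace_def
    by (simp_all add: linear_0[OF linear_Abar] linear_add[OF linear_Abar] linear_scale[OF linear_Abar] scaleR_add_right)
  have "bracket G W X \<in> P1" if "W \<in> LL" "X \<in> P1" for W X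
    using that LL_ad(1)[OF that(1)] eigen_submodules(1)[OF that(1)] unfolding P1_def by blast
  moreover have "bracket G W X \<in> P2" if "W \<in> LL" "X \<in> P2" for W X
    using that LL_ad(2)[OF that(1)] eigen_submodules(2)[OF that(1)] unfolding P2_def by blast
  ultimately have "ad_submodule G (span (hh \<union> qq)) P1" "ad_submodule G (span (hh \<union> qq)) P2"
    unfolding ad_submodule_def using s LL_span by blast+
  moreover have "P1 \<noteq> {0}" "P2 \<noteq> {0}" using X Y by (auto simp: P1_def P2_def)
  moreover have "P1 \<subseteq> p1" "P2 \<subseteq> p2" by (auto simp: P1_def P2_def)
  moreover have "\<forall>X\<in>P1. \<forall>Y\<in>P2. bracket G X Y = 0"
    using commuting_eigenvectors ne by (auto simp: P1_def P2_def)
  ultimately show False using nocomm by blast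
qed

text \<open>An eigenvector in \<open>p1\<close> fixes the eigenvalue on all of \<open>p2\<close>,
  and a nonzero vector of \<open>p2\<close> then carries it back to all of
  \<open>p1\<close>.\<close>

lemma scalar_p:
  obtains k where "\<And>X. X \<in> p1 \<Longrightarrow> Abar X = k *\<^sub>R X" "\<And>X. X \<in> p2 \<Longrightarrow> Abar X = k *\<^sub>R X"
proof -
  obtain X k where X: "X \<in> p1" "X \<noteq> 0" "Abar X = k *\<^sub>R X"
    using eigenvector_exists[OF sub(4) p1_nonzero Abar_pres(1)] by blast
  have 2: "Abar Y = k *\<^sub>R Y" if "Y \<in> p2" for Y
    by (rule scalar_of_eigenvectors[OF sub(5) Abar_pres(2) _ that]) (assumption, rule equal_eigenvalues[OF X, symmetric])
  obtain Y where Y: "Y \<in> p2" "Y \<noteq> 0" using p2_nonzero subspace_0[OF sub(5)] by blast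
  have 1: "Abar X = k *\<^sub>R X" if "X \<in> p1" for X
    by (rule scalar_of_eigenvectors[OF sub(4) Abar_pres(1) _ that])
      (assumption, rule equal_eigenvalues[OF _ _ _ Y 2[OF Y(1)]])
  show ?thesis by (rule that[OF 1 2])
qed

lemma scalar_n:
  assumes k: "\<And>X. X \<in> p1 \<Longrightarrow> Abar X = k *\<^sub>R X" "\<And>X. X \<in> p2 \<Longrightarrow> Abar X = k *\<^sub>R X" and "X \<in> nn"
  shows "Abar X = k *\<^sub>R X"
proof (rule scalar_of_eigenvectors[OF sub(6) Abar_pres(3) _ assms(3)])
  fix N m assume N: "N \<in> nn" "N \<noteq> 0" "Abar N = m *\<^sub>R N"
  show "m = k"
  proof (rule ccontr)
    assume "m \<noteq> k"
    then have ne: "k \<noteq> m" by simp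
    define E where "E = {Y \<in> nn. Abar Y = m *\<^sub>R Y}"
    have sE: "subspace E"
      using sub(6) unfolding E_def subspace_def
      by (simp add: linear_0[OF linear_Abar] linear_add[OF linear_Abar] linear_scale[OF linear_Abar] scaleR_add_right)
    have LE: "bracket G W Y \<in> E" if "W \<in> LL" "Y \<in> E" for W Y
      using LL_ad(3)[OF that(1)] eigen_submodules(3)[OF that(1)] that(2) by (auto simp: E_def)
    \<comment> \<open>The geodesic condition leaves an unwanted term \<open>bracket G Z X\<close>.
      It is orthogonal to the other term, which is in \<open>nn\<close>, and to
      \<open>bracket G X Y\<close>, since \<open>bracket G X (bracket G Z X)\<close> stays in one of
      the subalgebras. Hence it is 0.\<close>
    have pE: "bracket G X Y \<in> E" if X: "X \<in> p1 \<or> X \<in> p2" and Y: "Y \<in> E" for X Y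
    proof -
      have X': "Abar X = k *\<^sub>R X" "X \<in> mm" using X k pieces(6,7) by blast+
      have Y': "Abar Y = m *\<^sub>R Y" "Y \<in> nn" using Y unfolding E_def by blast+
      have Ym: "Y \<in> mm" using Y'(2) pieces(8) by blast
      obtain Z Z' where Z: "Z \<in> hh" "Z' \<in> hh" "bracket G X Y = bracket G Z X + bracket G Z' Y"
        using GO_eigen_bracket[OF GO X'(2,1) Ym Y'(1) ne] by blast
      have ZL: "Z \<in> LL" "Z' \<in> LL" using Z hh_kk by auto
      have U2: "bracket G Z' Y \<in> E" by (rule LE[OF ZL(2) Y])
      then have U2': "bracket G Z' Y \<in> nn" unfolding E_def by blast
      have "b (bracket G X Y) (bracket G Z X) = 0" "b (bracket G Z X) (bracket G Z' Y) = 0"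
      proof -
        have "bracket G X (bracket G Z X) \<in> kk \<or> bracket G X (bracket G Z X) \<in> kk'"
          using X
        proof
          assume "X \<in> p1"
          then have "X \<in> kk" "bracket G Z X \<in> kk" using LL_ad(1)[OF ZL(1)] pieces(3) by blast+
          then show ?thesis using bracket_kk(1) by blast
        next
          assume "X \<in> p2"
          then have "X \<in> kk'" "bracket G Z X \<in> kk'" using LL_ad(2)[OF ZL(1)] pieces(4) by blast+
          then show ?thesis using bracket_kk(2) by blast
        qed
        then have "b Y (bracket G X (bracket G Z X)) = 0" using perp(3,4)[OF Y'(2)] by blast
        then show "b (bracket G X Y) (bracket G Z X) = 0" by (simp add: b_bracket)
        show "b (bracket G Z X) (bracket G Z' Y) = 0"
          using X LL_ad(1,2)[OF ZL(1)] orth(5,6)[OF _ U2'] by blast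
      qed
      then have "b (bracket G Z X) (bracket G Z X) = 0"
        unfolding Z(3) using b_sym[of "bracket G Z' Y" "bracket G Z X"] by (simp add: b_simps)
      then have "bracket G Z X = 0" by (rule b_zero)
      then show ?thesis using Z(3) U2 by simp
    qed
    \<comment> \<open>The normaliser of \<open>E\<close>. It is a subalgebra by the Jacobi identity,
      which extends invariance from the two subalgebras to everything they generate.\<close>
    define K where "K = {W. \<forall>Y\<in>E. bracket G W Y \<in> E}"
    have addE: "bracket G (W + W') Y \<in> E" if "bracket G W Y \<in> E" "bracket G W' Y \<in> E" for W W' Y
      using that subspace_add[OF sE] by (simp add: bracket_simps)
    have decomp: "W \<in> K" if W: "W \<in> kk \<or> W \<in> kk'" for W
      unfolding K_def
    proof (intro CollectI ballI)
      fix Y assume Y: "Y \<in> E"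
      have "\<exists>Q X. Q \<in> qq \<and> (X \<in> p1 \<or> X \<in> p2) \<and> pm W = Q + X"
        using W kkE(1)[OF pm_kk(1)] kkE(2)[OF pm_kk(2)] by blast
      then obtain Q X where Q: "Q \<in> qq" and X: "X \<in> p1 \<or> X \<in> p2" and pmW: "pm W = Q + X" by blast
      have "bracket G (W - pm W) Y \<in> E" using hh_kk pm(2)[of W] by (intro LE Y) auto
      moreover have "bracket G Q Y \<in> E" using Q pieces by (intro LE Y) auto
      ultimately have "bracket G ((W - pm W) + (Q + X)) Y \<in> E" using pE[OF X Y] by (intro addE)
      then have "bracket G ((W - pm W) + pm W) Y \<in> E" by (simp only: pmW)
      then show "bracket G W Y \<in> E" by simp
    qed
    have "lie_subalgebra G K"
      unfolding lie_subalgebra_def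
    proof (intro conjI ballI)
      show "subspace K" unfolding K_def subspace_def
        using sE by (auto simp: bracket_simps subspace_0 subspace_add subspace_scale)
      fix V W assume VW: "V \<in> K" "W \<in> K"
      have "bracket G (bracket G V W) Y = bracket G V (bracket G W Y) - bracket G W (bracket G V Y)" for Y
        using jacobi[of V W Y] by simp
      then show "bracket G V W \<in> K" using VW sE unfolding K_def by (auto intro: subspace_diff)
    qed
    then have K: "K = UNIV" by (rule generated) (use decomp in auto)
    \<comment> \<open>Closed under brackets since \<open>ad\<close> is skew and \<open>E\<close> is
      an ideal. Once \<open>F\<close> is everything, it contains \<open>N\<close>, which becomes
      orthogonal to itself.\<close>
    define F where "F = {V. \<forall>Y\<in>E. b V Y = 0}"
    have "lie_subalgebra G F"
      unfolding lie_subalgebra_def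
    proof (intro conjI ballI)
      show "subspace F" unfolding F_def subspace_def by (auto simp: b_simps)
      fix V W assume "V \<in> F" "W \<in> F"
      moreover have "bracket G V Y \<in> E" if "Y \<in> E" for Y using K that unfolding K_def by blast
      ultimately show "bracket G V W \<in> F" unfolding F_def by (simp add: b_bracket)
    qed
    then have "F = UNIV"
    proof (rule generated)
      have "b V Y = 0" if "V \<in> kk \<or> V \<in> kk'" "Y \<in> E" for V Y
        using perp(3,4)[of Y V] that b_sym[of V Y] by (auto simp: E_def)
      then show "kk \<subseteq> F" "kk' \<subseteq> F" unfolding F_def by blast+
    qed
    then have "b N N = 0" using N by (auto simp: F_def E_def)
    then show False using N(2) b_zero by blast
  qed
qed

lemma scalar_on_p_n: "scalar_on (span (p1 \<union> p2 \<union> nn)) A"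
proof -
  obtain k where k: "\<And>X. X \<in> p1 \<Longrightarrow> Abar X = k *\<^sub>R X" "\<And>X. X \<in> p2 \<Longrightarrow> Abar X = k *\<^sub>R X"
    by (rule scalar_p) (rule that)
  have "subspace {X \<in> mm. Abar X = k *\<^sub>R X}"
    using subspace_orth[of hh] unfolding subspace_def
    by (simp add: linear_0[OF linear_Abar] linear_add[OF linear_Abar] linear_scale[OF linear_Abar] scaleR_add_right)
  moreover have "p1 \<union> p2 \<union> nn \<subseteq> {X \<in> mm. Abar X = k *\<^sub>R X}" using k scalar_n[OF k] pieces by auto
  ultimately have "span (p1 \<union> p2 \<union> nn) \<subseteq> {X \<in> mm. Abar X = k *\<^sub>R X}" by (intro span_minimal)
  then have "A X = k *\<^sub>R X" if "X \<in> span (p1 \<union> p2 \<union> nn)" for X using that by (auto simp: Abar_def)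
  then show ?thesis unfolding scalar_on_def by blast
qed

end

end

text \<open>A form of Schur's lemma. \<open>Abar\<close> followed by the projection to
  \<open>W\<close> is an intertwining map from \<open>V\<close> to \<open>W\<close>; unless it
  vanishes, it identifies a nonzero submodule of \<open>V\<close> with one of
  \<open>W\<close>.\<close>

lemma nonequivalent_orthogonal:
  assumes V: "Ad_submodule G H V" and W: "Ad_submodule G H W" and ne: "strictly_nonequivalent G H V W"
    and X: "X \<in> V" and Y: "Y \<in> W"
  shows "b (Abar X) Y = 0"
proof -
  have sV: "subspace V" "\<And>h X. h \<in> H \<Longrightarrow> X \<in> V \<Longrightarrow> Ad G h X \<in> V"
    and sW: "subspace W" "\<And>h X. h \<in> H \<Longrightarrow> X \<in> W \<Longrightarrow> Ad G h X \<in> W"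
    using V W unfolding Ad_submodule_def by auto
  have Ad_orth: "Ad G h Z \<in> orth_complement b S"
    if "h \<in> H" "Z \<in> orth_complement b S" "\<And>h X. h \<in> H \<Longrightarrow> X \<in> S \<Longrightarrow> Ad G h X \<in> S" for h Z S
    using that H_inv H_carrier unfolding orth_complement_def by (simp add: b_Ad_left)
  define pr where "pr X = (SOME P. P \<in> W \<and> X - P \<in> orth_complement b W)" for X
  have pr: "pr X \<in> W" "X - pr X \<in> orth_complement b W" for X
    using someI_ex[of "\<lambda>P. P \<in> W \<and> X - P \<in> orth_complement b W"] orth_decomp_exists[OF sW(1), of X]
    unfolding pr_def by blast+
  have pr_eq: "pr X = P" if P: "P \<in> W" "X - P \<in> orth_complement b W" for X P
  proof -
    have "P - pr X \<in> W" using P(1) pr(1) sW(1) subspace_diff by blast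
    moreover have "(X - pr X) - (X - P) \<in> orth_complement b W"
      using P(2) pr(2) subspace_orth subspace_diff by blast
    ultimately have "P - pr X = 0" using orth_zero[of "P - pr X" W] by simp
    then show ?thesis by simp
  qed
  have linpr: "linear pr"
  proof (rule linearI)
    fix X Y :: 'e and r :: real
    have "(X - pr X) + (Y - pr Y) \<in> orth_complement b W" by (intro subspace_add subspace_orth pr)
    then show "pr (X + Y) = pr X + pr Y"
      by (intro pr_eq subspace_add sW pr) (simp add: algebra_simps)
    have "r *\<^sub>R (X - pr X) \<in> orth_complement b W" by (intro subspace_scale subspace_orth pr)
    then show "pr (r *\<^sub>R X) = r *\<^sub>R pr X"
      by (intro pr_eq subspace_scale sW pr) (simp add: algebra_simps)
  qed
  have pr_Ad: "pr (Ad G h X) = Ad G h (pr X)" if "h \<in> H" for h X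
  proof (rule pr_eq)
    show "Ad G h (pr X) \<in> W" by (intro sW that pr)
    have "Ad G h (X - pr X) \<in> orth_complement b W" by (rule Ad_orth[OF that pr(2) sW(2)])
    then show "Ad G h X - Ad G h (pr X) \<in> orth_complement b W"
      using linear_diff[OF linear_Ad[OF H_carrier[OF that]]] by simp
  qed
  define f where "f X = pr (Abar X)" for X
  have linf: "linear f" unfolding f_def using linear_compose[OF linear_Abar linpr] by (simp add: o_def)
  have f_Ad: "f (Ad G h X) = Ad G h (f X)" if "h \<in> H" for h X
    unfolding f_def using that by (simp add: Abar_Ad pr_Ad)
  define K where "K = {X \<in> V. f X = 0}"
  have sK: "subspace K"
    using sV(1) unfolding K_def subspace_def
    by (simp add: linear_0[OF linf] linear_add[OF linf] linear_scale[OF linf])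
  have KAd: "Ad G h X \<in> K" if "h \<in> H" "X \<in> K" for h X
    using that sV(2) linear_0[OF linear_Ad[OF H_carrier]] unfolding K_def by (auto simp: f_Ad)
  \<comment> \<open>The complement of the kernel stands in for the quotient: it is again a
    submodule, and the intertwining map is injective on it.\<close>
  define V' where "V' = V \<inter> orth_complement b K"
  have V'_Ad: "Ad_submodule G H V'"
    unfolding Ad_submodule_def V'_def using sV Ad_orth[OF _ _ KAd]
    by (auto intro: subspace_inter subspace_orth)
  have sV': "subspace V'" using V'_Ad unfolding Ad_submodule_def by blast
  have W'_Ad: "Ad_submodule G H (f ` V')"
    unfolding Ad_submodule_def
  proof (intro conjI ballI)
    show "subspace (f ` V')" by (rule linear_subspace_image[OF linf sV'])
    fix h Y assume h: "h \<in> H" and "Y \<in> f ` V'"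
    then obtain U where U: "U \<in> V'" "Y = f U" by blast
    have "Ad G h U \<in> V'" using V'_Ad h U(1) unfolding Ad_submodule_def by blast
    then show "Ad G h Y \<in> f ` V'" unfolding U(2) f_Ad[OF h, symmetric] by (rule imageI)
  qed
  have inj: "inj_on f V'"
    unfolding linear_injective_on_subspace_0[OF linf sV']
  proof (intro ballI impI)
    fix U assume "U \<in> V'" "f U = 0"
    then have "U \<in> K" "U \<in> orth_complement b K" unfolding V'_def K_def by blast+
    then show "U = 0" by (rule orth_zero)
  qed
  have "Ad_equivalent G H V' (f ` V')"
    unfolding Ad_equivalent_def
    by (intro exI[of _ f] conjI ballI f_Ad)
      (use inj in \<open>auto simp: linear_on_def linear_add[OF linf] linear_scale[OF linf] bij_betw_def\<close>)
  moreover have "f ` V' \<subseteq> W" unfolding f_def using pr(1) by blast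
  moreover have "V' \<subseteq> V" unfolding V'_def by blast
  ultimately have z: "V' = {0} \<or> f ` V' = {0}"
    using ne V'_Ad W'_Ad unfolding strictly_nonequivalent_def by blast
  have V'0: "V' = {0}"
  proof (rule ccontr)
    assume "V' \<noteq> {0}"
    then obtain U where U: "U \<in> V'" "U \<noteq> 0" using subspace_0[OF sV'] by blast
    have "f ` V' = {0}" using z by (rule disjE) (use \<open>V' \<noteq> {0}\<close> in simp_all)
    with imageI[OF U(1), of f] have "f U = f 0" by (simp only: linear_0[OF linf] singleton_iff)
    from inj_onD[OF inj this U(1) subspace_0[OF sV']] U(2) show False by simp
  qed
  obtain P where P: "P \<in> K" "X - P \<in> orth_complement b K" by (rule orth_decompE[OF sK]) (rule that)
  have "P \<in> V" using P(1) unfolding K_def by blast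
  then have "X - P \<in> V'" unfolding V'_def by (intro IntI P(2) subspace_diff[OF sV(1) X])
  then have "X = P" using V'0 by simp
  then have "pr (Abar X) = 0" using P(1) by (simp add: K_def f_def)
  then have "Abar X \<in> orth_complement b W" using pr(2)[of "Abar X"] by simp
  then show ?thesis using Y by (rule orth_complementD)
qed

text \<open>Invariance of the pieces under \<open>A\<close> is not given here. It follows because
  pairwise disjointness makes \<open>Abar\<close> of each piece orthogonal to the other two.\<close>

lemma GO_iff_scalar:
  assumes q0: "qq = {0}" and Ads: "Ad_submodule G H p1" "Ad_submodule G H p2" "Ad_submodule G H nn"
    and ne: "strictly_nonequivalent G H p1 p2" "strictly_nonequivalent G H p1 nn" "strictly_nonequivalent G H p2 nn"
  shows "GO_metric G H mm gA \<longleftrightarrow> scalar_on mm A"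
proof
  assume GO: "GO_metric G H mm gA"
  note o12 = nonequivalent_orthogonal[OF Ads(1,2) ne(1)]
  note o1n = nonequivalent_orthogonal[OF Ads(1,3) ne(2)]
  note o2n = nonequivalent_orthogonal[OF Ads(2,3) ne(3)]
  have o21: "b (Abar X) Y = 0" if "X \<in> p2" "Y \<in> p1" for X Y
    using o12[OF that(2,1)] Abar_sym b_sym by metis
  have on1: "b (Abar X) Y = 0" if "X \<in> nn" "Y \<in> p1" for X Y
    using o1n[OF that(2,1)] Abar_sym b_sym by metis
  have on2: "b (Abar X) Y = 0" if "X \<in> nn" "Y \<in> p2" for X Y
    using o2n[OF that(2,1)] Abar_sym b_sym by metis
  \<comment> \<open>The recorded products identify components: when \<open>Abar X\<close> is
    orthogonal to a piece, the square of its component there is 0.\<close>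
  have dec: "\<exists>X1\<in>p1. \<exists>X2\<in>p2. \<exists>N\<in>nn. Abar X = X1 + X2 + N \<and> b (Abar X) X1 = b X1 X1 \<and>
      b (Abar X) X2 = b X2 X2 \<and> b (Abar X) N = b N N" for X
  proof -
    obtain X1 X2 N where d: "X1 \<in> p1" "X2 \<in> p2" "N \<in> nn" "Abar X = X1 + X2 + N"
      using mmE[OF Abar_mm, of X] q0 by (auto simp: add.assoc)
    have "b (Abar X) X1 = b X1 X1" "b (Abar X) X2 = b X2 X2" "b (Abar X) N = b N N"
      unfolding d(4) using orth(4)[OF d(1,2)] orth(5)[OF d(1,3)] orth(6)[OF d(2,3)] b_sym
      by (simp_all add: b_simps)
    then show ?thesis using d by blast
  qed
  have 1: "A ` p1 \<subseteq> p1"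
  proof (rule image_subsetI)
    fix X assume X: "X \<in> p1"
    then have XA: "A X = Abar X" using pieces by (auto simp: Abar_def)
    obtain X1 X2 N where d: "X1 \<in> p1" "X2 \<in> p2" "N \<in> nn" "Abar X = X1 + X2 + N"
      "b (Abar X) X2 = b X2 X2" "b (Abar X) N = b N N" using dec by blast
    have "X2 = 0" "N = 0" using o12[OF X d(2)] o1n[OF X d(3)] d b_zero by auto
    then show "A X \<in> p1" using d XA by simp
  qed
  have 2: "A ` p2 \<subseteq> p2"
  proof (rule image_subsetI)
    fix X assume X: "X \<in> p2"
    then have XA: "A X = Abar X" using pieces by (auto simp: Abar_def)
    obtain X1 X2 N where d: "X1 \<in> p1" "X2 \<in> p2" "N \<in> nn" "Abar X = X1 + X2 + N"
      "b (Abar X) X1 = b X1 X1" "b (Abar X) N = b N N" using dec by blast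
    have "X1 = 0" "N = 0" using o21[OF X d(1)] o2n[OF X d(3)] d b_zero by auto
    then show "A X \<in> p2" using d XA by simp
  qed
  have 3: "A ` nn \<subseteq> nn"
  proof (rule image_subsetI)
    fix X assume X: "X \<in> nn"
    then have XA: "A X = Abar X" using pieces by (auto simp: Abar_def)
    obtain X1 X2 N where d: "X1 \<in> p1" "X2 \<in> p2" "N \<in> nn" "Abar X = X1 + X2 + N"
      "b (Abar X) X1 = b X1 X1" "b (Abar X) X2 = b X2 X2" using dec by blast
    have "X1 = 0" "X2 = 0" using on1[OF X d(1)] on2[OF X d(2)] d b_zero by auto
    then show "A X \<in> nn" using d XA by simp
  qed
  have "mm = span (p1 \<union> p2 \<union> nn)"
    unfolding span_mm q0 by (simp add: Un_assoc)
  then show "scalar_on mm A" using scalar_on_p_n[OF GO 1 2 3] by simp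
qed (rule normal_metric_GO)

end

theorem proposition7:
  fixes G :: "('a::t2_space, 'e::euclidean_space) lie_structure"
    and H :: "'a set"
    and b :: "'e \<Rightarrow> 'e \<Rightarrow> real"
    and \<hh> \<mm> \<kk> \<kk>' \<pp> \<pp>' \<qq> \<pp>1 \<pp>2 \<nn> :: "'e set"
  assumes "lie_group G" and "compact (carrier G)" and "connected (carrier G)"
    and "subgroup H G" and "closedin (top_of_set (carrier G)) H"
    and "Ad_invariant_inner G b"
    and "\<hh> = lie_algebra_of G H" and "\<mm> = orth_complement b \<hh>"
    and "lie_subalgebra G \<kk>" and "lie_subalgebra G \<kk>'"
    and "\<kk> \<noteq> UNIV" and "\<kk>' \<noteq> UNIV"
    and "\<hh> \<subseteq> \<kk>" and "\<hh> \<subseteq> \<kk>'"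
    and "generate_lie_algebra G (\<kk> \<union> \<kk>')"
    and "\<pp> = \<kk> \<inter> \<mm>" and "\<pp>' = \<kk>' \<inter> \<mm>" and "\<qq> = \<pp> \<inter> \<pp>'"
    and "orth_decomposition b \<pp> [\<qq>, \<pp>1]" and "orth_decomposition b \<pp>' [\<qq>, \<pp>2]"
    and "\<nn> = \<mm> \<inter> orth_complement b (\<pp> \<union> \<pp>')"
    and "orth_decomposition b \<mm> [\<qq>, \<pp>1, \<pp>2, \<nn>]"
    and "\<not> (\<exists>P1 P2. P1 \<subseteq> \<pp>1 \<and> P2 \<subseteq> \<pp>2 \<and> P1 \<noteq> {0} \<and> P2 \<noteq> {0} \<and>
            ad_submodule G (span (\<hh> \<union> \<qq>)) P1 \<and> ad_submodule G (span (\<hh> \<union> \<qq>)) P2 \<and>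
            (\<forall>X\<in>P1. \<forall>Y\<in>P2. bracket G X Y = 0))"
  shows "(\<forall>A. metric_endomorphism G H b \<mm> A \<and> GO_metric G H \<mm> (endo_metric b A) \<and>
             A ` \<qq> \<subseteq> \<qq> \<and> A ` \<pp>1 \<subseteq> \<pp>1 \<and> A ` \<pp>2 \<subseteq> \<pp>2 \<and> A ` \<nn> \<subseteq> \<nn> \<longrightarrow>
             scalar_on (span (\<pp>1 \<union> \<pp>2 \<union> \<nn>)) A) \<and>
         (\<qq> = {0} \<and>
         Ad_submodule G H \<pp>1 \<and> Ad_submodule G H \<pp>2 \<and> Ad_submodule G H \<nn> \<and>
         strictly_nonequivalent G H \<pp>1 \<pp>2 \<and> strictly_nonequivalent G H \<pp>1 \<nn> \<and>
         strictly_nonequivalent G H \<pp>2 \<nn> \<longrightarrow>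
         (\<forall>A. metric_endomorphism G H b \<mm> A \<longrightarrow>
              (GO_metric G H \<mm> (endo_metric b A) \<longleftrightarrow> scalar_on \<mm> A)))"
proof -
  note eqs = assms(16,17) assms(8) assms(7)
  have S: "splitting G H b \<kk> \<kk>' \<qq> \<pp>1 \<pp>2 \<nn>"
  proof (intro splitting.intro hom_space.intro lie_closed_subgroup.intro lie_grp.intro
      splitting_axioms.intro hom_space_axioms.intro lie_closed_subgroup_axioms.intro, goal_cases)
    case 1 show ?case by (rule assms)
  next case 2 show ?case by (rule assms)
  next case 3 show ?case by (rule assms)
  next case 4 show ?case by (rule assms)
  next case 5 show ?case by (rule assms)
  next case 6 show ?case by (rule assms)
  next case 7 show ?case by (rule assms)
  next case 8 show ?case by (rule assms)
  next case 9 show ?case using assms(13) by (simp only: eqs)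
  next case 10 show ?case using assms(14) by (simp only: eqs)
  next case 11 show ?case by (rule assms)
  next case 12 show ?case using assms(18) by (simp only: eqs)
  next case 13 show ?case using assms(19) by (simp only: eqs)
  next case 14 show ?case using assms(20) by (simp only: eqs)
  next case 15 show ?case using assms(21) by (simp only: eqs)
  next case 16 show ?case using assms(22) by (simp only: eqs)
  next case 17 show ?case by (rule assms(23)[unfolded eqs])
  qed
  have R: "splitting_metric G H b \<kk> \<kk>' \<qq> \<pp>1 \<pp>2 \<nn> A" if "metric_endomorphism G H b \<mm> A" for A
  proof -
    interpret splitting G H b \<kk> \<kk>' \<qq> \<pp>1 \<pp>2 \<nn> by (rule S)
    show ?thesis by unfold_locales (use that in \<open>simp only: eqs\<close>)
  qed
  have m: "\<mm> = orth_complement b (lie_algebra_of G H)" by (simp only: eqs)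
  show ?thesis
  proof (intro conjI allI impI, goal_cases)
    case (1 A)
    then show ?case
      using splitting_metric.scalar_on_p_n[OF R, of A] unfolding m by blast
  next
    case (2 A)
    then show ?case
      using splitting_metric.GO_iff_scalar[OF R, of A] unfolding m by blast
  qed
qed

end
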